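(* There exist two total computable sequence-set betting strategies $R_1=(m_1,S_1)$ and $R_2=(m_2,S_2)$ such that for every infinite binary sequence $\alpha\in\{0,1\}^{\infty}$ that is not Martin-Löf random, at least one of $R_1,R_2$ succeeds on $\alpha$.
   Context: Words are finite binary strings, $\epsilon$ is the empty word, $\{0,1\}^{\infty}$ is Cantor space with Lebesgue (uniform) measure $\lambda$. For a word $v$, $v\{0,1\}^{\infty}$ is the cylinder of sequences extending $v$; a clopen set is a finite union of disjoint cylinders (represented finitely by a finite set of words). A sequence-partition function $sp$ is a possibly partial map from words to clopen sets with $sp(\epsilon)=\{0,1\}^{\infty}$ such that for each word $v$ either $sp(v0),sp(v1)$ are both undefined, or both are defined with $sp(v)=sp(v0)\cup sp(v1)$ and $sp(v0)\cap sp(v1)=\emptyset$. A sequence-set function $S$ is a sequence-partition function with the additional requirement that whenever $S(v0),S(v1)$ are defined, $\lambda(S(v0))=\lambda(S(v1))$. A mass function $m$ is a nonnegative, possibly partial map from words to rationals such that for each word $v$ either $m(v0),m(v1)$ are both undefined or both defined with $m(v)=m(v0)+m(v1)$. A betting strategy is a pair $R=(m,sp)$ of a mass function and a sequence-partition function; it is a sequence-set betting strategy if $sp$ is a sequence-set function. $R$ is total if $m$ and $sp$ are defined on all words, and computable if both functions are computable. $R$ succeeds on $\alpha$ if there is an infinite sequence of words $v_1,v_2,\ldots$ with $\alpha\in sp(v_i)$ and $m(v_i)/\lambda(sp(v_i))>i$ for all $i$. *)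

theory Defs
  imports "HOL-Probability.Probability" "HOL-Library.Nat_Bijection"
begin

text \<open>Bits are booleans (\<open>0\<close> is \<^term>\<open>False\<close>, \<open>1\<close> is \<^term>\<open>True\<close>), so the
  one-bit extensions of \<open>v\<close> are \<open>v @ [False]\<close> and \<open>v @ [True]\<close>.\<close>

type_synonym word = "bool list"
type_synonym seq = "nat \<Rightarrow> bool"

definition cylinder :: "word \<Rightarrow> seq set" where
  "cylinder v = {\<alpha>. \<forall>i<length v. \<alpha> i = v ! i}"

definition cantor_measure :: "seq measure" where
  "cantor_measure = (\<Pi>\<^sub>M i\<in>UNIV. measure_pmf (bernoulli_pmf (1/2)))"

abbreviation lam :: "seq set \<Rightarrow> real" where
  "lam A \<equiv> measure cantor_measure A"

definition represents :: "word set \<Rightarrow> seq set \<Rightarrow> bool" where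
  "represents W C \<longleftrightarrow> finite W \<and> disjoint_family_on cylinder W \<and> C = (\<Union>w\<in>W. cylinder w)"

definition clopen :: "seq set \<Rightarrow> bool" where
  "clopen C \<longleftrightarrow> (\<exists>W. represents W C)"

definition minimize :: "(nat \<Rightarrow> nat option) \<Rightarrow> nat option" where
  "minimize f =
    (if \<exists>k. f k = Some 0 \<and> (\<forall>j<k. \<exists>y. f j = Some (Suc y))
     then Some (LEAST k. f k = Some 0) else None)"

text \<open>Kleene's partial recursive functions in their unary presentation: finite argument
  tuples are passed as a single number through the Cantor pairing bijection
  \<^const>\<open>prod_encode\<close>.  \<^term>\<open>None\<close> stands for divergence, and every scheme is strict.
  Minimisation requires all values below the least zero to be defined.\<close>

inductive partrec :: "(nat \<Rightarrow> nat option) \<Rightarrow> bool" where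
  zero: "partrec (\<lambda>_. Some 0)"
| succ: "partrec (\<lambda>n. Some (Suc n))"
| proj1: "partrec (\<lambda>n. Some (fst (prod_decode n)))"
| proj2: "partrec (\<lambda>n. Some (snd (prod_decode n)))"
| pair: "partrec f \<Longrightarrow> partrec g \<Longrightarrow>
    partrec (\<lambda>n. Option.bind (f n) (\<lambda>a. Option.bind (g n) (\<lambda>b. Some (prod_encode (a, b)))))"
| comp: "partrec f \<Longrightarrow> partrec g \<Longrightarrow> partrec (\<lambda>n. Option.bind (g n) f)"
| prim_rec: "partrec f \<Longrightarrow> partrec g \<Longrightarrow>
    partrec (\<lambda>n. case prod_decode n of (a, m) \<Rightarrow>
      rec_nat (f a) (\<lambda>k r. Option.bind r (\<lambda>i. g (prod_encode (a, prod_encode (k, i))))) m)"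
| mu: "partrec f \<Longrightarrow> partrec (\<lambda>a. minimize (\<lambda>k. f (prod_encode (a, k))))"

definition ce :: "nat set \<Rightarrow> bool" where
  "ce A \<longleftrightarrow> (\<exists>\<phi>. partrec \<phi> \<and> A = dom \<phi>)"

definition word_code :: "word \<Rightarrow> nat" where
  "word_code w = list_encode (map of_bool w)"

text \<open>Every rational has a code, with denominator \<^term>\<open>Suc b\<close> to keep it nonzero.\<close>

definition rat_of_code :: "nat \<Rightarrow> rat" where
  "rat_of_code n = (case prod_decode n of (a, b) \<Rightarrow> of_int (int_decode a) / of_nat (Suc b))"

definition codes_clopen :: "nat \<Rightarrow> seq set \<Rightarrow> bool" where
  "codes_clopen n C \<longleftrightarrow> (\<exists>ws. n = list_encode (map word_code ws) \<and> represents (set ws) C)"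

text \<open>Partial maps on words have \<open>option\<close>-valued results; \<^term>\<open>None\<close> is ``undefined''.\<close>

definition mass_function :: "(word \<Rightarrow> rat option) \<Rightarrow> bool" where
  "mass_function m \<longleftrightarrow>
    (\<forall>v q. m v = Some q \<longrightarrow> 0 \<le> q) \<and>
    (\<forall>v. (m (v @ [False]) = None \<and> m (v @ [True]) = None) \<or>
         (\<exists>a b. m (v @ [False]) = Some a \<and> m (v @ [True]) = Some b \<and> m v = Some (a + b)))"

definition sequence_partition_function :: "(word \<Rightarrow> seq set option) \<Rightarrow> bool" where
  "sequence_partition_function sp \<longleftrightarrow>
    (\<forall>v C. sp v = Some C \<longrightarrow> clopen C) \<and>
    sp [] = Some UNIV \<and>
    (\<forall>v. (sp (v @ [False]) = None \<and> sp (v @ [True]) = None) \<or>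
         (\<exists>A B. sp (v @ [False]) = Some A \<and> sp (v @ [True]) = Some B \<and>
                sp v = Some (A \<union> B) \<and> A \<inter> B = {}))"

definition sequence_set_function :: "(word \<Rightarrow> seq set option) \<Rightarrow> bool" where
  "sequence_set_function S \<longleftrightarrow>
    sequence_partition_function S \<and>
    (\<forall>v A B. S (v @ [False]) = Some A \<longrightarrow> S (v @ [True]) = Some B \<longrightarrow> lam A = lam B)"

type_synonym strategy = "(word \<Rightarrow> rat option) \<times> (word \<Rightarrow> seq set option)"

definition betting_strategy :: "strategy \<Rightarrow> bool" where
  "betting_strategy R \<longleftrightarrow> mass_function (fst R) \<and> sequence_partition_function (snd R)"

definition sequence_set_betting_strategy :: "strategy \<Rightarrow> bool" where
  "sequence_set_betting_strategy R \<longleftrightarrow> betting_strategy R \<and> sequence_set_function (snd R)"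

definition total_strategy :: "strategy \<Rightarrow> bool" where
  "total_strategy R \<longleftrightarrow> (\<forall>v. fst R v \<noteq> None) \<and> (\<forall>v. snd R v \<noteq> None)"

definition computable_mass :: "(word \<Rightarrow> rat option) \<Rightarrow> bool" where
  "computable_mass m \<longleftrightarrow>
    (\<exists>\<phi>. partrec \<phi> \<and> (\<forall>v. m v = map_option rat_of_code (\<phi> (word_code v))))"

text \<open>\<^const>\<open>rel_option\<close> makes the algorithm converge exactly where \<open>sp\<close> is defined, with
  output a code for the value.\<close>

definition computable_partition :: "(word \<Rightarrow> seq set option) \<Rightarrow> bool" where
  "computable_partition sp \<longleftrightarrow>
    (\<exists>\<phi>. partrec \<phi> \<and> (\<forall>v. rel_option codes_clopen (\<phi> (word_code v)) (sp v)))"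

definition computable_strategy :: "strategy \<Rightarrow> bool" where
  "computable_strategy R \<longleftrightarrow> computable_mass (fst R) \<and> computable_partition (snd R)"

text \<open>The division is harmless: \<open>C\<close> is clopen and contains \<open>\<alpha>\<close>, hence has positive measure.\<close>

definition succeeds :: "strategy \<Rightarrow> seq \<Rightarrow> bool" where
  "succeeds R \<alpha> \<longleftrightarrow>
    (\<exists>v :: nat \<Rightarrow> word. \<forall>i\<ge>1. \<exists>q C. fst R (v i) = Some q \<and> snd R (v i) = Some C \<and>
       \<alpha> \<in> C \<and> of_rat q / lam C > real i)"

definition open_of :: "word set \<Rightarrow> seq set" where
  "open_of W = (\<Union>w\<in>W. cylinder w)"

definition uniformly_ce :: "(nat \<Rightarrow> word set) \<Rightarrow> bool" where
  "uniformly_ce V \<longleftrightarrow> ce {prod_encode (n, word_code w) | n w. w \<in> V n}"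

definition martin_loef_test :: "(nat \<Rightarrow> word set) \<Rightarrow> bool" where
  "martin_loef_test V \<longleftrightarrow> uniformly_ce V \<and> (\<forall>n. lam (open_of (V n)) \<le> (1/2) ^ n)"

definition martin_loef_random :: "seq \<Rightarrow> bool" where
  "martin_loef_random \<alpha> \<longleftrightarrow> (\<forall>V. martin_loef_test V \<longrightarrow> \<alpha> \<notin> (\<Inter>n. open_of (V n)))"

end

theory Submission
  imports Defs
begin

text \<open>
  Both strategies refine a partition of Cantor space into pieces of equal measure, bit by bit. In its
  current game a piece of the first strategy waits for some component \<open>U\<close> of a universal test of
  measure much smaller than the piece. When a part \<open>W\<close> of the piece is enumerated into \<open>U\<close>,
  the strategy moves mass from the rest of the piece to \<open>W\<close>, where its capital doubles and a new
  game begins. If this would cost more than half of the capital, the piece is stuck: the first strategy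
  stands aside and the second one bets on the whole piece instead. Since \<open>U\<close> is small, the stuck
  pieces have small total measure. When a piece is refined, it is mixed so evenly that the partitions of
  the two strategies remain nearly independent; hence stuck pieces occupy only a small fraction of every
  piece of the second strategy, which therefore is never stuck. A nonrandom sequence ends all of its
  games, so either it is stuck infinitely often and the second strategy doubles its capital infinitely
  often, or from some point on the first strategy wins every game.
\<close>

text \<open>Two demands fix the stake. During a game the capital may sink to half of
  \<open>base\<close>, so a won bet must multiply it by at least 4 for \<open>base\<close> to
  double. The same stake pays for conditioning: dropping K of N words concentrates the rest by N /
  (N - K), while the capital falls by (N - 4K) / N. So the dependence between pieces of the two
  trees is controlled by their losses of capital, a factor of at most 2 each. The obstacle is that a
  new game resets \<open>base\<close>, which erases the record of losses. At that moment only the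
  trivial bound by the size of a piece is available, so a game begun at depth q starts with a
  dependence factor 2^q. Its stuck pieces weigh 2^q times their measure for the second strategy.
  Hence the game waits for a component of measure (1/2)^(2q+9), which cancels this weight and leaves
  a summable remainder. The stakes of the second strategy are bounded through near independence,
  while the step that preserves near independence uses that the second strategy is not stuck; both
  are proved in one induction.\<close>

section \<open>Computable functions between encoded types\<close>

text \<open>Injectivity suffices because a function is judged by its action on codes of arguments;
  no arbitrary number has to be decoded.\<close>

class coded =
  fixes enc :: "'a \<Rightarrow> nat"
  assumes inj_enc: "inj enc"

lemma enc_eq_iff [simp]: "enc x = enc y \<longleftrightarrow> x = y"
  for x :: "'a :: coded"
  using inj_enc by (auto dest: injD)

instantiation nat :: coded
begin
definition enc_nat :: "nat \<Rightarrow> nat" where "enc_nat n = n"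
instance by standard (simp add: inj_def enc_nat_def)
end

instantiation bool :: coded
begin
definition enc_bool :: "bool \<Rightarrow> nat" where "enc_bool b = of_bool b"
instance by standard (simp add: inj_def enc_bool_def)
end

instantiation prod :: (coded, coded) coded
begin
definition enc_prod :: "'a \<times> 'b \<Rightarrow> nat" where "enc_prod p = prod_encode (enc (fst p), enc (snd p))"
instance by standard (simp add: inj_def enc_prod_def)
end

instantiation list :: (coded) coded
begin
definition enc_list :: "'a list \<Rightarrow> nat" where "enc_list xs = list_encode (map enc xs)"
instance
  by standard (auto simp: inj_def enc_list_def inj_map_eq_map inj_enc list_encode_eq)
end

lemma enc_list_simps [simp]:
  "enc [] = 0" "enc (x # xs) = Suc (prod_encode (enc x, enc xs))"
  by (simp_all add: enc_list_def)

definition comput :: "('a :: coded \<Rightarrow> 'b :: coded) \<Rightarrow> bool" where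
  "comput f \<longleftrightarrow> (\<exists>\<phi>. partrec \<phi> \<and> (\<forall>x. \<phi> (enc x) = Some (enc (f x))))"

text \<open>Used as introduction rules, these closure properties establish computability by following the
  syntax of a function; the variable bound by an inner abstraction is paired with the argument of the
  outer one.\<close>

named_theorems comput_intro

lemma comput_id [comput_intro]: "comput (\<lambda>x. x)"
proof -
  have "partrec Some"
    using partrec.pair[OF partrec.proj1 partrec.proj2] by (simp)
  then show ?thesis unfolding comput_def by auto
qed

lemma comput_comp: "comput f \<Longrightarrow> comput g \<Longrightarrow> comput (\<lambda>x. f (g x))"
  unfolding comput_def
proof (elim exE conjE)
  fix \<phi> \<psi> assume "partrec \<phi>" "partrec \<psi>" "\<forall>x. \<phi> (enc x) = Some (enc (f x))" "\<forall>x. \<psi> (enc x) = Some (enc (g x))"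
  then show "\<exists>\<phi>. partrec \<phi> \<and> (\<forall>x. \<phi> (enc x) = Some (enc (f (g x))))"
    by (intro exI[of _ "\<lambda>n. Option.bind (\<psi> n) \<phi>"]) (auto intro: partrec.comp)
qed

lemma comput_Pair [comput_intro]: "comput f \<Longrightarrow> comput g \<Longrightarrow> comput (\<lambda>x. (f x, g x))"
  unfolding comput_def
proof (elim exE conjE)
  fix \<phi> \<psi> assume "partrec \<phi>" "partrec \<psi>" "\<forall>x. \<phi> (enc x) = Some (enc (f x))" "\<forall>x. \<psi> (enc x) = Some (enc (g x))"
  then show "\<exists>\<phi>. partrec \<phi> \<and> (\<forall>x. \<phi> (enc x) = Some (enc (f x, g x)))"
    by (intro exI[of _ "\<lambda>n. Option.bind (\<phi> n) (\<lambda>a. Option.bind (\<psi> n) (\<lambda>b. Some (prod_encode (a, b))))"])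
       (auto intro: partrec.pair simp: enc_prod_def)
qed

lemma comput_fst [comput_intro]: "comput f \<Longrightarrow> comput (\<lambda>x. fst (f x))"
  by (rule comput_comp[where f=fst])
     (auto simp: comput_def enc_prod_def intro!: exI[of _ "\<lambda>n. Some (fst (prod_decode n))"] partrec.intros)

lemma comput_snd [comput_intro]: "comput f \<Longrightarrow> comput (\<lambda>x. snd (f x))"
  by (rule comput_comp[where f=snd])
     (auto simp: comput_def enc_prod_def intro!: exI[of _ "\<lambda>n. Some (snd (prod_decode n))"] partrec.intros)

lemma comput_comp2:
  "comput (\<lambda>p. f (fst p) (snd p)) \<Longrightarrow> comput g \<Longrightarrow> comput h \<Longrightarrow> comput (\<lambda>x. f (g x) (h x))"
  using comput_comp[of "\<lambda>p. f (fst p) (snd p)" "\<lambda>x. (g x, h x)"] by (simp add: comput_Pair)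

lemma comput_comp3:
  "comput (\<lambda>p. f (fst p) (fst (snd p)) (snd (snd p))) \<Longrightarrow> comput g \<Longrightarrow> comput h \<Longrightarrow> comput k
    \<Longrightarrow> comput (\<lambda>x. f (g x) (h x) (k x))"
  using comput_comp[of "\<lambda>p. f (fst p) (fst (snd p)) (snd (snd p))" "\<lambda>x. (g x, h x, k x)"]
  by (simp add: comput_Pair)

lemma comput_case_prod [comput_intro]:
  "comput (\<lambda>x. f x (fst (t x)) (snd (t x))) \<Longrightarrow> comput (\<lambda>x. case t x of (a, b) \<Rightarrow> f x a b)"
  by (simp add: case_prod_beta)

text \<open>Computability depends on codes alone. Maps that leave the code unchanged, such as
  \<open>prod_encode\<close> and \<open>prod_decode\<close>, are therefore computable at
  once.\<close>

lemma comput_by_code: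
  assumes "comput f" "\<And>x. enc (g x) = enc (f x)"
  shows "comput g"
  using assms unfolding comput_def by auto

lemma comput_enc [comput_intro]: "comput f \<Longrightarrow> comput (\<lambda>x. enc (f x))"
  by (erule comput_by_code) (simp add: enc_nat_def)

lemma comput_Suc [comput_intro]: "comput f \<Longrightarrow> comput (\<lambda>x. Suc (f x))"
proof (rule comput_comp[of Suc f])
  show "comput Suc"
    unfolding comput_def by (rule exI, rule conjI, rule partrec.succ) (simp add: enc_nat_def)
qed

lemma comput_const [comput_intro]: "comput (\<lambda>x. c)"
proof -
  have zero: "comput (\<lambda>x::'a. 0::nat)"
    unfolding comput_def by (rule exI, rule conjI, rule partrec.zero) (simp add: enc_nat_def)
  have "comput (\<lambda>x::'a. n)" for n :: nat
    by (induction n) (auto intro: zero comput_Suc)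
  from this[of "enc c"] show ?thesis
    by (rule comput_by_code) (simp add: enc_nat_def)
qed

lemma comput_rec_nat [comput_intro]:
  assumes f: "comput f" and g: "comput (\<lambda>p. g (fst p) (fst (snd p)) (snd (snd p)))" and m: "comput m"
  shows "comput (\<lambda>x. rec_nat (f x) (g x) (m x))"
proof -
  let ?g = "\<lambda>p. g (fst p) (fst (snd p)) (snd (snd p))"
  from f g obtain \<phi> \<psi> where \<phi>: "partrec \<phi>" "\<And>x. \<phi> (enc x) = Some (enc (f x))"
    and \<psi>: "partrec \<psi>" "\<And>x. \<psi> (enc x) = Some (enc (?g x))"
    unfolding comput_def by blast
  define h where "h n = (case prod_decode n of (a, m) \<Rightarrow>
      rec_nat (\<phi> a) (\<lambda>k r. Option.bind r (\<lambda>i. \<psi> (prod_encode (a, prod_encode (k, i))))) m)" for n :: nat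
  have "partrec h"
    unfolding h_def[abs_def] using \<phi>(1) \<psi>(1) by (rule partrec.prim_rec)
  moreover have "h (enc (x, n)) = Some (enc (rec_nat (f x) (g x) n))" for x n
  proof (induction n)
    case 0
    then show ?case by (simp add: h_def enc_prod_def \<phi> enc_nat_def)
  next
    case (Suc n)
    then show ?case using \<psi>(2)[of "(x, n, rec_nat (f x) (g x) n)"]
      by (simp add: h_def enc_prod_def \<phi> enc_nat_def)
  qed
  ultimately have "comput (\<lambda>p. rec_nat (f (fst p)) (g (fst p)) (snd p))"
    unfolding comput_def by auto
  from comput_comp[OF this comput_Pair[OF comput_id m]] show ?thesis by simp
qed

lemma comput_case_nat [comput_intro]:
  assumes "comput f" "comput (\<lambda>p. g (fst p) (snd p))" "comput m"
  shows "comput (\<lambda>x. case_nat (f x) (g x) (m x))"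
proof -
  have "comput (\<lambda>x. rec_nat (f x) (\<lambda>k r. g x k) (m x))"
    using assms(2) by (intro comput_intro assms comput_comp2[of g])
  moreover have "rec_nat (f x) (\<lambda>k r. g x k) (m x) = case_nat (f x) (g x) (m x)" for x
    by (cases "m x") auto
  ultimately show ?thesis by simp
qed

lemma comput_If [comput_intro]:
  assumes "comput b" "comput f" "comput g"
  shows "comput (\<lambda>x. if b x then f x else g x)"
proof -
  have "comput (\<lambda>x. case_nat (g x) (\<lambda>_. f x) (enc (b x)))"
    by (intro comput_intro assms comput_comp[OF assms(2)])
  moreover have "case_nat (g x) (\<lambda>_. f x) (enc (b x)) = (if b x then f x else g x)" for x
    by (simp add: enc_bool_def)
  ultimately show ?thesis by simp
qed

lemma comput_conj [comput_intro]: "comput b \<Longrightarrow> comput c \<Longrightarrow> comput (\<lambda>x. b x \<and> c x)"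
  by (rule comput_by_code[OF comput_If[of b c "\<lambda>_. False"]]) (simp_all add: comput_const)

lemma comput_not [comput_intro]: "comput b \<Longrightarrow> comput (\<lambda>x. \<not> b x)"
  by (rule comput_by_code[OF comput_If[of b "\<lambda>_. False" "\<lambda>_. True"]]) (simp_all add: comput_const)

lemma comput_disj [comput_intro]: "comput b \<Longrightarrow> comput c \<Longrightarrow> comput (\<lambda>x. b x \<or> c x)"
  by (rule comput_by_code[OF comput_If[of b "\<lambda>_. True" c]]) (simp_all add: comput_const)

lemma comput_Let [comput_intro]: "comput (\<lambda>x. f x (t x)) \<Longrightarrow> comput (\<lambda>x. let y = t x in f x y)"
  by simp

section \<open>Arithmetic and comparison\<close>

lemma comput_add [comput_intro]:
  fixes f :: "_ \<Rightarrow> nat"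
  assumes "comput f" "comput g" shows "comput (\<lambda>x. f x + g x)"
proof -
  have "comput (\<lambda>x. rec_nat (f x) (\<lambda>_. Suc) (g x))"
    by (intro comput_intro assms)
  moreover have "rec_nat a (\<lambda>_. Suc) b = a + b" for a b by (induction b) auto
  ultimately show ?thesis by simp
qed

lemma comput_diff [comput_intro]:
  fixes f :: "_ \<Rightarrow> nat"
  assumes "comput f" "comput g" shows "comput (\<lambda>x. f x - g x)"
proof -
  have "comput (\<lambda>x. rec_nat (f x) (\<lambda>_ r. case_nat 0 (\<lambda>k. k) r) (g x))"
    by (intro comput_intro assms)
  moreover have "rec_nat a (\<lambda>_ r. case_nat 0 (\<lambda>k. k) r) b = a - b" for a b
    by (induction b) (auto split: nat.splits)
  ultimately show ?thesis by simp
qed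

lemma comput_mult [comput_intro]:
  fixes f :: "_ \<Rightarrow> nat"
  assumes "comput f" "comput g" shows "comput (\<lambda>x. f x * g x)"
proof -
  have "comput (\<lambda>x. rec_nat 0 (\<lambda>_ r. r + f x) (g x))"
    by (intro comput_intro assms comput_comp[OF assms(1)])
  moreover have "rec_nat 0 (\<lambda>_ r. r + a) b = a * b" for a b by (induction b) auto
  ultimately show ?thesis by simp
qed

lemma comput_power [comput_intro]:
  fixes f :: "_ \<Rightarrow> nat"
  assumes "comput f" "comput g" shows "comput (\<lambda>x. f x ^ g x)"
proof -
  have "comput (\<lambda>x. rec_nat 1 (\<lambda>_ r. r * f x) (g x))"
    by (intro comput_intro assms comput_comp[OF assms(1)])
  moreover have "rec_nat 1 (\<lambda>_ r. r * a) b = a ^ b" for a b :: nat by (induction b) auto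
  ultimately show ?thesis by simp
qed

lemma comput_less [comput_intro]:
  fixes f :: "_ \<Rightarrow> nat"
  assumes "comput f" "comput g" shows "comput (\<lambda>x. f x < g x)"
proof -
  have "comput (\<lambda>x. case_nat False (\<lambda>_. True) (g x - f x))"
    by (intro comput_intro assms)
  moreover have "case_nat False (\<lambda>_. True) (a - b) = (b < a)" for a b :: nat
    by (auto split: nat.splits)
  ultimately show ?thesis by simp
qed

lemma comput_le [comput_intro]:
  fixes f :: "_ \<Rightarrow> nat"
  assumes "comput f" "comput g" shows "comput (\<lambda>x. f x \<le> g x)"
  unfolding not_less[symmetric] by (intro comput_intro assms)

lemma comput_eq [comput_intro]:
  assumes "comput f" "comput g" shows "comput (\<lambda>x. f x = g x)"
proof -
  have "comput (\<lambda>x. enc (f x) \<le> enc (g x) \<and> enc (g x) \<le> enc (f x))"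
    by (intro comput_intro assms)
  moreover have "(enc a \<le> enc b \<and> enc b \<le> enc a) = (a = b)" for a b :: 'b
    using enc_eq_iff[of a b] by linarith
  ultimately show ?thesis by simp
qed

lemma comput_mod [comput_intro]:
  fixes f :: "_ \<Rightarrow> nat"
  assumes "comput f" "comput g" shows "comput (\<lambda>x. f x mod g x)"
proof -
  \<comment> \<open>A counter that restarts on reaching \<open>g x\<close>. For
    \<open>g x = 0\<close> it never restarts, in agreement with \<open>a mod 0 = a\<close>.\<close>
  have "comput (\<lambda>x. rec_nat 0 (\<lambda>_ r. if Suc r = g x then 0 else Suc r) (f x))"
    by (intro comput_intro assms comput_comp[OF assms(2)])
  moreover have "rec_nat 0 (\<lambda>_ r. if Suc r = b then 0 else Suc r) a = a mod b" for a b
    by (induction a) (simp_all add: mod_Suc)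
  ultimately show ?thesis by simp
qed

lemma comput_div2 [comput_intro]:
  fixes f :: "_ \<Rightarrow> nat"
  assumes "comput f" shows "comput (\<lambda>x. f x div 2)"
proof -
  \<comment> \<open>Counts the odd numbers below \<open>f x\<close>.\<close>
  have "comput (\<lambda>x. rec_nat 0 (\<lambda>k r. r + k mod 2) (f x))"
    by (intro comput_intro assms)
  moreover have "rec_nat 0 (\<lambda>k r. r + k mod 2) a = a div 2" for a :: nat
  proof (induction a)
    case (Suc a)
    then show ?case by simp presburger
  qed simp
  ultimately show ?thesis by simp
qed

lemma comput_prod_encode [comput_intro]: "comput f \<Longrightarrow> comput (\<lambda>x. prod_encode (f x))"
  by (erule comput_by_code) (simp add: enc_nat_def enc_prod_def)

lemma comput_prod_decode [comput_intro]: "comput f \<Longrightarrow> comput (\<lambda>x. prod_decode (f x))"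
  by (erule comput_by_code) (simp add: enc_nat_def enc_prod_def)

section \<open>Lists\<close>

lemma comput_Cons [comput_intro]: "comput f \<Longrightarrow> comput g \<Longrightarrow> comput (\<lambda>x. f x # g x)"
  by (rule comput_by_code[of "\<lambda>x. Suc (enc (f x, g x))"]) (auto intro!: comput_intro simp: enc_nat_def enc_prod_def)

lemma comput_tl [comput_intro]:
  assumes "comput f" shows "comput (\<lambda>x. tl (f x))"
proof (rule comput_by_code[of "\<lambda>x. case_nat 0 (\<lambda>k. snd (prod_decode k)) (enc (f x))"])
  show "comput (\<lambda>x. case_nat 0 (\<lambda>k. snd (prod_decode k)) (enc (f x)))"
    by (intro comput_intro assms)
  show "enc (tl (f x)) = enc (case_nat 0 (\<lambda>k. snd (prod_decode k)) (enc (f x)))" for x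
    by (cases "f x") (simp_all add: enc_nat_def)
qed

lemma comput_hd [comput_intro]:
  assumes "comput f" shows "comput (\<lambda>x. hd (f x))"
\<comment> \<open>\<open>hd []\<close> is unspecified, but it is one fixed value, whose code can be
  built in as a constant.\<close>
proof (rule comput_by_code[of "\<lambda>x. case_nat (enc (hd [] :: 'b)) (\<lambda>k. fst (prod_decode k)) (enc (f x))"])
  show "comput (\<lambda>x. case_nat (enc (hd [] :: 'b)) (\<lambda>k. fst (prod_decode k)) (enc (f x)))"
    by (intro comput_intro assms)
  show "enc (hd (f x)) = enc (case_nat (enc (hd [] :: 'b)) (\<lambda>k. fst (prod_decode k)) (enc (f x)))" for x
    by (cases "f x") (simp_all add: enc_nat_def)
qed

text \<open>Lets the code of a list serve as the number of iterations of a loop over the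
  list.\<close>

lemma length_le_enc: "length xs \<le> enc xs"
proof (induction xs)
  case (Cons x xs)
  then show ?case using le_prod_encode_2[of "enc xs" "enc x"] by simp
qed simp

lemma comput_foldl [comput_intro]:
  assumes g: "comput (\<lambda>p. g (fst p) (fst (snd p)) (snd (snd p)))" and a: "comput a" and xs: "comput xs"
  shows "comput (\<lambda>x. foldl (g x) (a x) (xs x))"
proof -
  \<comment> \<open>One step consumes one entry and idles at the empty list, so that running it too
    often is harmless.\<close>
  define st where "st x r = (if snd r = [] then r else (g x (fst r) (hd (snd r)), tl (snd r)))" for x r
  have "comput (\<lambda>x. fst (rec_nat (a x, xs x) (\<lambda>_. st x) (enc (xs x))))"
    unfolding st_def by (intro comput_intro a xs comput_comp3[OF g])
  moreover have "fst (rec_nat (b, ys) (\<lambda>_. st x) n) = foldl (g x) b ys" if "length ys \<le> n" for b x ys n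
    using that
  proof (induction n arbitrary: b ys)
    case (Suc n)
    have shift: "rec_nat r (\<lambda>_. st x) (Suc n) = rec_nat (st x r) (\<lambda>_. st x) n" for r n
      by (induction n) auto
    show ?case
    proof (cases ys)
      case Nil
      moreover have "st x (b, []) = (b, [])" by (simp add: st_def)
      ultimately show ?thesis using Suc.IH[of "[]" b] by (simp only: shift) simp
    next
      case (Cons y zs)
      moreover have "st x (b, y # zs) = (g x b y, zs)" by (simp add: st_def)
      ultimately show ?thesis using Suc.IH[of zs "g x b y"] Suc.prems by (simp only: shift) simp
    qed
  qed simp
  ultimately show ?thesis by (simp add: length_le_enc)
qed

lemma comput_rev [comput_intro]:
  assumes "comput xs" shows "comput (\<lambda>x. rev (xs x))"
proof -
  have "comput (\<lambda>x. foldl (\<lambda>a y. y # a) [] (xs x))"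
    by (intro comput_intro assms)
  moreover have "foldl (\<lambda>a y. y # a) zs ys = rev ys @ zs" for ys zs :: "'b list"
    by (induction ys arbitrary: zs) auto
  ultimately show ?thesis by simp
qed

lemma comput_append [comput_intro]:
  assumes "comput xs" "comput ys" shows "comput (\<lambda>x. xs x @ ys x)"
proof -
  have "comput (\<lambda>x. foldl (\<lambda>a y. y # a) (ys x) (rev (xs x)))"
    by (intro comput_intro assms)
  moreover have "foldl (\<lambda>a y. y # a) zs ys = rev ys @ zs" for ys zs :: "'b list"
    by (induction ys arbitrary: zs) auto
  ultimately show ?thesis by simp
qed

lemma comput_map [comput_intro]:
  assumes f: "comput (\<lambda>p. f (fst p) (snd p))" and xs: "comput xs"
  shows "comput (\<lambda>x. map (f x) (xs x))"
proof -
  have "comput (\<lambda>x. foldl (\<lambda>a y. a @ [f x y]) [] (xs x))"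
    by (intro comput_intro xs comput_comp2[OF f])
  moreover have "foldl (\<lambda>a y. a @ [h y]) zs ys = zs @ map h ys" for h :: "'b \<Rightarrow> 'c" and ys zs
    by (induction ys arbitrary: zs) auto
  ultimately show ?thesis by simp
qed

lemma comput_filter [comput_intro]:
  assumes f: "comput (\<lambda>p. f (fst p) (snd p))" and xs: "comput xs"
  shows "comput (\<lambda>x. filter (f x) (xs x))"
proof -
  have "comput (\<lambda>x. foldl (\<lambda>a y. if f x y then a @ [y] else a) [] (xs x))"
    by (intro comput_intro xs comput_comp2[OF f])
  moreover have "foldl (\<lambda>a y. if h y then a @ [y] else a) zs ys = zs @ filter h ys" for h :: "'b \<Rightarrow> bool" and ys zs
    by (induction ys arbitrary: zs) auto
  ultimately show ?thesis by simp
qed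

lemma comput_concat [comput_intro]:
  assumes "comput xs" shows "comput (\<lambda>x. concat (xs x))"
proof -
  have "comput (\<lambda>x. foldl (\<lambda>a y. a @ y) [] (xs x))"
    by (intro comput_intro assms)
  moreover have "foldl (\<lambda>a y. a @ y) zs ys = zs @ concat ys" for ys and zs :: "'b list"
    by (induction ys arbitrary: zs) auto
  ultimately show ?thesis by simp
qed

lemma comput_length [comput_intro]:
  assumes "comput xs" shows "comput (\<lambda>x. length (xs x))"
proof -
  have "comput (\<lambda>x. foldl (\<lambda>a y. Suc a) 0 (xs x))"
    by (intro comput_intro assms)
  moreover have "foldl (\<lambda>a y. Suc a) n ys = n + length ys" for n and ys :: "'b list"
    by (induction ys arbitrary: n) auto
  ultimately show ?thesis by simp
qed

lemma comput_sum_list [comput_intro]: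
  fixes xs :: "_ \<Rightarrow> nat list"
  assumes "comput xs" shows "comput (\<lambda>x. sum_list (xs x))"
proof -
  have "comput (\<lambda>x. foldl (\<lambda>a y. a + y) 0 (xs x))"
    by (intro comput_intro assms)
  moreover have "foldl (\<lambda>a y. a + y) n ys = n + sum_list ys" for n :: nat and ys
    by (induction ys arbitrary: n) auto
  ultimately show ?thesis by simp
qed

lemma comput_drop [comput_intro]:
  assumes "comput n" "comput xs" shows "comput (\<lambda>x. drop (n x) (xs x))"
proof -
  have "comput (\<lambda>x. rec_nat (xs x) (\<lambda>_ r. tl r) (n x))"
    by (intro comput_intro assms)
  moreover have "rec_nat ys (\<lambda>_ r. tl r) k = drop k ys" for k and ys :: "'b list"
    by (induction k) (simp_all add: drop_Suc tl_drop)
  ultimately show ?thesis by simp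
qed

lemma comput_take [comput_intro]:
  assumes "comput n" "comput xs" shows "comput (\<lambda>x. take (n x) (xs x))"
proof -
  have "comput (\<lambda>x. rev (drop (length (xs x) - n x) (rev (xs x))))"
    by (intro comput_intro assms)
  then show ?thesis by (simp flip: rev_take)
qed

lemma comput_upt [comput_intro]:
  assumes "comput n" shows "comput (\<lambda>x. [0..<n x])"
proof -
  have "comput (\<lambda>x. rec_nat [] (\<lambda>k r. r @ [k]) (n x))"
    by (intro comput_intro assms)
  moreover have "rec_nat [] (\<lambda>k r. r @ [k]) k = [0..<k]" for k by (induction k) auto
  ultimately show ?thesis by simp
qed

section \<open>Bounded search\<close>

lemma comput_Bex_set [comput_intro]:
  assumes f: "comput (\<lambda>p. f (fst p) (snd p))" and xs: "comput xs"
  shows "comput (\<lambda>x. \<exists>y\<in>set (xs x). f x y)"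
proof -
  have "comput (\<lambda>x. filter (f x) (xs x) \<noteq> [])"
    by (intro comput_intro assms)
  then show ?thesis by (simp add: filter_empty_conv)
qed

lemma comput_Ball_set [comput_intro]:
  assumes f: "comput (\<lambda>p. f (fst p) (snd p))" and xs: "comput xs"
  shows "comput (\<lambda>x. \<forall>y\<in>set (xs x). f x y)"
proof -
  have "comput (\<lambda>x. \<not> (\<exists>y\<in>set (xs x). \<not> f x y))"
    by (intro comput_intro assms)
  then show ?thesis by simp
qed

lemma comput_member [comput_intro]:
  assumes "comput f" "comput xs" shows "comput (\<lambda>x. f x \<in> set (xs x))"
proof -
  have "comput (\<lambda>x. \<exists>y\<in>set (xs x). y = f x)"
    by (intro comput_intro assms comput_comp[OF assms(1)])
  then show ?thesis by simp
qed

lemma comput_Bex_less [comput_intro]: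
  fixes n :: "_ \<Rightarrow> nat"
  assumes f: "comput (\<lambda>p. f (fst p) (snd p))" and n: "comput n"
  shows "comput (\<lambda>x. \<exists>y<n x. f x y)"
proof -
  have "comput (\<lambda>x. \<exists>y\<in>set [0..<n x]. f x y)"
    by (intro comput_intro assms)
  then show ?thesis by (simp add: Bex_def conj_commute)
qed

lemma comput_Ball_less [comput_intro]:
  fixes n :: "_ \<Rightarrow> nat"
  assumes f: "comput (\<lambda>p. f (fst p) (snd p))" and n: "comput n"
  shows "comput (\<lambda>x. \<forall>y<n x. f x y)"
proof -
  have "comput (\<lambda>x. \<forall>y\<in>set [0..<n x]. f x y)"
    by (intro comput_intro assms)
  then show ?thesis by (simp add: Ball_def)
qed

lemma comput_n_lists [comput_intro]:
  assumes "comput n" shows "comput (\<lambda>x. List.n_lists (n x) ys)"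
proof -
  have "comput (\<lambda>x. rec_nat [[]] (\<lambda>_ r. concat (map (\<lambda>zs. map (\<lambda>y. y # zs) ys) r)) (n x))"
    by (intro comput_intro assms)
  moreover have "rec_nat [[]] (\<lambda>_ r. concat (map (\<lambda>zs. map (\<lambda>y. y # zs) ys) r)) k = List.n_lists k ys" for k
    by (induction k) auto
  ultimately show ?thesis by simp
qed

section \<open>An enumeration of the c.e. sets\<close>

type_synonym claim = "nat \<times> nat \<times> nat"

text \<open>A claim \<open>(e, x, v)\<close> says that the program \<open>e\<close> maps \<open>x\<close> to \<open>v\<close>; it is justified by the
  claims \<open>cs\<close> if it follows from them by one evaluation step. The tags 0 to 7 are the constructors of
  \<^const>\<open>partrec\<close> in their order of definition.\<close>

definition just :: "claim list \<Rightarrow> claim \<Rightarrow> bool" where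
  "just cs c \<longleftrightarrow> (case c of (e, x, v) \<Rightarrow>
    let t = fst (prod_decode e); f = fst (prod_decode (snd (prod_decode e)));
        g = snd (prod_decode (snd (prod_decode e)));
        a = fst (prod_decode x); m = snd (prod_decode x)
    in t = 0 \<and> v = 0 \<or> t = 1 \<and> v = Suc x \<or> t = 2 \<and> v = a \<or> t = 3 \<and> v = m
     \<or> t = 4 \<and> (f, x, fst (prod_decode v)) \<in> set cs \<and> (g, x, snd (prod_decode v)) \<in> set cs
     \<or> t = 5 \<and> (\<exists>d\<in>set cs. d = (g, x, snd (snd d)) \<and> (f, snd (snd d), v) \<in> set cs)
     \<or> t = 6 \<and> m = 0 \<and> (f, a, v) \<in> set cs
     \<or> t = 6 \<and> 0 < m \<and> (\<exists>d\<in>set cs. d = (e, prod_encode (a, m - 1), snd (snd d)) \<and>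
          (g, prod_encode (a, prod_encode (m - 1, snd (snd d))), v) \<in> set cs)
     \<or> t = 7 \<and> (f, prod_encode (x, v), 0) \<in> set cs
          \<and> (\<forall>j<v. \<exists>d\<in>set cs. d = (f, prod_encode (x, j), snd (snd d)) \<and> 0 < snd (snd d)))"

text \<open>A claim may rest only on later entries, which excludes circular justification. The
  indexed form has a bounded quantifier, to which the closure rules apply.\<close>

definition derivation :: "claim list \<Rightarrow> bool" where
  "derivation cs \<longleftrightarrow> (\<forall>i<length cs. just (drop (Suc i) cs) (hd (drop i cs)))"

definition derivable :: "claim \<Rightarrow> bool" where
  "derivable c \<longleftrightarrow> (\<exists>cs. derivation cs \<and> c \<in> set cs)"

lemma derivation_simps [simp]:
  "derivation []" "derivation (c # cs) \<longleftrightarrow> just cs c \<and> derivation cs"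
proof -
  show "derivation []" by (simp add: derivation_def)
  show "derivation (c # cs) \<longleftrightarrow> just cs c \<and> derivation cs"
    unfolding derivation_def by (auto simp: less_Suc_eq_0_disj)
qed

lemma just_mono: "just cs c \<Longrightarrow> set cs \<subseteq> set ds \<Longrightarrow> just ds c"
  unfolding just_def Let_def case_prod_beta by (elim disjE) (simp; blast)+

lemma derivation_append: "derivation cs \<Longrightarrow> derivation ds \<Longrightarrow> derivation (cs @ ds)"
  by (induction cs) (auto elim: just_mono)

text \<open>Derivations can be joined end to end, because \<open>just\<close> is monotone in the
  claims it may use.\<close>

lemma derivable_finite:
  assumes "finite C" "\<And>c. c \<in> C \<Longrightarrow> derivable c"
  shows "\<exists>cs. derivation cs \<and> C \<subseteq> set cs"
  using assms
proof (induction C)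
  case empty
  then show ?case by (intro exI[of _ "[]"]) simp
next
  case (insert c C)
  then obtain cs where "derivation cs" "C \<subseteq> set cs" by blast
  moreover from insert.prems obtain ds where "derivation ds" "c \<in> set ds"
    unfolding derivable_def by blast
  ultimately show ?case by (intro exI[of _ "cs @ ds"]) (auto intro: derivation_append)
qed

lemma derivable_justI:
  assumes "finite C" "\<And>c. c \<in> C \<Longrightarrow> derivable c" "\<And>cs. C \<subseteq> set cs \<Longrightarrow> just cs c"
  shows "derivable c"
proof -
  obtain cs where "derivation cs" "C \<subseteq> set cs"
    using derivable_finite[OF assms(1,2)] by blast
  then show ?thesis
    unfolding derivable_def using assms(3) by (intro exI[of _ "c # cs"]) simp
qed

lemma derivable_justE:
  assumes "derivable c"
  obtains cs where "just cs c" "\<And>d. d \<in> set cs \<Longrightarrow> derivable d"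
proof -
  from assms obtain ds where ds: "derivation ds" "c \<in> set ds" by (auto simp: derivable_def)
  then have "\<exists>cs. just cs c \<and> derivation cs"
    by (induction ds) auto
  then show ?thesis using that by (auto simp: derivable_def)
qed

text \<open>The equivalence also captures divergence: no claim about an undefined value is
  derivable.\<close>

definition computes_code :: "nat \<Rightarrow> (nat \<Rightarrow> nat option) \<Rightarrow> bool" where
  "computes_code e \<phi> \<longleftrightarrow> (\<forall>x v. derivable (e, x, v) \<longleftrightarrow> \<phi> x = Some v)"

lemma computes_codeI:
  assumes "\<And>x v cs. just cs (e, x, v) \<Longrightarrow> (\<And>d. d \<in> set cs \<Longrightarrow> derivable d) \<Longrightarrow> \<phi> x = Some v"
    and "\<And>x v. \<phi> x = Some v \<Longrightarrow>
      \<exists>C. finite C \<and> (\<forall>c\<in>C. derivable c) \<and> (\<forall>cs. C \<subseteq> set cs \<longrightarrow> just cs (e, x, v))"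
  shows "computes_code e \<phi>"
  unfolding computes_code_def
proof (intro allI iffI)
  fix x v
  show "\<phi> x = Some v" if "derivable (e, x, v)"
    using derivable_justE[OF that] assms(1) by metis
  show "derivable (e, x, v)" if "\<phi> x = Some v"
    using assms(2)[OF that] derivable_justI by metis
qed

definition op_code :: "nat \<Rightarrow> nat \<Rightarrow> nat \<Rightarrow> nat" where
  "op_code t f g = prod_encode (t, prod_encode (f, g))"

lemma minimize_eq_Some:
  "minimize h = Some v \<longleftrightarrow> h v = Some 0 \<and> (\<forall>j<v. \<exists>y. h j = Some (Suc y))"
proof
  assume "minimize h = Some v"
  then obtain k where k: "h k = Some 0" "\<forall>j<k. \<exists>y. h j = Some (Suc y)" "v = (LEAST k. h k = Some 0)"
    unfolding minimize_def by (auto split: if_splits)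
  then have "v = k"
    by (metis (mono_tags, lifting) LeastI Zero_not_Suc not_less_Least linorder_neqE_nat option.inject)
  with k show "h v = Some 0 \<and> (\<forall>j<v. \<exists>y. h j = Some (Suc y))" by simp
next
  assume v: "h v = Some 0 \<and> (\<forall>j<v. \<exists>y. h j = Some (Suc y))"
  then have "(LEAST k. h k = Some 0) = v"
    by (intro Least_equality) (auto, metis Zero_not_Suc not_less option.inject)
  with v show "minimize h = Some v" unfolding minimize_def by auto
qed

text \<open>A claim with tag 6 may rest on a claim with the same code at the preceding argument, so
  its soundness is not settled by the two subprograms alone. Hence the induction on \<open>m\<close>
  in place of \<open>computes_codeI\<close>.\<close>

lemma computes_code_prim_rec:
  assumes f: "computes_code ef f" and g: "computes_code eg g"
  shows "computes_code (op_code 6 ef eg) (\<lambda>n. case prod_decode n of (a, m) \<Rightarrow>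
      rec_nat (f a) (\<lambda>k r. Option.bind r (\<lambda>i. g (prod_encode (a, prod_encode (k, i))))) m)"
proof -
  define e where "e = op_code 6 ef eg"
  define h where "h a m = rec_nat (f a) (\<lambda>k r. Option.bind r (\<lambda>i. g (prod_encode (a, prod_encode (k, i))))) m"
    for a m :: nat
  have h_simps: "h a 0 = f a" "h a (Suc k) = Option.bind (h a k) (\<lambda>i. g (prod_encode (a, prod_encode (k, i))))"
    for a k by (simp_all add: h_def)
  have f': "derivable (ef, x, v) \<longleftrightarrow> f x = Some v" and g': "derivable (eg, x, v) \<longleftrightarrow> g x = Some v" for x v
    using f g by (auto simp: computes_code_def)
  have just_zero: "just cs (e, prod_encode (a, 0), v) \<longleftrightarrow> (ef, a, v) \<in> set cs" for cs a v
    by (simp add: just_def e_def op_code_def)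
  have just_Suc: "just cs (e, prod_encode (a, Suc k), v) \<longleftrightarrow>
      (\<exists>i. (e, prod_encode (a, k), i) \<in> set cs \<and> (eg, prod_encode (a, prod_encode (k, i)), v) \<in> set cs)" for cs a k v
    by (force simp add: just_def e_def op_code_def)
  have "derivable (e, prod_encode (a, m), v) \<longleftrightarrow> h a m = Some v" for a m v
  proof (induction m arbitrary: v)
    case 0
    show ?case
    proof
      assume "derivable (e, prod_encode (a, 0), v)"
      then show "h a 0 = Some v"
        by (rule derivable_justE) (auto simp: just_zero h_simps simp flip: f')
    next
      assume "h a 0 = Some v"
      then show "derivable (e, prod_encode (a, 0), v)"
        by - (rule derivable_justI[of "{(ef, a, v)}"], auto simp: just_zero h_simps f')
    qed
  next
    case (Suc k)
    show ?case
    proof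
      assume "derivable (e, prod_encode (a, Suc k), v)"
      then show "h a (Suc k) = Some v"
        by (rule derivable_justE) (unfold just_Suc h_simps bind_eq_Some_conv Suc[symmetric] g'[symmetric], blast)
    next
      assume "h a (Suc k) = Some v"
      then obtain i where "h a k = Some i" "g (prod_encode (a, prod_encode (k, i))) = Some v"
        by (auto simp: h_simps bind_eq_Some_conv)
      then show "derivable (e, prod_encode (a, Suc k), v)"
        by - (rule derivable_justI[of "{(e, prod_encode (a, k), i), (eg, prod_encode (a, prod_encode (k, i)), v)}"],
          auto simp: just_Suc g' Suc)
    qed
  qed
  from this[of "fst (prod_decode n)" "snd (prod_decode n)" for n] show ?thesis
    by (simp add: computes_code_def e_def h_def case_prod_beta)
qed

lemma computes_code_mu:
  assumes f: "computes_code ef f"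
  shows "computes_code (op_code 7 ef 0) (\<lambda>a. minimize (\<lambda>k. f (prod_encode (a, k))))"
proof (rule computes_codeI)
  have f': "derivable (ef, x, v) \<longleftrightarrow> f x = Some v" for x v
    using f by (auto simp: computes_code_def)
  fix x v
  have just: "just cs (op_code 7 ef 0, x, v) \<longleftrightarrow>
      (ef, prod_encode (x, v), 0) \<in> set cs \<and> (\<forall>j<v. \<exists>y. (ef, prod_encode (x, j), Suc y) \<in> set cs)" for cs
  proof -
    have "(\<exists>d\<in>set cs. d = (ef, y, snd (snd d)) \<and> 0 < snd (snd d)) \<longleftrightarrow> (\<exists>u. (ef, y, Suc u) \<in> set cs)" for y
      by (auto simp: gr0_conv_Suc) (metis snd_conv)+
    then show ?thesis by (simp add: just_def op_code_def)
  qed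
  show "minimize (\<lambda>k. f (prod_encode (x, k))) = Some v"
    if "just cs (op_code 7 ef 0, x, v)" "\<And>d. d \<in> set cs \<Longrightarrow> derivable d" for cs
    using that unfolding just minimize_eq_Some f'[symmetric] by blast
  assume "minimize (\<lambda>k. f (prod_encode (x, k))) = Some v"
  then obtain y where "f (prod_encode (x, v)) = Some 0" "\<And>j. j < v \<Longrightarrow> f (prod_encode (x, j)) = Some (Suc (y j))"
    unfolding minimize_eq_Some by metis
  then show "\<exists>C. finite C \<and> (\<forall>c\<in>C. derivable c) \<and> (\<forall>cs. C \<subseteq> set cs \<longrightarrow> just cs (op_code 7 ef 0, x, v))"
    by (intro exI[of _ "insert (ef, prod_encode (x, v), 0) ((\<lambda>j. (ef, prod_encode (x, j), Suc (y j))) ` {..<v})"])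
       (auto simp: just f')
qed

lemma ex_computes_code: "partrec \<phi> \<Longrightarrow> \<exists>e. computes_code e \<phi>"
proof (induction rule: partrec.induct)
  case zero
  have "computes_code (op_code 0 0 0) (\<lambda>_. Some 0)"
    by (rule computes_codeI) (auto simp: just_def op_code_def intro!: exI[of _ "{}"])
  then show ?case ..
next
  case succ
  have "computes_code (op_code 1 0 0) (\<lambda>n. Some (Suc n))"
    by (rule computes_codeI) (auto simp: just_def op_code_def intro!: exI[of _ "{}"])
  then show ?case ..
next
  case proj1
  have "computes_code (op_code 2 0 0) (\<lambda>n. Some (fst (prod_decode n)))"
    by (rule computes_codeI) (auto simp: just_def op_code_def intro!: exI[of _ "{}"])
  then show ?case ..
next
  case proj2
  have "computes_code (op_code 3 0 0) (\<lambda>n. Some (snd (prod_decode n)))"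
    by (rule computes_codeI) (auto simp: just_def op_code_def intro!: exI[of _ "{}"])
  then show ?case ..
next
  case (pair f g)
  then obtain ef eg where "computes_code ef f" "computes_code eg g" by blast
  then have f': "derivable (ef, x, v) \<longleftrightarrow> f x = Some v" and g': "derivable (eg, x, v) \<longleftrightarrow> g x = Some v" for x v
    by (auto simp: computes_code_def)
  have "computes_code (op_code 4 ef eg)
      (\<lambda>n. Option.bind (f n) (\<lambda>a. Option.bind (g n) (\<lambda>b. Some (prod_encode (a, b)))))"
  proof (rule computes_codeI)
    fix x v
    have just: "just cs (op_code 4 ef eg, x, v) \<longleftrightarrow>
        (ef, x, fst (prod_decode v)) \<in> set cs \<and> (eg, x, snd (prod_decode v)) \<in> set cs" for cs
      by (simp add: just_def op_code_def)
    show "Option.bind (f x) (\<lambda>a. Option.bind (g x) (\<lambda>b. Some (prod_encode (a, b)))) = Some v"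
      if "just cs (op_code 4 ef eg, x, v)" "\<And>d. d \<in> set cs \<Longrightarrow> derivable d" for cs
    proof -
      have "f x = Some (fst (prod_decode v))" "g x = Some (snd (prod_decode v))"
        using that unfolding just f'[symmetric] g'[symmetric] by blast+
      then show ?thesis by simp
    qed
    assume "Option.bind (f x) (\<lambda>a. Option.bind (g x) (\<lambda>b. Some (prod_encode (a, b)))) = Some v"
    then show "\<exists>C. finite C \<and> (\<forall>c\<in>C. derivable c) \<and> (\<forall>cs. C \<subseteq> set cs \<longrightarrow> just cs (op_code 4 ef eg, x, v))"
      by (intro exI[of _ "{(ef, x, fst (prod_decode v)), (eg, x, snd (prod_decode v))}"])
         (auto simp: just bind_eq_Some_conv f' g')
  qed
  then show ?case ..
next
  case (comp f g)
  then obtain ef eg where "computes_code ef f" "computes_code eg g" by blast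
  then have f': "derivable (ef, x, v) \<longleftrightarrow> f x = Some v" and g': "derivable (eg, x, v) \<longleftrightarrow> g x = Some v" for x v
    by (auto simp: computes_code_def)
  have "computes_code (op_code 5 ef eg) (\<lambda>n. Option.bind (g n) f)"
  proof (rule computes_codeI)
    fix x v
    have just: "just cs (op_code 5 ef eg, x, v) \<longleftrightarrow> (\<exists>u. (eg, x, u) \<in> set cs \<and> (ef, u, v) \<in> set cs)" for cs
      by (force simp add: just_def op_code_def)
    show "Option.bind (g x) f = Some v"
      if "just cs (op_code 5 ef eg, x, v)" "\<And>d. d \<in> set cs \<Longrightarrow> derivable d" for cs
      using that unfolding just bind_eq_Some_conv f'[symmetric] g'[symmetric] by blast
    assume "Option.bind (g x) f = Some v"
    then obtain u where "g x = Some u" "f u = Some v" by (auto simp: bind_eq_Some_conv)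
    then show "\<exists>C. finite C \<and> (\<forall>c\<in>C. derivable c) \<and> (\<forall>cs. C \<subseteq> set cs \<longrightarrow> just cs (op_code 5 ef eg, x, v))"
      by (intro exI[of _ "{(eg, x, u), (ef, u, v)}"]) (auto simp: just f' g')
  qed
  then show ?case ..
qed (blast intro: computes_code_prim_rec computes_code_mu)+

text \<open>Every witness sought by \<open>just\<close> is an entry of the given list, and the one
  numerical quantifier is bounded by \<open>v\<close>; so a single evaluation step is
  decidable.\<close>

lemma comput_just: "comput f \<Longrightarrow> comput g \<Longrightarrow> comput (\<lambda>x. just (f x) (g x))"
  by (rule comput_comp2[of just], unfold just_def, intro comput_intro) auto

lemma comput_derivation [comput_intro]: "comput f \<Longrightarrow> comput (\<lambda>x. derivation (f x))"
  by (rule comput_comp[of derivation f]) (unfold derivation_def, intro comput_intro comput_just)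

text \<open>Inverse of \<open>enc\<close> on lists of claims, which turns the search for a
  derivation into a search for a number.\<close>

definition claims_of :: "nat \<Rightarrow> claim list" where
  "claims_of y = map (\<lambda>c. (fst (prod_decode c), prod_decode (snd (prod_decode c)))) (list_decode y)"

definition step_accepts :: "nat \<Rightarrow> nat \<Rightarrow> nat \<Rightarrow> bool" where
  "step_accepts e x y \<longleftrightarrow> derivation (claims_of y) \<and>
     (\<exists>d\<in>set (claims_of y). d = (e, x, snd (snd d)))"

lemma enc_claims_of: "enc (claims_of y) = y"
  by (simp add: enc_list_def claims_of_def comp_def enc_prod_def enc_nat_def)

lemma comput_step_accepts:
  "comput f \<Longrightarrow> comput g \<Longrightarrow> comput h \<Longrightarrow> comput (\<lambda>x. step_accepts (f x) (g x) (h x))"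
proof (rule comput_comp3[of step_accepts])
  have "comput claims_of"
    by (rule comput_by_code[OF comput_id]) (simp add: enc_claims_of enc_nat_def)
  note * = comput_comp[OF this]
  show "comput (\<lambda>p. step_accepts (fst p) (fst (snd p)) (snd (snd p)))"
    unfolding step_accepts_def by (intro comput_intro *)
qed

text \<open>Kleene's normal form: membership is the existence of a number that passes a decidable
  test.\<close>

lemma ce_enumeration: "ce A \<Longrightarrow> \<exists>e. \<forall>x. x \<in> A \<longleftrightarrow> (\<exists>y. step_accepts e x y)"
proof -
  assume "ce A"
  then obtain \<phi> where \<phi>: "partrec \<phi>" "A = dom \<phi>" by (auto simp: ce_def)
  then obtain e where e: "computes_code e \<phi>" using ex_computes_code by blast
  have "x \<in> A \<longleftrightarrow> (\<exists>v. derivable (e, x, v))" for x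
    using e \<phi> by (auto simp: computes_code_def)
  moreover have "derivable (e, x, v) \<longleftrightarrow> (\<exists>y. derivation (claims_of y) \<and> (e, x, v) \<in> set (claims_of y))" for x v
  proof -
    have "claims_of (enc cs) = cs" for cs
      using enc_claims_of[of "enc cs"] by simp
    then show ?thesis unfolding derivable_def by metis
  qed
  ultimately show ?thesis unfolding step_accepts_def by (metis snd_conv)
qed

section \<open>Clopen sets and their measure\<close>

lemma prob_space_cantor: "prob_space cantor_measure"
  unfolding cantor_measure_def
  by (intro prob_space_PiM prob_space_measure_pmf)

interpretation cantor: prob_space cantor_measure
  by (rule prob_space_cantor)

lemma cylinder_emb: "cylinder v = prod_emb UNIV (\<lambda>_. measure_pmf (bernoulli_pmf (1/2)))
    {..<length v} (PiE {..<length v} (\<lambda>i. {v ! i}))"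
  by (auto simp: cylinder_def prod_emb_def PiE_def restrict_def extensional_def Pi_def)

lemma sets_cylinder [measurable, simp]: "cylinder v \<in> sets cantor_measure"
  unfolding cylinder_emb cantor_measure_def by (rule sets_PiM_I) auto

lemma lam_cylinder: "lam (cylinder v) = (1/2) ^ length v"
proof -
  interpret product_prob_space "\<lambda>_. measure_pmf (bernoulli_pmf (1/2))" UNIV
    by standard
  have "lam (cylinder v) = (\<Prod>i<length v. measure (measure_pmf (bernoulli_pmf (1/2))) {v ! i})"
    unfolding cylinder_emb cantor_measure_def by (rule measure_PiM_emb) auto
  also have "\<dots> = (\<Prod>i<length v. 1/2)"
    by (intro prod.cong refl) (simp add: measure_pmf_single pmf_bernoulli_half)
  finally show ?thesis by simp
qed

lemma sets_open_of [measurable, simp]: "open_of W \<in> sets cantor_measure"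
  unfolding open_of_def by (intro sets.countable_UN') auto

lemma mem_cylinder: "\<alpha> \<in> cylinder w \<longleftrightarrow> map \<alpha> [0..<length w] = w"
  unfolding cylinder_def list_eq_iff_nth_eq[of "map \<alpha> [0..<length w]"] by simp

text \<open>With words of one length, sets of sequences become sets of words and measure becomes
  counting. This is why each stage works at a single level.\<close>

lemma mem_open_of_level:
  assumes "\<And>w. w \<in> W \<Longrightarrow> length w = L"
  shows "\<alpha> \<in> open_of W \<longleftrightarrow> map \<alpha> [0..<L] \<in> W"
proof -
  have "\<alpha> \<in> open_of W \<longleftrightarrow> (\<exists>w\<in>W. map \<alpha> [0..<L] = w)"
    unfolding open_of_def UN_iff mem_cylinder using assms by (intro bex_cong) simp_all
  then show ?thesis by simp
qed

abbreviation words :: "nat \<Rightarrow> word set" where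
  "words L \<equiv> {w. length w = L}"

lemma finite_words [simp]: "finite (words L)"
  using finite_lists_length_eq[of "UNIV :: bool set" L] by simp

lemma card_words: "card (words L) = 2 ^ L"
  using card_lists_length_eq[of "UNIV :: bool set" L] by simp

lemma disjoint_cylinders:
  assumes "W \<subseteq> words L" shows "disjoint_family_on cylinder W"
  unfolding disjoint_family_on_def
proof (intro ballI impI)
  fix v w assume "v \<in> W" "w \<in> W" "v \<noteq> w"
  moreover from this assms have "length v = L" "length w = L" by auto
  ultimately show "cylinder v \<inter> cylinder w = {}"
    unfolding disjoint_iff mem_cylinder by metis
qed

lemma lam_open_of_level:
  assumes "W \<subseteq> words L" shows "lam (open_of W) = card W / 2 ^ L"
proof -
  have fin: "finite W" using assms finite_subset finite_words by blast
  have "lam (open_of W) = (\<Sum>w\<in>W. lam (cylinder w))"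
    unfolding open_of_def
    by (intro cantor.finite_measure_finite_Union fin disjoint_cylinders[OF assms]) auto
  also have "\<dots> = (\<Sum>w\<in>W. 1 / 2 ^ L)"
    using assms by (intro sum.cong refl) (auto simp: lam_cylinder power_one_over)
  finally show ?thesis by simp
qed

lemma represents_level:
  assumes "W \<subseteq> words L" shows "represents W (open_of W)"
  unfolding represents_def open_of_def
  by (intro conjI finite_subset[OF assms finite_words] disjoint_cylinders[OF assms] refl)

section \<open>A universal test\<close>

lemma enc_word: "enc w = word_code w" for w :: word
proof -
  have "(enc :: bool \<Rightarrow> nat) = of_bool"
    by (rule ext) (simp add: enc_bool_def)
  then show ?thesis by (simp add: enc_list_def word_code_def)
qed

lemma word_code_inject [simp]: "word_code v = word_code w \<longleftrightarrow> v = w"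
  using enc_eq_iff[of v w] by (simp add: enc_word)

lemma comput_word_code [comput_intro]: "comput f \<Longrightarrow> comput (\<lambda>x. word_code (f x))"
  using comput_enc[of f] by (simp add: enc_word)

text \<open>The factor 5 arises because a stage appends \<open>4 * L\<close> fresh bits to words of
  length \<open>L\<close>: two halves of \<open>2 * L\<close> bits, one for each strategy.\<close>

definition lev :: "nat \<Rightarrow> nat" where
  "lev s = 5 ^ s"

lemma comput_lev [comput_intro]: "comput f \<Longrightarrow> comput (\<lambda>x. lev (f x))"
  unfolding lev_def by (intro comput_intro)

lemma le_lev: "s \<le> lev s"
  unfolding lev_def using less_exp[of s] power_mono[of "2::nat" 5 s] by linarith

lemma lev_mono: "s \<le> t \<Longrightarrow> lev s \<le> lev t"
  by (simp add: lev_def power_increasing)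

abbreviation bitstrings :: "nat \<Rightarrow> word list" where
  "bitstrings n \<equiv> List.n_lists n [False, True]"

lemma set_bitstrings: "set (bitstrings n) = words n"
  by (auto simp: set_n_lists)

lemma length_bitstrings [simp]: "length (bitstrings n) = 2 ^ n"
  by (simp add: length_n_lists numeral_2_eq_2)

lemma distinct_bitstrings: "distinct (bitstrings n)"
  by (simp add: distinct_n_lists)

definition covered :: "nat \<Rightarrow> nat \<Rightarrow> nat \<Rightarrow> word \<Rightarrow> bool" where
  "covered e k s w \<longleftrightarrow> (\<exists>i<Suc (length w). \<exists>y<s. step_accepts e (prod_encode (k, word_code (take i w))) y)"

text \<open>The measure bound of \<open>small_iff\<close>, stated in integers so that it is
  decidable.\<close>

definition small :: "nat \<Rightarrow> nat \<Rightarrow> nat \<Rightarrow> bool" where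
  "small e k s \<longleftrightarrow> length (filter (covered e k s) (bitstrings (lev s))) * 2 ^ k \<le> 2 ^ lev s"

text \<open>Stage \<open>s\<close> of the \<open>j\<close>-th component of a universal test: the components of index \<open>j + e + 1\<close> of
  all uniformly c.e. sequences of open sets, where the \<open>e\<close>-th sequence is ignored as soon as it is
  seen to violate the measure bound.\<close>

definition hit :: "nat \<Rightarrow> nat \<Rightarrow> word \<Rightarrow> bool" where
  "hit j s w \<longleftrightarrow> (\<exists>e<s. small e (j + e + 1) s \<and> covered e (j + e + 1) s w)"

lemma comput_covered:
  "comput e \<Longrightarrow> comput k \<Longrightarrow> comput s \<Longrightarrow> comput w \<Longrightarrow> comput (\<lambda>x. covered (e x) (k x) (s x) (w x))"
proof -
  assume *: "comput e" "comput k" "comput s" "comput w"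
  have "comput (\<lambda>p. covered (fst p) (fst (snd p)) (fst (snd (snd p))) (snd (snd (snd p))))"
    unfolding covered_def by (intro comput_intro comput_step_accepts)
  from comput_comp[OF this, of "\<lambda>x. (e x, k x, s x, w x)"] show ?thesis
    by (simp add: comput_intro *)
qed

lemma comput_small:
  "comput e \<Longrightarrow> comput k \<Longrightarrow> comput s \<Longrightarrow> comput (\<lambda>x. small (e x) (k x) (s x))"
  by (rule comput_comp3[of small], unfold small_def, intro comput_intro comput_covered) auto

lemma comput_hit [comput_intro]:
  "comput j \<Longrightarrow> comput s \<Longrightarrow> comput w \<Longrightarrow> comput (\<lambda>x. hit (j x) (s x) (w x))"
  by (rule comput_comp3[of hit], unfold hit_def, intro comput_intro comput_covered comput_small) auto

abbreviation prefix_of :: "seq \<Rightarrow> nat \<Rightarrow> word" where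
  "prefix_of \<alpha> n \<equiv> map \<alpha> [0..<n]"

lemma mem_open_of_words: "\<alpha> \<in> open_of {w \<in> words L. P w} \<longleftrightarrow> P (prefix_of \<alpha> L)"
  by (subst mem_open_of_level[where L = L]) simp_all

definition covered_set :: "nat \<Rightarrow> nat \<Rightarrow> nat \<Rightarrow> seq set" where
  "covered_set e k s = open_of {w \<in> words (lev s). covered e k s w}"

lemma mem_covered_set:
  "\<alpha> \<in> covered_set e k s \<longleftrightarrow>
    (\<exists>i\<le>lev s. \<exists>y<s. step_accepts e (prod_encode (k, word_code (prefix_of \<alpha> i))) y)"
proof -
  have "\<alpha> \<in> covered_set e k s \<longleftrightarrow> covered e k s (prefix_of \<alpha> (lev s))"
    unfolding covered_set_def mem_open_of_words ..
  also have "\<dots> \<longleftrightarrow> (\<exists>i\<le>lev s. \<exists>y<s. step_accepts e (prod_encode (k, word_code (prefix_of \<alpha> i))) y)"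
    unfolding covered_def by (intro ex_cong1) (auto simp: less_Suc_eq_le take_map)
  finally show ?thesis .
qed

lemma covered_set_mono: "s \<le> t \<Longrightarrow> covered_set e k s \<subseteq> covered_set e k t"
  using lev_mono[of s t] by (auto simp: mem_covered_set) (meson le_trans less_le_trans)

lemma lam_covered_set:
  "lam (covered_set e k s) = length (filter (covered e k s) (bitstrings (lev s))) / 2 ^ lev s"
proof -
  have "length (filter (covered e k s) (bitstrings (lev s))) = card {w \<in> words (lev s). covered e k s w}"
    using distinct_card[OF distinct_filter[OF distinct_bitstrings], of "covered e k s" "lev s"]
    by (simp add: set_bitstrings)
  then show ?thesis
    unfolding covered_set_def by (subst lam_open_of_level[where L = "lev s"]) auto
qed

lemma small_iff: "small e k s \<longleftrightarrow> lam (covered_set e k s) \<le> (1/2) ^ k"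
proof -
  have "small e k s \<longleftrightarrow> real (length (filter (covered e k s) (bitstrings (lev s))) * 2 ^ k) \<le> real (2 ^ lev s)"
    unfolding small_def of_nat_le_iff ..
  then show ?thesis
    unfolding lam_covered_set by (simp add: field_simps power_one_over)
qed

definition hit_set :: "nat \<Rightarrow> seq set" where
  "hit_set j = (\<Union>s. open_of {w \<in> words (lev s). hit j s w})"

lemma mem_hit_set: "\<alpha> \<in> hit_set j \<longleftrightarrow> (\<exists>s. hit j s (prefix_of \<alpha> (lev s)))"
  unfolding hit_set_def UN_iff mem_open_of_words by simp

lemma sets_hit_set [measurable, simp]: "hit_set j \<in> sets cantor_measure"
  unfolding hit_set_def by measurable

text \<open>Covered sets grow with the stage. So all stages at which the \<open>e\<close>-th set is
  small lie inside the last of them, whose measure obeys the bound; the bounds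
  \<open>(1/2) ^ (j + e + 1)\<close> add up to \<open>(1/2) ^ j\<close>.\<close>

lemma lam_hit_set: "lam (hit_set j) \<le> (1/2) ^ j"
proof -
  \<comment> \<open>The cutoff \<open>N\<close> guarantees that there is a last small stage; it is
    removed by continuity of the measure.\<close>
  define K where "K e k N = (\<Union>s\<in>{s. s < N \<and> small e k s}. covered_set e k s)" for e k N
  have [measurable, simp]: "covered_set e k s \<in> sets cantor_measure" for e k s
    by (simp add: covered_set_def)
  have [measurable, simp]: "K e k N \<in> sets cantor_measure" for e k N
    by (simp add: K_def)
  have K_le: "lam (K e k N) \<le> (1/2) ^ k" for e k N
  proof (cases "{s. s < N \<and> small e k s} = {}")
    case False
    define m where "m = Max {s. s < N \<and> small e k s}"
    have m: "m \<in> {s. s < N \<and> small e k s}"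
      unfolding m_def using False by (intro Max_in) auto
    have "K e k N \<subseteq> covered_set e k m"
      unfolding K_def
    proof (intro UN_least covered_set_mono)
      show "s \<le> m" if "s \<in> {s. s < N \<and> small e k s}" for s
        unfolding m_def using that by (intro Max_ge) auto
    qed
    then have "lam (K e k N) \<le> lam (covered_set e k m)"
      by (intro cantor.finite_measure_mono) auto
    also have "\<dots> \<le> (1/2) ^ k" using m by (simp add: small_iff)
    finally show ?thesis .
  next
    case True
    show ?thesis unfolding K_def True by simp
  qed
  have KU: "lam (\<Union>N. K e k N) \<le> (1/2) ^ k" for e k
  proof (rule LIMSEQ_le_const2)
    show "(\<lambda>N. lam (K e k N)) \<longlonglongrightarrow> lam (\<Union>N. K e k N)"
    proof (rule cantor.finite_Lim_measure_incseq)
      show "incseq (K e k)"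
        unfolding incseq_def K_def by (intro allI impI UN_mono) auto
    qed auto
    show "\<exists>N. \<forall>n\<ge>N. lam (K e k n) \<le> (1/2) ^ k" using K_le by blast
  qed
  have sub: "hit_set j \<subseteq> (\<Union>e. \<Union>N. K e (j + e + 1) N)"
  proof
    fix \<alpha> assume "\<alpha> \<in> hit_set j"
    then obtain s e where "small e (j + e + 1) s" "covered e (j + e + 1) s (prefix_of \<alpha> (lev s))"
      by (auto simp: mem_hit_set hit_def)
    then have "\<alpha> \<in> K e (j + e + 1) (Suc s)"
      unfolding K_def covered_set_def UN_iff mem_open_of_words by (intro bexI[of _ s]) auto
    then show "\<alpha> \<in> (\<Union>e. \<Union>N. K e (j + e + 1) N)" by blast
  qed
  have sums: "(\<lambda>e. (1/2) ^ (j + e + 1) :: real) sums ((1/2) ^ j)"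
    using sums_mult[OF power_half_series, of "(1/2) ^ j"] by (simp add: power_add mult.assoc)
  have summ: "summable (\<lambda>e. lam (\<Union>N. K e (j + e + 1) N))"
  proof (rule summable_comparison_test'[OF sums_summable[OF sums]])
    show "norm (lam (\<Union>N. K e (j + e + 1) N)) \<le> (1/2) ^ (j + e + 1)" if "e \<ge> 0" for e
      using KU[of e "j + e + 1"] by simp
  qed
  have "lam (hit_set j) \<le> lam (\<Union>e. \<Union>N. K e (j + e + 1) N)"
    using sub by (intro cantor.finite_measure_mono) auto
  also have "\<dots> \<le> (\<Sum>e. lam (\<Union>N. K e (j + e + 1) N))"
    by (rule cantor.finite_measure_subadditive_countably[OF _ summ]) auto
  also have "\<dots> \<le> (\<Sum>e. (1/2) ^ (j + e + 1))"
    by (rule suminf_le[OF KU summ sums_summable[OF sums]])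
  also have "\<dots> = (1/2) ^ j" using sums by (rule sums_unique[symmetric])
  finally show ?thesis .
qed

text \<open>A genuine test is small at every stage, so its hits persist. Persistence matters because
  a game may begin arbitrarily late and must still see the hit.\<close>

lemma not_random_hit:
  assumes "\<not> martin_loef_random \<alpha>"
  shows "\<exists>s0. \<forall>s\<ge>s0. hit j s (prefix_of \<alpha> (lev s))"
proof -
  from assms obtain V where V: "uniformly_ce V" "\<And>n. lam (open_of (V n)) \<le> (1/2) ^ n"
    "\<And>n. \<alpha> \<in> open_of (V n)"
    unfolding martin_loef_random_def martin_loef_test_def by blast
  obtain e where e: "\<forall>x. x \<in> {prod_encode (n, word_code w) | n w. w \<in> V n} \<longleftrightarrow> (\<exists>y. step_accepts e x y)"
    using ce_enumeration[OF V(1)[unfolded uniformly_ce_def]] ..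
  have acc: "w \<in> V n \<longleftrightarrow> (\<exists>y. step_accepts e (prod_encode (n, word_code w)) y)" for n w
  proof -
    have "w \<in> V n \<longleftrightarrow> prod_encode (n, word_code w) \<in> {prod_encode (n, word_code w) | n w. w \<in> V n}"
      by auto
    then show ?thesis unfolding e[rule_format] .
  qed
  define k where "k = j + e + 1"
  have sub: "covered_set e k s \<subseteq> open_of (V k)" for s
  proof
    fix \<beta> assume "\<beta> \<in> covered_set e k s"
    then obtain i where "prefix_of \<beta> i \<in> V k" unfolding mem_covered_set acc by blast
    moreover have "\<beta> \<in> cylinder (prefix_of \<beta> i)" by (simp add: mem_cylinder)
    ultimately show "\<beta> \<in> open_of (V k)" unfolding open_of_def by blast
  qed
  have small: "small e k s" for s
    unfolding small_iff using V(2)[of k] cantor.finite_measure_mono[OF sub sets_open_of, of s] by linarith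
  from V(3)[of k] obtain u where "u \<in> V k" "prefix_of \<alpha> (length u) = u"
    unfolding open_of_def UN_iff mem_cylinder by blast
  then obtain y where y: "step_accepts e (prod_encode (k, word_code (prefix_of \<alpha> (length u)))) y"
    unfolding acc by metis
  \<comment> \<open>The stage leaves room for the index \<open>e\<close>, the accepting number
    \<open>y\<close> and the length of \<open>u\<close>.\<close>
  have "hit j s (prefix_of \<alpha> (lev s))" if s: "s \<ge> Suc (e + y + length u)" for s
  proof -
    have "\<alpha> \<in> covered_set e k s"
      unfolding mem_covered_set using y s le_lev[of s] by (intro exI[of _ "length u"] exI[of _ y] conjI) auto
    then have "covered e k s (prefix_of \<alpha> (lev s))"
      unfolding covered_set_def mem_open_of_words .
    then show ?thesis
      unfolding hit_def using small s by (intro exI[of _ e]) (auto simp: k_def)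
  qed
  then show ?thesis by blast
qed

section \<open>The two trees of pieces\<close>

text \<open>Besides its words, which all have the same length, a piece stores its mass, the mass it would have
  if nothing had been lost since its current game began, and the depth at which that game began. Masses
  are numerators over the total mass of all pieces, which grows from stage to stage so that they stay
  integers.\<close>

type_synonym piece = "word list \<times> nat \<times> nat \<times> nat"

abbreviation pwords :: "piece \<Rightarrow> word list" where "pwords p \<equiv> fst p"
abbreviation mass :: "piece \<Rightarrow> nat" where "mass p \<equiv> fst (snd p)"
abbreviation base :: "piece \<Rightarrow> nat" where "base p \<equiv> fst (snd (snd p))"
abbreviation cls :: "piece \<Rightarrow> nat" where "cls p \<equiv> snd (snd (snd p))"

text \<open>\<open>hd (drop u xs)\<close> stands for \<open>xs ! u\<close>, in terms of functions
  already known to be computable.\<close>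

definition block :: "bool \<Rightarrow> nat \<Rightarrow> nat \<Rightarrow> word list" where
  "block d t u = map (\<lambda>r. if d then hd (drop u (bitstrings t)) @ r else r @ hd (drop u (bitstrings t))) (bitstrings t)"

text \<open>The assignment of words to pieces is a Latin square: for every value \<open>u\<close> of the fresh bits, the
  \<open>i\<close>-th piece receives word number \<open>i + u\<close> modulo the number of words.\<close>

definition mix :: "bool \<Rightarrow> nat \<Rightarrow> word list \<Rightarrow> nat \<Rightarrow> word list" where
  "mix d t ws i = concat (map (\<lambda>u. map (\<lambda>z. hd (drop ((i + u) mod length ws) ws) @ z) (block d t u)) [0..<2 ^ t])"

definition spread :: "bool \<Rightarrow> nat \<Rightarrow> word list \<Rightarrow> word list list" where
  "spread d t ws = map (mix d t ws) [0..<length ws]"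

text \<open>A bet on \<open>K\<close> of the \<open>N\<close> words multiplies the capital on the other words by \<open>(N - 4K) / N\<close>; the
  truncated subtraction also declares the piece busted when \<open>4K > N\<close>.\<close>

definition busted :: "word list \<Rightarrow> piece \<Rightarrow> bool" where
  "busted W p \<longleftrightarrow> 2 * mass p * (length (pwords p) - 4 * length W) < base p * length (pwords p)"

text \<open>\<open>N\<close> words become \<open>N\<close> pieces and the total mass grows by
  \<open>N * N\<close>, so mass times \<open>N\<close> means unchanged capital. Fairness is the
  identity \<open>K * (5 * N - 4 * K) + (N - K) * (N - 4 * K) = N * N\<close>. A busted piece places
  no bet and begins a new game.\<close>

definition refine :: "bool \<Rightarrow> nat \<Rightarrow> word list \<Rightarrow> piece \<Rightarrow> piece list" where
  "refine d L W p = (let N = length (pwords p); K = length W in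
     if busted W p
     then map (\<lambda>x. (x, mass p * N, mass p * N, L)) (spread d (2 * L) (pwords p))
     else map (\<lambda>x. (x, mass p * (5 * N - 4 * K), mass p * (5 * N - 4 * K), L)) (spread d (2 * L) W)
       @ map (\<lambda>x. (x, mass p * (N - 4 * K), base p * N, cls p))
           (spread d (2 * L) (filter (\<lambda>w. w \<notin> set W) (pwords p))))"

text \<open>The measure bound \<open>(1/2) ^ (2q + 9)\<close> is small enough for the \<open>burden\<close> of all stages to add up to
  at most \<open>1/2\<close>.\<close>

definition bet1 :: "nat \<Rightarrow> piece \<Rightarrow> word list" where
  "bet1 s p = filter (hit (2 * cls p + 9) s) (pwords p)"

definition lost :: "nat \<Rightarrow> piece list \<Rightarrow> word list" where
  "lost s P = concat (map (\<lambda>p. if busted (bet1 s p) p then pwords p else []) P)"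

definition bet2 :: "word list \<Rightarrow> piece \<Rightarrow> word list" where
  "bet2 E r = filter (\<lambda>w. w \<in> set E) (pwords r)"

definition next_state :: "nat \<Rightarrow> piece list \<times> piece list \<Rightarrow> piece list \<times> piece list" where
  "next_state s PQ =
    (concat (map (\<lambda>p. refine True (lev s) (bet1 s p) p) (fst PQ)),
     concat (map (\<lambda>r. refine False (lev s) (bet2 (lost s (fst PQ)) r) r) (snd PQ)))"

definition state :: "nat \<Rightarrow> piece list \<times> piece list" where
  "state = rec_nat ([([[False], [True]], 1, 1, 0)], [([[False], [True]], 1, 1, 0)]) next_state"

abbreviation "P1 s \<equiv> fst (state s)"
abbreviation "P2 s \<equiv> snd (state s)"

section \<open>Computability of the construction\<close>

lemma comput_mix: "comput d \<Longrightarrow> comput t \<Longrightarrow> comput ws \<Longrightarrow> comput i \<Longrightarrow> comput (\<lambda>x. mix (d x) (t x) (ws x) (i x))"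
proof -
  assume *: "comput d" "comput t" "comput ws" "comput i"
  have "comput (\<lambda>p. mix (fst p) (fst (snd p)) (fst (snd (snd p))) (snd (snd (snd p))))"
    unfolding mix_def block_def by (intro comput_intro)
  from comput_comp[OF this, of "\<lambda>x. (d x, t x, ws x, i x)"] show ?thesis
    by (simp add: comput_intro *)
qed

lemma comput_spread: "comput d \<Longrightarrow> comput t \<Longrightarrow> comput ws \<Longrightarrow> comput (\<lambda>x. spread (d x) (t x) (ws x))"
  by (rule comput_comp3[of spread], unfold spread_def, intro comput_intro comput_mix) auto

lemma comput_busted: "comput W \<Longrightarrow> comput p \<Longrightarrow> comput (\<lambda>x. busted (W x) (p x))"
  by (rule comput_comp2[of busted], unfold busted_def, intro comput_intro) auto

lemma comput_refine: "comput d \<Longrightarrow> comput L \<Longrightarrow> comput W \<Longrightarrow> comput p \<Longrightarrow> comput (\<lambda>x. refine (d x) (L x) (W x) (p x))"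
proof -
  assume *: "comput d" "comput L" "comput W" "comput p"
  have "comput (\<lambda>p. refine (fst p) (fst (snd p)) (fst (snd (snd p))) (snd (snd (snd p))))"
    unfolding refine_def by (intro comput_intro comput_busted comput_spread)
  from comput_comp[OF this, of "\<lambda>x. (d x, L x, W x, p x)"] show ?thesis
    by (simp add: comput_intro *)
qed

lemma comput_next_state: "comput s \<Longrightarrow> comput PQ \<Longrightarrow> comput (\<lambda>x. next_state (s x) (PQ x))"
  by (rule comput_comp2[of next_state], unfold next_state_def lost_def bet1_def bet2_def,
      intro comput_intro comput_busted comput_refine) auto

lemma comput_state: "comput s \<Longrightarrow> comput (\<lambda>x. state (s x))"
  unfolding state_def by (intro comput_intro comput_next_state)

text \<open>Stage \<open>s\<close> has \<open>2 ^ dep s\<close> pieces. Every word of a piece gives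
  rise to one piece of the next stage, hence \<open>dep (Suc s) = lev s\<close>.\<close>

fun dep :: "nat \<Rightarrow> nat" where
  "dep 0 = 0"
| "dep (Suc s) = lev s"

lemma lev_pos [simp]: "0 < lev s"
  by (simp add: lev_def)

lemma lev_Suc: "lev (Suc s) = 5 * lev s"
  by (simp add: lev_def)

lemma dep_less_lev: "dep s < lev s"
  by (cases s) (simp_all add: lev_Suc)

text \<open>Makes stage \<open>length v\<close> late enough to evaluate a strategy at the node
  \<open>v\<close>.\<close>

lemma le_dep: "s \<le> dep s"
proof (cases s)
  case (Suc k)
  have "k < 5 ^ k" by (induction k) auto
  with Suc show ?thesis by (simp add: lev_def)
qed simp

lemma state_0: "state 0 = ([([[False], [True]], 1, 1, 0)], [([[False], [True]], 1, 1, 0)])"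
  by (simp add: state_def)

lemma P1_Suc: "P1 (Suc s) = concat (map (\<lambda>p. refine True (lev s) (bet1 s p) p) (P1 s))"
  and P2_Suc: "P2 (Suc s) = concat (map (\<lambda>r. refine False (lev s) (bet2 (lost s (P1 s)) r) r) (P2 s))"
  by (simp_all add: state_def next_state_def)

section \<open>The words of refined pieces\<close>

definition tails :: "nat \<Rightarrow> word set \<Rightarrow> word set" where
  "tails t W = {w @ z | w z. w \<in> W \<and> length z = t}"

lemma tails_Un: "tails t (A \<union> B) = tails t A \<union> tails t B"
  by (auto simp: tails_def)

lemma tails_UN: "tails t (\<Union>x\<in>X. A x) = (\<Union>x\<in>X. tails t (A x))"
  by (auto simp: tails_def)

lemma tails_words: "tails t (words L) = words (L + t)"
proof
  show "words (L + t) \<subseteq> tails t (words L)"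
  proof
    fix w :: word assume "w \<in> words (L + t)"
    then have "take L w @ drop L w \<in> tails t (words L)"
      unfolding tails_def by (intro CollectI exI[of _ "take L w"] exI[of _ "drop L w"]) auto
    then show "w \<in> tails t (words L)" by simp
  qed
qed (auto simp: tails_def)

lemma nth_bitstrings: "u < 2 ^ t \<Longrightarrow> hd (drop u (bitstrings t)) = bitstrings t ! u"
  by (simp add: hd_drop_conv_nth)

lemma length_nth_bitstrings: "u < 2 ^ t \<Longrightarrow> length (bitstrings t ! u) = t"
  using nth_mem[of u "bitstrings t"] unfolding set_bitstrings by simp

text \<open>The flag says whether the index \<open>u\<close> is stored in the first or in the second half of the
  \<open>2t\<close> fresh bits; the two strategies use different halves, which makes their mixing independent.\<close>

definition half :: "bool \<Rightarrow> nat \<Rightarrow> word \<Rightarrow> word" where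
  "half d t z = (if d then take t z else drop t z)"

lemma mem_block:
  assumes "u < 2 ^ t"
  shows "z \<in> set (block d t u) \<longleftrightarrow> length z = 2 * t \<and> half d t z = bitstrings t ! u"
proof -
  have "z \<in> set (block d t u) \<longleftrightarrow>
      (\<exists>r. length r = t \<and> z = (if d then bitstrings t ! u @ r else r @ bitstrings t ! u))"
    unfolding block_def nth_bitstrings[OF assms] by (auto simp: set_bitstrings)
  also have "\<dots> \<longleftrightarrow> length z = 2 * t \<and> half d t z = bitstrings t ! u"
  proof
    assume "length z = 2 * t \<and> half d t z = bitstrings t ! u"
    then have "length z = 2 * t" "bitstrings t ! u = half d t z" by simp_all
    then show "\<exists>r. length r = t \<and> z = (if d then bitstrings t ! u @ r else r @ bitstrings t ! u)"
      by (intro exI[of _ "half (\<not> d) t z"]) (simp add: half_def)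
  next
    assume "\<exists>r. length r = t \<and> z = (if d then bitstrings t ! u @ r else r @ bitstrings t ! u)"
    then obtain r where "length r = t" "z = (if d then bitstrings t ! u @ r else r @ bitstrings t ! u)" by blast
    then show "length z = 2 * t \<and> half d t z = bitstrings t ! u"
      using length_nth_bitstrings[OF assms] by (simp add: half_def)
  qed
  finally show ?thesis .
qed

lemma length_block [simp]: "length (block d t u) = 2 ^ t"
  by (simp add: block_def)

lemma length_mix [simp]: "length (mix d t ws i) = 2 ^ t * 2 ^ t"
  by (simp add: mix_def length_concat comp_def sum_list_triv)

lemma set_mix:
  assumes "ws \<noteq> []"
  shows "set (mix d t ws i) =
    (\<Union>u<2 ^ t. (\<lambda>z. ws ! ((i + u) mod length ws) @ z) ` set (block d t u))"
proof -
  have "hd (drop ((i + u) mod length ws) ws) = ws ! ((i + u) mod length ws)" for u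
    using assms by (intro hd_drop_conv_nth) simp
  then show ?thesis by (simp add: mix_def lessThan_atLeast0)
qed

lemma length_spread [simp]: "length (spread d t ws) = length ws"
  by (simp add: spread_def)

lemma length_in_spread: "x \<in> set (spread d t ws) \<Longrightarrow> length x = 2 ^ t * 2 ^ t"
  by (auto simp: spread_def)

lemma ex_bitstring_index: "length z = t \<Longrightarrow> \<exists>u<2 ^ t. z = bitstrings t ! u"
proof -
  assume "length z = t"
  then have "z \<in> set (bitstrings t)" unfolding set_bitstrings by simp
  then show ?thesis unfolding in_set_conv_nth by auto
qed

lemma set_spread: "(\<Union>x\<in>set (spread d t ws). set x) = tails (2 * t) (set ws)"
proof (cases "ws = []")
  case True
  then show ?thesis by (simp add: spread_def tails_def)
next
  case False
  define M where "M = length ws"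
  have M: "M > 0" using False by (simp add: M_def)
  show ?thesis
  proof
    show "(\<Union>x\<in>set (spread d t ws). set x) \<subseteq> tails (2 * t) (set ws)"
    proof
      fix y assume "y \<in> (\<Union>x\<in>set (spread d t ws). set x)"
      then obtain i where "y \<in> set (mix d t ws i)" by (auto simp: spread_def)
      then obtain u z where "u < 2 ^ t" "z \<in> set (block d t u)" "y = ws ! ((i + u) mod length ws) @ z"
        unfolding set_mix[OF False] by blast
      moreover have "ws ! ((i + u) mod length ws) \<in> set ws" using False by simp
      ultimately show "y \<in> tails (2 * t) (set ws)" unfolding tails_def using mem_block by blast
    qed
    show "tails (2 * t) (set ws) \<subseteq> (\<Union>x\<in>set (spread d t ws). set x)"
    proof
      fix y assume "y \<in> tails (2 * t) (set ws)"
      then obtain k z where k: "k < M" and z: "length z = 2 * t" and y: "y = ws ! k @ z"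
        unfolding tails_def M_def by (auto simp: in_set_conv_nth)
      have "\<exists>u<2 ^ t. z \<in> set (block d t u)"
      proof -
        have "length (half d t z) = t" using z by (simp add: half_def)
        from ex_bitstring_index[OF this] show ?thesis using z by (auto simp: mem_block)
      qed
      then obtain u where u: "u < 2 ^ t" "z \<in> set (block d t u)" by blast
      \<comment> \<open>Solves \<open>i + u = k\<close> modulo \<open>M\<close>, with
        \<open>M - u mod M\<close> in the role of the negative of \<open>u\<close>.\<close>
      define i where "i = (k + (M - u mod M)) mod M"
      have "(i + u) mod M = (k + (M - u mod M) + u) mod M"
        by (simp add: i_def mod_add_left_eq)
      also have "\<dots> = (k + (M - u mod M) + u mod M) mod M"
        by (simp add: mod_add_right_eq)
      also have "k + (M - u mod M) + u mod M = k + M"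
        using mod_less_divisor[OF M, of u] by linarith
      finally have i: "(i + u) mod M = k" using k by simp
      have "y \<in> set (mix d t ws i)"
        unfolding set_mix[OF False] using u i by (auto simp: y M_def)
      moreover have "i < M" using M by (simp add: i_def)
      ultimately show "y \<in> (\<Union>x\<in>set (spread d t ws). set x)"
        by (auto simp: spread_def M_def)
    qed
  qed
qed


lemma filter_not_mem_filter: "filter (\<lambda>w. w \<notin> set (filter f ws)) ws = filter (\<lambda>w. \<not> f w) ws"
  by (intro filter_cong) auto

lemma length_filter_not: "length (filter (\<lambda>w. w \<notin> set (filter f ws)) ws) = length ws - length (filter f ws)"
  unfolding filter_not_mem_filter using sum_length_filter_compl[of f ws] by simp

lemma refine_cases:
  assumes "x \<in> set (refine d L W p)"
  obtains
    (busted) "busted W p" "pwords x \<in> set (spread d (2 * L) (pwords p))"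
      "mass x = mass p * length (pwords p)" "base x = mass p * length (pwords p)" "cls x = L"
  | (win) "\<not> busted W p" "pwords x \<in> set (spread d (2 * L) W)"
      "mass x = mass p * (5 * length (pwords p) - 4 * length W)" "base x = mass x" "cls x = L"
  | (out) "\<not> busted W p" "pwords x \<in> set (spread d (2 * L) (filter (\<lambda>w. w \<notin> set W) (pwords p)))"
      "mass x = mass p * (length (pwords p) - 4 * length W)" "base x = base p * length (pwords p)" "cls x = cls p"
  using assms unfolding refine_def Let_def by (auto split: if_splits)

lemma length_refine:
  assumes "W = filter f (pwords p)"
  shows "length (refine d L W p) = length (pwords p)"
  unfolding refine_def Let_def assms filter_not_mem_filter
  using sum_length_filter_compl[of f "pwords p"] by simp

lemma length_pwords_refine:
  assumes "x \<in> set (refine d L W p)"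
  shows "length (pwords x) = 2 ^ (4 * L)"
proof -
  have "length (pwords x) = 2 ^ (2 * L) * 2 ^ (2 * L)"
    using assms by (rule refine_cases) (auto dest: length_in_spread)
  then show ?thesis by (simp flip: power_add)
qed

lemma set_words_spread: "(\<Union>x\<in>set (map (\<lambda>y. (y, c)) (spread d (2 * L) ws)). set (pwords x)) = tails (4 * L) (set ws)"
  using set_spread[of d "2 * L" ws] by simp

lemma words_refine:
  assumes "W = filter f (pwords p)"
  shows "(\<Union>x\<in>set (refine d L W p). set (pwords x)) = tails (4 * L) (set (pwords p))"
proof (cases "busted W p")
  case False
  have "tails (4 * L) (set (pwords p)) =
      tails (4 * L) (set W) \<union> tails (4 * L) (set (filter (\<lambda>w. w \<notin> set W) (pwords p)))"
    unfolding tails_Un[symmetric] using assms by (intro arg_cong[of _ _ "tails (4 * L)"]) auto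
  then show ?thesis
    using False by (simp only: refine_def Let_def if_False set_append UN_Un set_words_spread)
qed (simp only: refine_def Let_def if_True set_words_spread)

text \<open>The invariant of a running game: at most half of its initial capital is gone.\<close>

definition valid :: "piece \<Rightarrow> bool" where
  "valid p \<longleftrightarrow> 0 < mass p \<and> mass p \<le> base p \<and> base p \<le> 2 * mass p"

text \<open>If \<open>4 * K\<close> reached \<open>N\<close>, the truncated difference would be 0,
  and the positive \<open>base\<close> would make the piece busted.\<close>

lemma not_busted_bound:
  assumes "\<not> busted W p" "valid p" "pwords p \<noteq> []"
  shows "4 * length W < length (pwords p)"
proof (rule ccontr)
  assume "\<not> ?thesis"
  then have "length (pwords p) - 4 * length W = 0" by simp
  with assms show False by (auto simp: busted_def valid_def)
qed

lemma valid_refine: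
  assumes x: "x \<in> set (refine d L W p)" and p: "valid p" "pwords p \<noteq> []"
  shows "valid x"
  using x
proof (cases rule: refine_cases)
  case busted
  then show ?thesis using p by (simp add: valid_def)
next
  case win
  then show ?thesis using not_busted_bound[OF win(1) p] p by (simp add: valid_def)
next
  case out
  \<comment> \<open>The new upper bound on \<open>base\<close> is precisely the negation of
    \<open>busted\<close>.\<close>
  then show ?thesis using not_busted_bound[OF out(1) p] p
    by (auto simp: valid_def busted_def intro: mult_le_mono)
qed

lemma sum_mass_refine:
  assumes W: "W = filter f (pwords p)" and p: "valid p" "pwords p \<noteq> []"
  shows "sum_list (map mass (refine d L W p)) = mass p * (length (pwords p) * length (pwords p))"
proof (cases "busted W p")
  case False
  define N K where "N = length (pwords p)" and "K = length W"
  have "4 * K < N" using not_busted_bound[OF False p] by (simp add: N_def K_def)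
  then obtain j where N: "N = 4 * K + j" by (metis less_imp_le le_Suc_ex)
  have "K * (5 * N - 4 * K) + (N - K) * (N - 4 * K) = N * N"
    unfolding N by (simp add: algebra_simps)
  moreover have "sum_list (map mass (refine d L W p)) =
      K * (mass p * (5 * N - 4 * K)) + (N - K) * (mass p * (N - 4 * K))"
    using False length_filter_not[of f "pwords p", folded W]
    by (simp only: refine_def Let_def if_False map_append sum_list_append map_map comp_def fst_conv snd_conv
      sum_list_triv length_spread N_def K_def of_nat_id)
  moreover have "a * (m * x) + b * (m * y) = m * (a * x + b * y)" for a b m x y :: nat
    by (simp add: algebra_simps)
  ultimately show ?thesis by (simp only: N_def)
qed (simp add: refine_def Let_def comp_def sum_list_triv algebra_simps)

definition partitioned :: "nat \<Rightarrow> nat \<Rightarrow> piece list \<Rightarrow> bool" where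
  "partitioned L n P \<longleftrightarrow> n \<le> L \<and> length P = 2 ^ n \<and> (\<forall>p\<in>set P. length (pwords p) = 2 ^ (L - n))
    \<and> (\<Union>p\<in>set P. set (pwords p)) = words L"

text \<open>Disjointness comes from counting: all pieces together have \<open>2 ^ L\<close> entries
  and cover \<open>2 ^ L\<close> words, so nothing occurs twice. Refinement thus only has to
  preserve sizes and coverage.\<close>

lemma partitioned_distinct:
  assumes "partitioned L n P"
  shows "distinct (concat (map pwords P))" "distinct P"
    "\<And>p. p \<in> set P \<Longrightarrow> distinct (pwords p)"
    "\<And>p q w. p \<in> set P \<Longrightarrow> q \<in> set P \<Longrightarrow> w \<in> set (pwords p) \<Longrightarrow> w \<in> set (pwords q) \<Longrightarrow> p = q"
proof -
  have "length (concat (map pwords P)) = sum_list (map (\<lambda>p. 2 ^ (L - n)) P)"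
    unfolding length_concat map_map comp_def using assms
    by (intro arg_cong[of _ _ sum_list] map_cong) (auto simp: partitioned_def)
  also have "\<dots> = 2 ^ L"
    using assms by (simp add: partitioned_def sum_list_triv flip: power_add)
  also have "\<dots> = card (set (concat (map pwords P)))"
    using assms by (simp add: partitioned_def card_words)
  finally show *: "distinct (concat (map pwords P))"
    by (intro card_distinct) simp
  have "pwords p \<noteq> []" if "p \<in> set P" for p
    using assms that by (auto simp: partitioned_def)
  then have "[] \<notin> pwords ` set P" by (metis imageE)
  then have "removeAll [] (map pwords P) = map pwords P" by (intro removeAll_id) simp
  with * have **: "distinct (map pwords P)" "\<forall>ys\<in>set (map pwords P). distinct ys"
     "\<forall>ys zs. ys \<in> set (map pwords P) \<and> zs \<in> set (map pwords P) \<and> ys \<noteq> zs \<longrightarrow> set ys \<inter> set zs = {}"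
    unfolding distinct_concat_iff by simp_all
  from **(1) show "distinct P" by (simp add: distinct_map)
  from **(2) show "\<And>p. p \<in> set P \<Longrightarrow> distinct (pwords p)" by simp
  fix p q w assume pq: "p \<in> set P" "q \<in> set P" "w \<in> set (pwords p)" "w \<in> set (pwords q)"
  then have "pwords p \<in> set (map pwords P)" "pwords q \<in> set (map pwords P)" by simp_all
  with **(3) pq have "pwords p = pwords q" by blast
  with **(1) pq show "p = q" by (auto simp: distinct_map dest: inj_onD)
qed

lemma sum_list_concat_map: "sum_list (map f (concat xss)) = sum_list (map (\<lambda>xs. sum_list (map f xs)) xss)"
  for f :: "'a \<Rightarrow> 'b :: comm_monoid_add"
  by (induction xss) simp_all

lemma open_of_tails:
  assumes "W \<subseteq> words L" shows "open_of (tails t W) = open_of W"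
proof -
  have "\<alpha> \<in> open_of (tails t W) \<longleftrightarrow> \<alpha> \<in> open_of W" for \<alpha>
  proof -
    have "\<alpha> \<in> open_of (tails t W) \<longleftrightarrow> prefix_of \<alpha> (L + t) \<in> tails t W"
      using assms by (intro mem_open_of_level) (auto simp: tails_def)
    also have "\<dots> \<longleftrightarrow> prefix_of \<alpha> L \<in> W"
    proof
      assume "prefix_of \<alpha> (L + t) \<in> tails t W"
      then obtain w z where wz: "w \<in> W" "prefix_of \<alpha> (L + t) = w @ z" by (auto simp: tails_def)
      then have "prefix_of \<alpha> L = take L (w @ z)" by (simp flip: wz(2) add: take_map)
      also have "\<dots> = w" using wz(1) assms by auto
      finally show "prefix_of \<alpha> L \<in> W" using wz(1) by simp
    next
      assume "prefix_of \<alpha> L \<in> W"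
      moreover have "prefix_of \<alpha> (L + t) = prefix_of \<alpha> L @ map \<alpha> [L..<L + t]"
        by (simp only: upt_add_eq_append[OF le0] map_append)
      ultimately show "prefix_of \<alpha> (L + t) \<in> tails t W"
        unfolding tails_def by (intro CollectI exI[of _ "prefix_of \<alpha> L"] exI[of _ "map \<alpha> [L..<L + t]"]) simp
    qed
    also have "\<dots> \<longleftrightarrow> \<alpha> \<in> open_of W"
      using assms by (intro mem_open_of_level[symmetric]) auto
    finally show ?thesis .
  qed
  then show ?thesis by blast
qed

text \<open>The pieces below the node \<open>v\<close>: the tree of a strategy is read off the order
  of the list, each bit choosing a half. The lists in question have a power of two as
  length.\<close>

definition sub :: "word \<Rightarrow> piece list \<Rightarrow> piece list" where
  "sub v P = foldl (\<lambda>P b. if b then drop (length P div 2) P else take (length P div 2) P) P v"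

lemma sub_Nil [simp]: "sub [] P = P"
  and sub_Cons: "sub (b # v) P = sub v (if b then drop (length P div 2) P else take (length P div 2) P)"
  and sub_snoc: "sub (v @ [b]) P = (if b then drop (length (sub v P) div 2) (sub v P) else take (length (sub v P) div 2) (sub v P))"
  by (simp_all add: sub_def)

lemma length_sub: "length P = 2 ^ n \<Longrightarrow> length v \<le> n \<Longrightarrow> length (sub v P) = 2 ^ (n - length v)"
proof (induction v arbitrary: P n)
  case (Cons b v)
  then obtain k where n: "n = Suc k" by (cases n) auto
  have "length (if b then drop (length P div 2) P else take (length P div 2) P) = 2 ^ k"
    using Cons.prems by (simp add: n)
  from Cons.IH[OF this] Cons.prems show ?case by (simp add: sub_Cons n)
qed simp

lemma take_concat_map:
  "\<forall>p\<in>set P. length (f p) = c \<Longrightarrow> take (m * c) (concat (map f P)) = concat (map f (take m P))"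
  "\<forall>p\<in>set P. length (f p) = c \<Longrightarrow> drop (m * c) (concat (map f P)) = concat (map f (drop m P))"
proof (induction P arbitrary: m)
  case (Cons p P)
  { case 1 then show ?case using Cons by (cases m) simp_all }
  { case 2 then show ?case using Cons by (cases m) simp_all }
qed simp_all

lemma length_concat_map: "\<forall>p\<in>set P. length (f p) = c \<Longrightarrow> length (concat (map f P)) = length P * c"
  by (induction P) simp_all

lemma set_sub_subset: "set (sub v P) \<subseteq> set P"
proof (induction v arbitrary: P)
  case (Cons b v)
  have "set (if b then drop (length P div 2) P else take (length P div 2) P) \<subseteq> set P"
    by (simp add: set_drop_subset set_take_subset)
  with Cons.IH show ?case unfolding sub_Cons by blast
qed simp

text \<open>When every piece is replaced by equally many pieces, halving commutes with the
  replacement. So a node keeps exactly the descendants of its pieces at the next stage.\<close>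

lemma sub_concat:
  "length P = 2 ^ n \<Longrightarrow> length v \<le> n \<Longrightarrow> \<forall>p\<in>set P. length (f p) = c \<Longrightarrow>
    sub v (concat (map f P)) = concat (map f (sub v P))"
proof (induction v arbitrary: P n)
  case (Cons b v)
  then obtain k where n: "n = Suc k" by (cases n) auto
  let ?Q = "if b then drop (length P div 2) P else take (length P div 2) P"
  have len: "length ?Q = 2 ^ k" using Cons.prems by (simp add: n)
  have "set ?Q \<subseteq> set P" by (simp add: set_drop_subset set_take_subset)
  then have "\<forall>p\<in>set ?Q. length (f p) = c" using Cons.prems(3) by blast
  from Cons.IH[OF len _ this] Cons.prems(2)
  have *: "sub v (concat (map f ?Q)) = concat (map f (sub v ?Q))"
    by (simp add: n)
  have "length (concat (map f P)) div 2 = 2 ^ k * c" "length P div 2 = 2 ^ k"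
    using length_concat_map[OF Cons.prems(3)] Cons.prems(1) by (simp_all add: n)
  then have "(if b then drop (length (concat (map f P)) div 2) (concat (map f P))
      else take (length (concat (map f P)) div 2) (concat (map f P))) = concat (map f ?Q)"
    using Cons.prems(3) by (simp add: take_concat_map)
  then show ?case using * by (simp only: sub_Cons)
qed simp

lemma ex_sub: "length P = 2 ^ n \<Longrightarrow> p \<in> set P \<Longrightarrow> \<exists>v. length v = n \<and> sub v P = [p]"
proof (induction n arbitrary: P)
  case 0
  then have "P = [p]" by (auto simp: length_Suc_conv)
  then show ?case by (intro exI[of _ "[]"]) simp
next
  case (Suc n)
  have "p \<in> set (take (length P div 2) P @ drop (length P div 2) P)"
    using Suc.prems(2) by simp
  then have "p \<in> set (take (length P div 2) P) \<or> p \<in> set (drop (length P div 2) P)"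
    unfolding set_append by blast
  then have "\<exists>b. p \<in> set (if b then drop (length P div 2) P else take (length P div 2) P)"
  proof
    assume "p \<in> set (take (length P div 2) P)" then show ?thesis by (intro exI[of _ False]) simp
  next
    assume "p \<in> set (drop (length P div 2) P)" then show ?thesis by (intro exI[of _ True]) simp
  qed
  then obtain b where "p \<in> set (if b then drop (length P div 2) P else take (length P div 2) P)" ..
  moreover have "length (if b then drop (length P div 2) P else take (length P div 2) P) = 2 ^ n"
    using Suc.prems by simp
  ultimately obtain v where "length v = n" "sub v (if b then drop (length P div 2) P else take (length P div 2) P) = [p]"
    using Suc.IH by blast
  then show ?case by (intro exI[of _ "b # v"]) (simp add: sub_Cons)
qed

section \<open>The strategy defined by a tree\<close>

lemma sum_list_take_drop: "sum_list (map f xs) = sum_list (map f (take n xs)) + (sum_list (map f (drop n xs)) :: nat)"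
  by (metis append_take_drop_id map_append sum_list_append)

text \<open>Abstracts from the choice of bets, so that both strategies share all facts on mass,
  regions and capital. The first tree can influence the bets of the second because \<open>W\<close>
  depends on the stage.\<close>

locale tower =
  fixes P :: "nat \<Rightarrow> piece list" and d :: bool and W :: "nat \<Rightarrow> piece \<Rightarrow> word list"
  assumes P_0: "P 0 = [([[False], [True]], 1, 1, 0)]"
    and P_Suc: "P (Suc s) = concat (map (\<lambda>p. refine d (lev s) (W s p) p) (P s))"
    and W_filter: "\<exists>f. W s p = filter f (pwords p)"
begin

abbreviation width :: "nat \<Rightarrow> nat" where
  "width s \<equiv> 2 ^ (lev s - dep s)"

lemma length_refine_W: "length (refine d L (W s p) p) = length (pwords p)"
  using W_filter length_refine by metis

lemma words_refine_W: "(\<Union>x\<in>set (refine d L (W s p) p). set (pwords x)) = tails (4 * L) (set (pwords p))"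
  using W_filter words_refine by metis

lemma partitioned_P: "partitioned (lev s) (dep s) (P s)"
proof (induction s)
  case 0
  have "set [[False], [True]] = words (Suc 0)"
    by (auto simp: length_Suc_conv)
  then show ?case by (simp add: partitioned_def P_0 lev_def)
next
  case (Suc s)
  have len: "\<forall>p\<in>set (P s). length (refine d (lev s) (W s p) p) = width s"
    using Suc by (simp add: partitioned_def length_refine_W)
  have 1: "length (P (Suc s)) = 2 ^ lev s"
    unfolding P_Suc length_concat_map[OF len] using Suc by (simp add: partitioned_def flip: power_add)
  have 2: "\<forall>p\<in>set (P (Suc s)). length (pwords p) = 2 ^ (lev (Suc s) - lev s)"
    unfolding P_Suc by (auto simp: lev_Suc dest: length_pwords_refine)
  have "(\<Union>p\<in>set (P (Suc s)). set (pwords p)) =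
      (\<Union>p\<in>set (P s). \<Union>x\<in>set (refine d (lev s) (W s p) p). set (pwords x))"
    unfolding P_Suc by auto
  also have "\<dots> = tails (4 * lev s) (words (lev s))"
    unfolding words_refine_W tails_UN[symmetric] using Suc by (simp add: partitioned_def)
  also have "\<dots> = words (lev (Suc s))"
    by (simp add: tails_words lev_Suc)
  finally show ?case using 1 2 by (simp add: partitioned_def lev_Suc)
qed

lemma length_P: "length (P s) = 2 ^ dep s"
  and length_pwords: "p \<in> set (P s) \<Longrightarrow> length (pwords p) = width s"
  and words_P: "(\<Union>p\<in>set (P s). set (pwords p)) = words (lev s)"
  using partitioned_P[of s] by (simp_all add: partitioned_def)

lemma pwords_nonempty: "p \<in> set (P s) \<Longrightarrow> pwords p \<noteq> []"
  using length_pwords[of p s] by auto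

lemma in_P_Suc: "x \<in> set (P (Suc s)) \<longleftrightarrow> (\<exists>p\<in>set (P s). x \<in> set (refine d (lev s) (W s p) p))"
  by (simp add: P_Suc)

lemma valid_P: "p \<in> set (P s) \<Longrightarrow> valid p"
proof (induction s arbitrary: p)
  case 0
  then show ?case by (simp add: P_0 valid_def)
next
  case (Suc s)
  then show ?case using valid_refine pwords_nonempty unfolding in_P_Suc by blast
qed

abbreviation total :: "nat \<Rightarrow> nat" where
  "total s \<equiv> sum_list (map mass (P s))"

text \<open>Each piece divides its mass fairly, so the mass below a node grows by the same factor as
  the total. This makes \<open>ratio\<close> independent of the stage.\<close>

lemma submass_Suc:
  assumes "length v \<le> dep s"
  shows "sum_list (map mass (sub v (P (Suc s)))) = sum_list (map mass (sub v (P s))) * (width s * width s)"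
proof -
  have "sum_list (map mass (sub v (P (Suc s)))) =
      sum_list (map (\<lambda>p. sum_list (map mass (refine d (lev s) (W s p) p))) (sub v (P s)))"
    unfolding P_Suc using assms length_P length_pwords
    by (subst sub_concat[where n = "dep s" and c = "width s"])
       (simp_all add: length_refine_W sum_list_concat_map comp_def)
  also have "\<dots> = sum_list (map (\<lambda>p. mass p * (width s * width s)) (sub v (P s)))"
  proof (intro arg_cong[of _ _ sum_list] map_cong refl)
    fix p assume "p \<in> set (sub v (P s))"
    then have p: "p \<in> set (P s)" using set_sub_subset by blast
    obtain f where "W s p = filter f (pwords p)" using W_filter by blast
    from sum_mass_refine[OF this valid_P[OF p] pwords_nonempty[OF p]]
    show "sum_list (map mass (refine d (lev s) (W s p) p)) = mass p * (width s * width s)"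
      by (simp add: length_pwords[OF p])
  qed
  finally show ?thesis by (simp add: sum_list_mult_const)
qed

lemma total_Suc: "total (Suc s) = total s * (width s * width s)"
  using submass_Suc[of "[]" s] by simp

lemma total_pos: "0 < total s"
  by (induction s) (simp_all add: total_Suc, simp add: P_0)

definition ratio :: "nat \<Rightarrow> word \<Rightarrow> rat" where
  "ratio s v = of_nat (sum_list (map mass (sub v (P s)))) / of_nat (total s)"

definition node_words :: "nat \<Rightarrow> word \<Rightarrow> word list" where
  "node_words s v = concat (map pwords (sub v (P s)))"

lemma ratio_stable:
  assumes "s \<le> t" "length v \<le> dep s" shows "ratio t v = ratio s v"
  using assms(1)
proof (induction rule: dec_induct)
  case (step k)
  have "dep s \<le> dep k"
    using step(1) by (cases s; cases k) (auto intro: lev_mono)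
  then have "ratio (Suc k) v = ratio k v"
    using assms(2) by (simp add: ratio_def submass_Suc total_Suc)
  with step show ?case by simp
qed simp

lemma node_words_subset: "set (node_words s v) \<subseteq> words (lev s)"
  unfolding node_words_def words_P[symmetric] using set_sub_subset[of v "P s"] by auto

lemma region_Suc:
  assumes "length v \<le> dep s"
  shows "open_of (set (node_words (Suc s) v)) = open_of (set (node_words s v))"
proof -
  have len: "\<forall>p\<in>set (P s). length (refine d (lev s) (W s p) p) = width s"
    by (simp add: length_refine_W length_pwords)
  have "set (node_words (Suc s) v) =
      (\<Union>p\<in>set (sub v (P s)). \<Union>x\<in>set (refine d (lev s) (W s p) p). set (pwords x))"
    unfolding P_Suc node_words_def sub_concat[OF length_P assms len] by simp
  also have "\<dots> = tails (4 * lev s) (set (node_words s v))"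
    unfolding words_refine_W tails_UN[symmetric] by (simp add: node_words_def)
  finally show ?thesis using open_of_tails[OF node_words_subset] by simp
qed

lemma region_stable:
  assumes "s \<le> t" "length v \<le> dep s"
  shows "open_of (set (node_words t v)) = open_of (set (node_words s v))"
  using assms(1)
proof (induction rule: dec_induct)
  case (step k)
  have "dep s \<le> dep k"
    using step(1) by (cases s; cases k) (auto intro: lev_mono)
  then show ?case using step assms(2) by (simp add: region_Suc)
qed simp

lemma distinct_node_words: "distinct (node_words s v)"
proof (induction v rule: rev_induct)
  case Nil
  then show ?case using partitioned_distinct(1)[OF partitioned_P] by (simp add: node_words_def)
next
  case (snoc b v)
  let ?X = "sub v (P s)" let ?n = "length ?X div 2"
  have "distinct (concat (map pwords (take ?n ?X @ drop ?n ?X)))"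
    using snoc by (simp add: node_words_def)
  then show ?case unfolding node_words_def sub_snoc map_append concat_append by auto
qed

lemma length_node_words:
  assumes "length v \<le> dep s"
  shows "length (node_words s v) = 2 ^ (lev s - length v)"
proof -
  have "\<forall>p\<in>set (sub v (P s)). length (pwords p) = width s"
    using set_sub_subset length_pwords by blast
  from length_concat_map[OF this] length_sub[OF length_P assms] show ?thesis
    using assms dep_less_lev[of s] by (simp add: node_words_def flip: power_add)
qed

lemma lam_region:
  assumes "length v \<le> dep s"
  shows "lam (open_of (set (node_words s v))) = 1 / 2 ^ length v"
proof -
  have "card (set (node_words s v)) = 2 ^ (lev s - length v)"
    by (simp add: distinct_card distinct_node_words length_node_words[OF assms])
  moreover have "(2::real) ^ lev s = 2 ^ (lev s - length v) * 2 ^ length v"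
    using assms dep_less_lev[of s] by (simp flip: power_add)
  ultimately show ?thesis by (simp add: lam_open_of_level[OF node_words_subset])
qed

text \<open>Every stage with \<open>length v \<le> dep s\<close> gives the same value;
  \<open>length v\<close> is a convenient computable choice of such a stage.\<close>

definition strat :: strategy where
  "strat = (\<lambda>v. Some (ratio (length v) v), \<lambda>v. Some (open_of (set (node_words (length v) v))))"

lemma mass_strat: "dep s \<ge> length v \<Longrightarrow> fst strat v = Some (ratio s v)"
  and region_strat: "dep s \<ge> length v \<Longrightarrow> snd strat v = Some (open_of (set (node_words s v)))"
proof -
  assume v: "dep s \<ge> length v"
  have "length v \<le> s \<Longrightarrow> ratio s v = ratio (length v) v" "s \<le> length v \<Longrightarrow> ratio (length v) v = ratio s v"
    using v le_dep[of "length v"] by (simp_all only: ratio_stable)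
  then show "fst strat v = Some (ratio s v)" unfolding strat_def by (cases "s \<le> length v") auto
  have "length v \<le> s \<Longrightarrow> open_of (set (node_words s v)) = open_of (set (node_words (length v) v))"
    "s \<le> length v \<Longrightarrow> open_of (set (node_words (length v) v)) = open_of (set (node_words s v))"
    using v le_dep[of "length v"] by (simp_all only: region_stable)
  then show "snd strat v = Some (open_of (set (node_words s v)))"
    unfolding strat_def by (cases "s \<le> length v") auto
qed

lemma mass_function_strat: "mass_function (fst strat)"
  unfolding mass_function_def
proof (intro conjI allI impI disjI2)
  fix v q assume "fst strat v = Some q"
  then show "0 \<le> q" by (auto simp: strat_def ratio_def)
next
  fix v :: word
  \<comment> \<open>A common stage at which \<open>v\<close> and both of its children can be
    evaluated.\<close>
  let ?s = "Suc (length v)"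
  have dep: "length v \<le> dep ?s" "length (v @ [b]) \<le> dep ?s" for b
    using le_dep[of ?s] by auto
  have "ratio ?s v = ratio ?s (v @ [False]) + ratio ?s (v @ [True])"
    using sum_list_take_drop[of mass "sub v (P ?s)" "length (sub v (P ?s)) div 2"]
    by (simp add: ratio_def sub_snoc flip: add_divide_distrib of_nat_add)
  then show "\<exists>a b. fst strat (v @ [False]) = Some a \<and> fst strat (v @ [True]) = Some b \<and> fst strat v = Some (a + b)"
    by (intro exI[of _ "ratio ?s (v @ [False])"] exI[of _ "ratio ?s (v @ [True])"] conjI)
       (simp_all add: mass_strat[OF dep(1)] mass_strat[OF dep(2)] del: dep.simps)
qed

lemma sequence_set_function_strat: "sequence_set_function (snd strat)"
  unfolding sequence_set_function_def sequence_partition_function_def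
proof (intro conjI allI impI disjI2)
  fix v C assume "snd strat v = Some C"
  then have "C = open_of (set (node_words (length v) v))" by (simp add: strat_def)
  then show "clopen C" using represents_level[OF node_words_subset] by (auto simp: clopen_def)
next
  have "open_of (words L) = UNIV" for L
    using mem_open_of_words[of _ L "\<lambda>_. True"] by auto
  moreover have "set (node_words 0 []) = words (lev 0)"
    using words_P[of 0] by (simp add: node_words_def)
  ultimately show "snd strat [] = Some UNIV" by (simp add: strat_def)
next
  fix v :: word
  let ?s = "Suc (length v)" let ?n = "length (sub v (P (Suc (length v)))) div 2"
  have dep: "length v \<le> dep ?s" "length (v @ [b]) \<le> dep ?s" for b
    using le_dep[of ?s] by auto
  have split: "node_words ?s v = node_words ?s (v @ [False]) @ node_words ?s (v @ [True])"
    unfolding node_words_def sub_snoc by (simp flip: concat_append map_append)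
  have "set (node_words ?s (v @ [False])) \<inter> set (node_words ?s (v @ [True])) = {}"
    using distinct_node_words[of ?s v] unfolding split by simp
  then have "open_of (set (node_words ?s (v @ [False]))) \<inter> open_of (set (node_words ?s (v @ [True]))) = {}"
    using node_words_subset by (auto simp: mem_open_of_level[where L = "lev ?s"] subset_iff)
  moreover have "open_of (set (node_words ?s v)) =
      open_of (set (node_words ?s (v @ [False]))) \<union> open_of (set (node_words ?s (v @ [True])))"
    unfolding split by (auto simp: open_of_def)
  ultimately show "\<exists>A B. snd strat (v @ [False]) = Some A \<and> snd strat (v @ [True]) = Some B \<and>
      snd strat v = Some (A \<union> B) \<and> A \<inter> B = {}"
    by (intro exI[of _ "open_of (set (node_words ?s (v @ [False])))"]
          exI[of _ "open_of (set (node_words ?s (v @ [True])))"] conjI)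
       (simp_all add: region_strat[OF dep(1)] region_strat[OF dep(2)] del: dep.simps)
next
  fix v A B assume "snd strat (v @ [False]) = Some A" "snd strat (v @ [True]) = Some B"
  then have "A = open_of (set (node_words (Suc (length v)) (v @ [False])))"
    "B = open_of (set (node_words (Suc (length v)) (v @ [True])))"
    by (simp_all add: strat_def)
  then show "lam A = lam B" using le_dep[of "Suc (length v)"] by (simp add: lam_region)
qed

lemma sequence_set_strat: "sequence_set_betting_strategy strat"
  using mass_function_strat sequence_set_function_strat
  by (simp add: sequence_set_betting_strategy_def betting_strategy_def sequence_set_function_def)

lemma total_strat: "total_strategy strat"
  by (simp add: total_strategy_def strat_def)

lemma computable_strat:
  assumes P: "comput P" shows "computable_strategy strat"
proof -
  note P' = comput_comp[OF P]
  \<comment> \<open>The even code \<open>2 * n\<close> denotes the integer \<open>n\<close> under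
    \<open>int_decode\<close>. The denominator is stored less one, as \<open>rat_of_code\<close>
    expects; the total is positive.\<close>
  have "comput (\<lambda>v. prod_encode (2 * sum_list (map mass (sub v (P (length v)))), total (length v) - 1))"
    unfolding sub_def by (intro comput_intro P')
  then obtain \<phi> where \<phi>: "partrec \<phi>" and
    \<phi>_eq: "\<And>v. \<phi> (word_code v) =
      Some (prod_encode (2 * sum_list (map mass (sub v (P (length v)))), total (length v) - 1))"
    unfolding comput_def enc_word enc_nat_def by blast
  have "int_decode (2 * n) = int n" for n
    using int_encode_inverse[of "int n"] by (simp add: int_encode_def sum_encode_def)
  then have "rat_of_code (prod_encode (2 * n, total s - 1)) = of_nat n / of_nat (total s)" for n s
    using total_pos[of s] by (simp add: rat_of_code_def)
  then have "computable_mass (fst strat)"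
    unfolding computable_mass_def using \<phi> \<phi>_eq by (intro exI[of _ \<phi>]) (simp add: strat_def ratio_def)
  moreover have "comput (\<lambda>v. node_words (length v) v)"
    unfolding node_words_def sub_def by (intro comput_intro P')
  then obtain \<psi> where \<psi>: "partrec \<psi>" "\<And>v. \<psi> (word_code v) = Some (enc (node_words (length v) v))"
    unfolding comput_def enc_word by blast
  have "codes_clopen (enc (node_words s v)) (open_of (set (node_words s v)))" for s v
    unfolding codes_clopen_def using represents_level[OF node_words_subset]
    by (intro exI[of _ "node_words s v"]) (simp add: enc_list_def enc_word[abs_def])
  then have "computable_partition (snd strat)"
    unfolding computable_partition_def using \<psi> by (intro exI[of _ \<psi>]) (simp add: strat_def)
  ultimately show ?thesis by (simp add: computable_strategy_def)
qed

text \<open>A piece has measure \<open>1 / 2 ^ dep s\<close>, so its capital is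
  \<open>mass p * 2 ^ dep s / total s\<close>; by \<open>ex_sub\<close> it is the value of the
  strategy at some node.\<close>

lemma succeeds_strat:
  assumes "\<And>B :: nat. \<exists>s. \<exists>p\<in>set (P s). prefix_of \<alpha> (lev s) \<in> set (pwords p) \<and> B * total s < mass p * 2 ^ dep s"
  shows "succeeds strat \<alpha>"
proof -
  have "\<exists>v q C. fst strat v = Some q \<and> snd strat v = Some C \<and> \<alpha> \<in> C \<and> of_rat q / lam C > real B" for B
  proof -
    from assms obtain s p where p: "p \<in> set (P s)" "prefix_of \<alpha> (lev s) \<in> set (pwords p)"
      "B * total s < mass p * 2 ^ dep s" by blast
    obtain v where v: "length v = dep s" "sub v (P s) = [p]"
      using ex_sub[OF length_P p(1)] by blast
    have nw: "node_words s v = pwords p" by (simp add: node_words_def v)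
    have "\<alpha> \<in> open_of (set (node_words s v))"
      using node_words_subset[of s v] p(2) by (subst mem_open_of_level[where L = "lev s"]) (auto simp: nw)
    moreover have "of_rat (ratio s v) / lam (open_of (set (node_words s v))) = real (mass p) / real (total s) * 2 ^ dep s"
      using v by (subst lam_region) (simp_all add: ratio_def of_rat_divide)
    moreover have "\<dots> > real B"
    proof -
      have "real (B * total s) < real (mass p * 2 ^ dep s)" using p(3) unfolding of_nat_less_iff .
      then show ?thesis using total_pos[of s] by (simp add: field_simps)
    qed
    ultimately show ?thesis
      using mass_strat[of v s] region_strat[of v s] v by (intro exI[of _ v]) auto
  qed
  then have "\<forall>B. \<exists>v. \<exists>q C. fst strat v = Some q \<and> snd strat v = Some C \<and> \<alpha> \<in> C \<and> of_rat q / lam C > real B"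
    by blast
  then show ?thesis unfolding succeeds_def by (rule choice[THEN exE]) blast
qed

end

section \<open>The capital along a sequence\<close>

lemma take_spread:
  assumes "x \<in> set (spread d t ws)" "y \<in> set x" "set ws \<subseteq> words L"
  shows "take L y \<in> set ws"
proof -
  have "y \<in> tails (2 * t) (set ws)"
    using set_spread[of d t ws] assms(1,2) by blast
  then show ?thesis using assms(3) unfolding tails_def by auto
qed

context tower
begin

lemma ex_piece: "\<exists>!p. p \<in> set (P s) \<and> prefix_of \<alpha> (lev s) \<in> set (pwords p)"
proof (rule ex_ex1I)
  have "prefix_of \<alpha> (lev s) \<in> (\<Union>p\<in>set (P s). set (pwords p))" unfolding words_P by simp
  then show "\<exists>p. p \<in> set (P s) \<and> prefix_of \<alpha> (lev s) \<in> set (pwords p)" by blast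
qed (use partitioned_distinct(4)[OF partitioned_P] in blast)

definition piece :: "seq \<Rightarrow> nat \<Rightarrow> piece" where
  "piece \<alpha> s = (THE p. p \<in> set (P s) \<and> prefix_of \<alpha> (lev s) \<in> set (pwords p))"

lemma piece_in: "piece \<alpha> s \<in> set (P s)"
  and prefix_in_piece: "prefix_of \<alpha> (lev s) \<in> set (pwords (piece \<alpha> s))"
  using theI'[OF ex_piece[of s \<alpha>]] by (simp_all add: piece_def)

lemma piece_unique: "p \<in> set (P s) \<Longrightarrow> prefix_of \<alpha> (lev s) \<in> set (pwords p) \<Longrightarrow> piece \<alpha> s = p"
  using ex_piece[of s \<alpha>] piece_in prefix_in_piece by blast

lemma pwords_subset: "p \<in> set (P s) \<Longrightarrow> set (pwords p) \<subseteq> words (lev s)"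
  using words_P[of s] by blast

lemma W_subset: "set (W s p) \<subseteq> set (pwords p)"
  using W_filter[of s p] by auto

lemma length_W: "length (W s p) \<le> length (pwords p)"
proof -
  obtain f where "W s p = filter f (pwords p)" using W_filter by blast
  then show ?thesis by simp
qed

abbreviation stuck :: "nat \<Rightarrow> piece \<Rightarrow> bool" where
  "stuck s p \<equiv> busted (W s p) p"

lemma refine_words:
  assumes p: "p \<in> set (P s)" and x: "x \<in> set (refine d (lev s) (W s p) p)" and y: "y \<in> set (pwords x)"
  shows "take (lev s) y \<in> set (pwords p)"
    "\<not> stuck s p \<Longrightarrow> cls x = lev s \<and> base x = mass x \<and> mass x = mass p * (5 * width s - 4 * length (W s p))
        \<and> take (lev s) y \<in> set (W s p)
      \<or> cls x = cls p \<and> base x = base p * width s \<and> mass x = mass p * (width s - 4 * length (W s p))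
        \<and> take (lev s) y \<notin> set (W s p)
        \<and> pwords x \<in> set (spread d (2 * lev s) (filter (\<lambda>w. w \<notin> set (W s p)) (pwords p)))"
    "stuck s p \<Longrightarrow> cls x = lev s \<and> base x = mass x \<and> mass x = mass p * width s"
proof -
  have sub: "set (pwords p) \<subseteq> words (lev s)" "set (W s p) \<subseteq> words (lev s)"
    "set (filter (\<lambda>w. w \<notin> set (W s p)) (pwords p)) \<subseteq> words (lev s)"
    using pwords_subset[OF p] W_subset[of s p] by auto
  note len = length_pwords[OF p]
  from x show "take (lev s) y \<in> set (pwords p)"
  proof (cases rule: refine_cases)
    case busted
    from take_spread[OF busted(2) y sub(1)] show ?thesis .
  next
    case win
    from take_spread[OF win(2) y sub(2)] show ?thesis using W_subset[of s p] by blast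
  next
    case out
    from take_spread[OF out(2) y sub(3)] show ?thesis by simp
  qed
  from x show "cls x = lev s \<and> base x = mass x \<and> mass x = mass p * (5 * width s - 4 * length (W s p))
        \<and> take (lev s) y \<in> set (W s p)
      \<or> cls x = cls p \<and> base x = base p * width s \<and> mass x = mass p * (width s - 4 * length (W s p))
        \<and> take (lev s) y \<notin> set (W s p)
        \<and> pwords x \<in> set (spread d (2 * lev s) (filter (\<lambda>w. w \<notin> set (W s p)) (pwords p)))" if "\<not> stuck s p"
  proof (cases rule: refine_cases)
    case out
    then show ?thesis using take_spread[OF out(2) y sub(3)] by (auto simp: len)
  qed (use that take_spread[OF _ y sub(2)] len in auto)
  from x show "cls x = lev s \<and> base x = mass x \<and> mass x = mass p * width s" if "stuck s p"
    by (cases rule: refine_cases) (use that len in auto)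
qed

lemma piece_Suc: "piece \<alpha> (Suc s) \<in> set (refine d (lev s) (W s (piece \<alpha> s)) (piece \<alpha> s))"
proof -
  obtain p where p: "p \<in> set (P s)" "piece \<alpha> (Suc s) \<in> set (refine d (lev s) (W s p) p)"
    using piece_in[of \<alpha> "Suc s"] unfolding in_P_Suc by blast
  have "take (lev s) (prefix_of \<alpha> (lev (Suc s))) = prefix_of \<alpha> (lev s)"
    by (simp add: take_map lev_Suc)
  then have "prefix_of \<alpha> (lev s) \<in> set (pwords p)"
    using refine_words(1)[OF p prefix_in_piece] by simp
  from piece_unique[OF p(1) this] p(2) show ?thesis by simp
qed

lemma piece_step:
  "stuck s (piece \<alpha> s) \<Longrightarrow> cls (piece \<alpha> (Suc s)) = lev s \<and> base (piece \<alpha> (Suc s)) = mass (piece \<alpha> (Suc s))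
    \<and> mass (piece \<alpha> (Suc s)) = mass (piece \<alpha> s) * width s"
  "\<not> stuck s (piece \<alpha> s) \<Longrightarrow> prefix_of \<alpha> (lev s) \<in> set (W s (piece \<alpha> s)) \<Longrightarrow>
    cls (piece \<alpha> (Suc s)) = lev s \<and> base (piece \<alpha> (Suc s)) = mass (piece \<alpha> (Suc s))
    \<and> mass (piece \<alpha> (Suc s)) = mass (piece \<alpha> s) * (5 * width s - 4 * length (W s (piece \<alpha> s)))"
  "\<not> stuck s (piece \<alpha> s) \<Longrightarrow> prefix_of \<alpha> (lev s) \<notin> set (W s (piece \<alpha> s)) \<Longrightarrow>
    cls (piece \<alpha> (Suc s)) = cls (piece \<alpha> s) \<and> base (piece \<alpha> (Suc s)) = base (piece \<alpha> s) * width s"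
proof -
  have tk: "take (lev s) (prefix_of \<alpha> (lev (Suc s))) = prefix_of \<alpha> (lev s)"
    by (simp add: take_map lev_Suc)
  note * = refine_words(2,3)[OF piece_in[of \<alpha> s] piece_Suc[of \<alpha> s] prefix_in_piece[of \<alpha> "Suc s"], unfolded tk]
  show "stuck s (piece \<alpha> s) \<Longrightarrow> cls (piece \<alpha> (Suc s)) = lev s \<and> base (piece \<alpha> (Suc s)) = mass (piece \<alpha> (Suc s))
    \<and> mass (piece \<alpha> (Suc s)) = mass (piece \<alpha> s) * width s" by (rule *(2))
  show "\<not> stuck s (piece \<alpha> s) \<Longrightarrow> prefix_of \<alpha> (lev s) \<in> set (W s (piece \<alpha> s)) \<Longrightarrow>
    cls (piece \<alpha> (Suc s)) = lev s \<and> base (piece \<alpha> (Suc s)) = mass (piece \<alpha> (Suc s))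
    \<and> mass (piece \<alpha> (Suc s)) = mass (piece \<alpha> s) * (5 * width s - 4 * length (W s (piece \<alpha> s)))"
    using *(1) by blast
  show "\<not> stuck s (piece \<alpha> s) \<Longrightarrow> prefix_of \<alpha> (lev s) \<notin> set (W s (piece \<alpha> s)) \<Longrightarrow>
    cls (piece \<alpha> (Suc s)) = cls (piece \<alpha> s) \<and> base (piece \<alpha> (Suc s)) = base (piece \<alpha> s) * width s"
    using *(1) by blast
qed

text \<open>The capital a piece would have if it had lost nothing since its last reset.\<close>

definition gain :: "seq \<Rightarrow> nat \<Rightarrow> real" where
  "gain \<alpha> s = real (base (piece \<alpha> s)) * 2 ^ dep s / real (total s)"

lemma gain_pos: "0 < gain \<alpha> s"
  using valid_P[OF piece_in[of \<alpha> s]] total_pos[of s] by (simp add: gain_def valid_def)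

lemma power_lev: "(2::real) ^ lev s = 2 ^ dep s * real (width s)"
  using dep_less_lev[of s] by (simp flip: power_add)

lemma gain_Suc:
  "gain \<alpha> (Suc s) = real (base (piece \<alpha> (Suc s))) / real (width s) * 2 ^ dep s / real (total s)"
  unfolding gain_def total_Suc dep.simps power_lev by simp

lemma mass_ge_half_base: "2 * real (mass (piece \<alpha> s)) \<ge> real (base (piece \<alpha> s))"
  using valid_P[OF piece_in[of \<alpha> s]] unfolding valid_def
  by (metis of_nat_le_iff of_nat_mult of_nat_numeral)

text \<open>Within a game the capital may fall, but \<open>gain\<close> does not: on a miss
  \<open>base\<close> scales exactly like the normalisation. A reset costs at most half, as
  \<open>base\<close> is at most twice \<open>mass\<close>. A win multiplies the capital by at least
  4, hence yields at least twice the old \<open>base\<close>.\<close>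

lemma gain_step:
  "stuck s (piece \<alpha> s) \<Longrightarrow> gain \<alpha> (Suc s) \<ge> gain \<alpha> s / 2"
  "\<not> stuck s (piece \<alpha> s) \<Longrightarrow> prefix_of \<alpha> (lev s) \<in> set (W s (piece \<alpha> s)) \<Longrightarrow> gain \<alpha> (Suc s) \<ge> 2 * gain \<alpha> s"
  "\<not> stuck s (piece \<alpha> s) \<Longrightarrow> prefix_of \<alpha> (lev s) \<notin> set (W s (piece \<alpha> s)) \<Longrightarrow> gain \<alpha> (Suc s) = gain \<alpha> s"
proof -
  define b m b' where "b = real (base (piece \<alpha> s))" and "m = real (mass (piece \<alpha> s))"
    and "b' = real (base (piece \<alpha> (Suc s)))"
  have b: "b \<le> 2 * m" using mass_ge_half_base[of \<alpha> s] by (simp add: b_def m_def)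
  have g: "gain \<alpha> s = b * 2 ^ dep s / real (total s)"
    by (simp only: gain_def b_def)
  have g': "gain \<alpha> (Suc s) = b' / real (width s) * 2 ^ dep s / real (total s)"
    by (simp only: gain_Suc b'_def)
  have mono: "x \<le> y \<Longrightarrow> x * 2 ^ dep s / real (total s) \<le> y * 2 ^ dep s / real (total s)" for x y
    by (intro divide_right_mono mult_right_mono) auto
  { assume "stuck s (piece \<alpha> s)"
    then have "b' = m * real (width s)" using piece_step(1) by (simp add: b'_def m_def)
    then have "b / 2 \<le> b' / real (width s)" using b by simp
    from mono[OF this] show "gain \<alpha> (Suc s) \<ge> gain \<alpha> s / 2"
      unfolding g g' by simp }
  { assume "\<not> stuck s (piece \<alpha> s)" "prefix_of \<alpha> (lev s) \<in> set (W s (piece \<alpha> s))"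
    then have "b' = m * real (5 * width s - 4 * length (W s (piece \<alpha> s)))"
      unfolding b'_def m_def of_nat_mult[symmetric] of_nat_eq_iff using piece_step(2)[of s \<alpha>] by metis
    moreover have "4 * width s \<le> 5 * width s - 4 * length (W s (piece \<alpha> s))"
    proof -
      have "4 * length (W s (piece \<alpha> s)) < width s"
        using not_busted_bound[OF \<open>\<not> stuck s (piece \<alpha> s)\<close> valid_P[OF piece_in] pwords_nonempty[OF piece_in]]
        by (simp only: length_pwords[OF piece_in])
      then show ?thesis by linarith
    qed
    then have "4 * real (width s) \<le> real (5 * width s - 4 * length (W s (piece \<alpha> s)))"
      by (metis of_nat_le_iff of_nat_mult of_nat_numeral)
    ultimately have "m * (4 * real (width s)) \<le> b'"
      unfolding m_def by (metis mult_left_mono of_nat_0_le_iff)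
    then have "4 * m \<le> b' / real (width s)" by (simp add: field_simps)
    then have "2 * b \<le> b' / real (width s)" using b by linarith
    from mono[OF this] show "gain \<alpha> (Suc s) \<ge> 2 * gain \<alpha> s"
      unfolding g g' by simp }
  { assume "\<not> stuck s (piece \<alpha> s)" "prefix_of \<alpha> (lev s) \<notin> set (W s (piece \<alpha> s))"
    then have "b' = b * real (width s)" using piece_step(3) by (simp add: b'_def b_def)
    then show "gain \<alpha> (Suc s) = gain \<alpha> s"
      unfolding g g' by simp }
qed

lemma succeeds_if_gain_unbounded:
  assumes "\<And>B. \<exists>s. B < gain \<alpha> s" shows "succeeds strat \<alpha>"
proof (rule succeeds_strat)
  fix B :: nat
  obtain s where "2 * real B < gain \<alpha> s" using assms by blast
  then have "2 * real B * real (total s) < real (base (piece \<alpha> s)) * 2 ^ dep s"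
    using total_pos[of s] by (simp add: gain_def pos_less_divide_eq)
  also have "\<dots> \<le> 2 * real (mass (piece \<alpha> s)) * 2 ^ dep s"
    using mass_ge_half_base by (intro mult_right_mono) auto
  finally have "real (B * total s) < real (mass (piece \<alpha> s) * 2 ^ dep s)" by simp
  then have "B * total s < mass (piece \<alpha> s) * 2 ^ dep s" unfolding of_nat_less_iff .
  then show "\<exists>s. \<exists>p\<in>set (P s). prefix_of \<alpha> (lev s) \<in> set (pwords p) \<and> B * total s < mass p * 2 ^ dep s"
    using piece_in prefix_in_piece by blast
qed

text \<open>A new game receives \<open>lev s\<close>, which exceeds \<open>dep s\<close> and hence
  every earlier class. Along a sequence the class thus identifies the game.\<close>

lemma cls_le: "p \<in> set (P s) \<Longrightarrow> cls p \<le> dep s"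
proof (induction s arbitrary: p)
  case 0
  then show ?case by (simp add: P_0)
next
  case (Suc s)
  then obtain p' where "p' \<in> set (P s)" "p \<in> set (refine d (lev s) (W s p') p')" unfolding in_P_Suc by blast
  then show ?case using Suc.IH[of p'] dep_less_lev[of s] by (auto elim!: refine_cases)
qed

lemma cls_piece_mono:
  assumes "s \<le> t" shows "cls (piece \<alpha> s) \<le> cls (piece \<alpha> t)"
  using assms
proof (induction rule: dec_induct)
  case (step k)
  have "cls (piece \<alpha> k) \<le> cls (piece \<alpha> (Suc k))"
    using piece_step[where \<alpha> = \<alpha> and s = k] cls_le[OF piece_in[of \<alpha> k]] dep_less_lev[of k]
    by (cases "stuck k (piece \<alpha> k)"; cases "prefix_of \<alpha> (lev k) \<in> set (W k (piece \<alpha> k))") auto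
  with step show ?case by simp
qed simp

end

lemma unbounded_if_doubling:
  fixes f :: "nat \<Rightarrow> real"
  assumes mono: "\<And>s. s \<ge> s0 \<Longrightarrow> f s \<le> f (Suc s)" and pos: "0 < f s0"
    and dbl: "\<And>m. \<exists>s\<ge>m. 2 * f s \<le> f (Suc s)"
  shows "\<exists>s. B < f s"
proof -
  have le: "f s \<le> f t" if "s0 \<le> s" "s \<le> t" for s t
    using that(2) by (induction rule: dec_induct) (use that(1) mono order_trans in force)+
  have "\<exists>s\<ge>s0. 2 ^ k * f s0 \<le> f s" for k
  proof (induction k)
    case (Suc k)
    then obtain s where s: "s \<ge> s0" "2 ^ k * f s0 \<le> f s" by blast
    obtain t where t: "t \<ge> s" "2 * f t \<le> f (Suc t)" using dbl by blast
    have "f s \<le> f t" using le s t by simp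
    with s t show ?case by (intro exI[of _ "Suc t"]) auto
  qed auto
  moreover obtain k where "B / f s0 < 2 ^ k" using real_arch_pow[of 2 "B / f s0"] by auto
  then have "B < 2 ^ k * f s0" using pos by (simp add: field_simps)
  ultimately show ?thesis by (meson less_le_trans)
qed

section \<open>The two instances\<close>

interpretation R1: tower P1 True bet1
  by standard (auto simp: state_0 P1_Suc bet1_def)

interpretation R2: tower P2 False "\<lambda>s. bet2 (lost s (P1 s))"
  by standard (auto simp: state_0 P2_Suc bet2_def)

section \<open>The measure on which the first strategy gives up\<close>

lemma distinct_concat_sub:
  assumes "distinct (concat (map f ps))" "\<And>p. p \<in> set ps \<Longrightarrow> set (g p) \<subseteq> set (f p)"
    "\<And>p. p \<in> set ps \<Longrightarrow> distinct (g p)"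
  shows "distinct (concat (map g ps))"
  using assms
proof (induction ps)
  case (Cons p ps)
  have "set (g p) \<inter> set (concat (map g ps)) = {}"
    using Cons.prems(1) Cons.prems(2)[of p] Cons.prems(2) by fastforce
  with Cons show ?case by simp
qed simp

lemma sum_list_of_bool_split:
  fixes h :: "'a \<Rightarrow> real"
  assumes "\<And>p. p \<in> set ps \<Longrightarrow> c p \<le> (n :: nat)"
  shows "(\<Sum>p\<leftarrow>ps. h p) = (\<Sum>q\<le>n. \<Sum>p\<leftarrow>ps. if c p = q then h p else 0)"
  using assms
proof (induction ps)
  case (Cons p ps)
  have "(\<Sum>q\<le>n. if c p = q then h p else 0) = h p"
    using Cons.prems[of p] by simp
  with Cons show ?case by (simp add: sum.distrib)
qed simp

definition bet_part :: "nat \<Rightarrow> nat \<Rightarrow> word list" where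
  "bet_part q s = concat (map (\<lambda>p. if cls p = q then bet1 s p else []) (P1 s))"

text \<open>A potential: the share of capital lost in the games begun at depth \<open>q\<close>,
  weighted by measure.\<close>

definition deficit :: "nat \<Rightarrow> nat \<Rightarrow> real" where
  "deficit q s = (\<Sum>p\<leftarrow>P1 s. if cls p = q then (1 - real (mass p) / real (base p)) / 2 ^ dep s else 0)"

definition stuck_measure :: "nat \<Rightarrow> nat \<Rightarrow> real" where
  "stuck_measure q s = (\<Sum>p\<leftarrow>P1 s. if cls p = q then (if R1.stuck s p then 1 / 2 ^ dep s else 0) else 0)"

lemma real_length_concat_map:
  "real (length (concat (map g ps))) / c = (\<Sum>p\<leftarrow>ps. real (length (g p)) / c)"
  by (induction ps) (simp_all add: add_divide_distrib)

lemma bet_measure_eq: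
  "length (bet_part q s) / 2 ^ lev s = (\<Sum>p\<leftarrow>P1 s. if cls p = q then length (bet1 s p) / 2 ^ lev s else 0)"
  unfolding bet_part_def real_length_concat_map
  by (intro arg_cong[of _ _ sum_list] map_cong) auto

text \<open>A bet on K of N words costs a share of at most \<open>4 * K / N\<close>, so the deficit
  grows by at most 4 times the measure bet on. A piece gets stuck only if its deficit plus the cost
  of the bet is at least half of its measure, and this deficit then leaves the sum. New games start
  with deficit 0, whatever their class.\<close>

lemma refine_deficit:
  assumes p: "p \<in> set (P1 s)"
  shows "(\<Sum>x\<leftarrow>refine True (lev s) (bet1 s p) p.
      if cls x = q then (1 - real (mass x) / real (base x)) / 2 ^ lev s else 0)
    + (if cls p = q then (if R1.stuck s p then 1 / 2 ^ dep s else 0) else 0) / 2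
    \<le> (if cls p = q then (1 - real (mass p) / real (base p)) / 2 ^ dep s else 0)
    + 4 * (if cls p = q then length (bet1 s p) / 2 ^ lev s else 0)"
proof -
  define N K a where "N = real (R1.width s)" and "K = real (length (bet1 s p))"
    and "a = real (mass p) / real (base p)"
  note len = R1.length_pwords[OF p] and val = R1.valid_P[OF p]
  have base: "0 < base p" using val by (simp add: valid_def)
  then have a: "0 < a" "a \<le> 1" using val by (simp_all add: a_def valid_def)
  have N: "N > 0" and lev: "2 ^ lev s = 2 ^ dep s * N" using R1.power_lev by (simp_all add: N_def)
  have K: "0 \<le> K" by (simp add: K_def)
  have KL: "K / 2 ^ lev s = K / N / 2 ^ dep s" by (simp add: lev mult.commute)
  show ?thesis
  proof (cases "R1.stuck s p")
    case True
    have "(\<Sum>x\<leftarrow>refine True (lev s) (bet1 s p) p.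
        if cls x = q then (1 - real (mass x) / real (base x)) / 2 ^ lev s else 0) = 0"
      using True val len by (simp add: refine_def Let_def comp_def valid_def sum_list_triv cong del: if_weak_cong)
    \<comment> \<open>Being busted means \<open>a * (1 - 4 * (K / N)) < 1 / 2\<close>, and
      \<open>a \<le> 1\<close>. The case split isolates the truncated subtraction.\<close>
    moreover have "1 / 2 \<le> 1 - a + 4 * (K / N)"
    proof (cases "4 * length (bet1 s p) \<le> R1.width s")
      case True
      have "real (2 * mass p * (R1.width s - 4 * length (bet1 s p))) < real (base p * R1.width s)"
        using \<open>R1.stuck s p\<close> unfolding busted_def len of_nat_less_iff .
      then have "2 * real (mass p) * (N - 4 * K) < real (base p) * N"
        using True by (simp add: N_def K_def of_nat_diff)
      then have "2 * a * (1 - 4 * (K / N)) < 1"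
        using N base by (simp add: a_def field_simps)
      then have "2 * a - 2 * (a * (4 * (K / N))) < 1"
        by (simp only: right_diff_distrib mult_1_right mult.assoc)
      moreover have "a * (4 * (K / N)) \<le> 1 * (4 * (K / N))" using a K N by (intro mult_right_mono) auto
      ultimately show ?thesis by linarith
    next
      case False
      then have "4 * K > N" unfolding K_def N_def by linarith
      then have "4 * (K / N) > 1" using N by (simp add: field_simps)
      then show ?thesis using a by simp
    qed
    then have "1 / 2 / 2 ^ dep s \<le> (1 - a + 4 * (K / N)) / 2 ^ dep s"
      by (rule divide_right_mono) simp
    then have "1 / 2 ^ dep s / 2 \<le> (1 - a) / 2 ^ dep s + 4 * (K / 2 ^ lev s)"
      unfolding KL by (simp add: add_divide_distrib diff_divide_distrib)
    ultimately show ?thesis using True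
      by (cases "cls p = q") (simp_all only: a_def K_def if_True if_False add_0 div_0 mult_zero_right order_refl simp_thms)
  next
    case False
    have less: "4 * length (bet1 s p) < R1.width s"
      using not_busted_bound[OF False val R1.pwords_nonempty[OF p]] by (simp only: len)
    have "real (4 * length (bet1 s p)) < real (R1.width s)"
      using less unfolding of_nat_less_iff .
    then have "4 * K < N" by (simp add: K_def N_def)
    moreover have "length (bet1 s p) \<le> R1.width s" using less by linarith
    ultimately have KN: "4 * K < N" "real (R1.width s - 4 * length (bet1 s p)) = N - 4 * K"
      "real (R1.width s - length (bet1 s p)) = N - K"
      using less unfolding K_def N_def by (simp_all only: of_nat_diff less_imp_le of_nat_mult of_nat_numeral)
    obtain f where f: "bet1 s p = filter f (pwords p)" using R1.W_filter by blast
    have lenO: "length (filter (\<lambda>w. w \<notin> set (bet1 s p)) (pwords p)) = R1.width s - length (bet1 s p)"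
      using length_filter_not[of f "pwords p", folded f] by (simp add: len)
    have win: "0 < mass p * (5 * R1.width s - 4 * length (bet1 s p))"
      using val less by (simp add: valid_def)
    have "(\<Sum>x\<leftarrow>refine True (lev s) (bet1 s p) p.
        if cls x = q then (1 - real (mass x) / real (base x)) / 2 ^ lev s else 0)
      = (if cls p = q then (N - K) * ((1 - real (mass p * (R1.width s - 4 * length (bet1 s p))) /
          real (base p * R1.width s)) / 2 ^ lev s) else 0)"
      using False win by (simp add: refine_def Let_def comp_def sum_list_triv len lenO KN del: of_nat_mult cong del: if_weak_cong)
    also have "(1 - real (mass p * (R1.width s - 4 * length (bet1 s p))) / real (base p * R1.width s))
        = 1 - a * (1 - 4 * (K / N))"
      using N base unfolding of_nat_mult KN a_def N_def[symmetric] by (simp add: field_simps)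
    also have "(N - K) * ((1 - a * (1 - 4 * (K / N))) / 2 ^ lev s) \<le> (1 - a) / 2 ^ dep s + 4 * (K / 2 ^ lev s)"
    proof -
      have "a * (4 * (K / N)) \<le> 1 * (4 * (K / N))" using a K N by (intro mult_right_mono) auto
      then have "1 - a * (1 - 4 * (K / N)) \<le> 1 - a + 4 * (K / N)" by (simp add: algebra_simps)
      moreover have "0 \<le> 1 - a + 4 * (K / N)" using a K N by simp
      ultimately have "(N - K) * (1 - a * (1 - 4 * (K / N))) \<le> N * (1 - a + 4 * (K / N))"
        using K KN(1) by (intro order_trans[OF mult_left_mono mult_right_mono]) auto
      then have "(N - K) * (1 - a * (1 - 4 * (K / N))) / 2 ^ lev s \<le> N * (1 - a + 4 * (K / N)) / 2 ^ lev s"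
        by (rule divide_right_mono) simp
      also have "\<dots> = (1 - a) / 2 ^ dep s + 4 * (K / 2 ^ lev s)"
        using N unfolding KL unfolding lev by (simp add: add_divide_distrib)
      finally show ?thesis by simp
    qed
    finally have "(\<Sum>x\<leftarrow>refine True (lev s) (bet1 s p) p.
        if cls x = q then (1 - real (mass x) / real (base x)) / 2 ^ lev s else 0)
      \<le> (if cls p = q then (1 - a) / 2 ^ dep s + 4 * (K / 2 ^ lev s) else 0)"
      by simp
    then show ?thesis using False
      by (cases "cls p = q") (simp_all only: a_def K_def if_True if_False add_0_right div_0 mult_zero_right simp_thms)
  qed
qed

lemma sum_list_divide: "(\<Sum>x\<leftarrow>xs. f x / c) = (\<Sum>x\<leftarrow>xs. f x) / (c :: real)"
  by (induction xs) (simp_all add: add_divide_distrib)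

lemma deficit_Suc:
  "deficit q (Suc s) + stuck_measure q s / 2 \<le> deficit q s + 4 * (length (bet_part q s) / 2 ^ lev s)"
proof -
  have "deficit q (Suc s) + stuck_measure q s / 2 =
      (\<Sum>p\<leftarrow>P1 s. (\<Sum>x\<leftarrow>refine True (lev s) (bet1 s p) p.
        if cls x = q then (1 - real (mass x) / real (base x)) / 2 ^ lev s else 0)
      + (if cls p = q then (if R1.stuck s p then 1 / 2 ^ dep s else 0) else 0) / 2)"
    unfolding deficit_def stuck_measure_def P1_Suc sum_list_concat_map
    unfolding map_map comp_def sum_list_addf sum_list_divide dep.simps ..
  also have "\<dots> \<le> (\<Sum>p\<leftarrow>P1 s. (if cls p = q then (1 - real (mass p) / real (base p)) / 2 ^ dep s else 0)
      + 4 * (if cls p = q then length (bet1 s p) / 2 ^ lev s else 0))"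
    by (intro sum_list_mono refine_deficit)
  also have "\<dots> = deficit q s + 4 * (length (bet_part q s) / 2 ^ lev s)"
    unfolding bet_measure_eq deficit_def sum_list_addf sum_list_const_mult ..
  finally show ?thesis .
qed

lemma deficit_bound:
  "deficit q s + (\<Sum>t<s. stuck_measure q t) / 2 \<le> 4 * (\<Sum>t<s. length (bet_part q t) / 2 ^ lev t)"
proof (induction s)
  case 0
  show ?case by (simp add: deficit_def state_0)
next
  case (Suc s)
  then show ?case using deficit_Suc[of q s] by (simp add: add_divide_distrib)
qed

lemma deficit_nonneg: "0 \<le> deficit q s"
  unfolding deficit_def
proof (rule sum_list_nonneg)
  fix x assume "x \<in> set (map (\<lambda>p. if cls p = q then (1 - real (mass p) / real (base p)) / 2 ^ dep s else 0) (P1 s))"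
  then obtain p where "p \<in> set (P1 s)" and x: "x = (if cls p = q then (1 - real (mass p) / real (base p)) / 2 ^ dep s else 0)"
    by auto
  then show "0 \<le> x" using R1.valid_P[of p s] by (simp add: valid_def)
qed

lemma mem_bet_part:
  "prefix_of \<alpha> (lev s) \<in> set (bet_part q s) \<longleftrightarrow>
    cls (R1.piece \<alpha> s) = q \<and> hit (2 * q + 9) s (prefix_of \<alpha> (lev s))"
proof -
  have "prefix_of \<alpha> (lev s) \<in> set (bet_part q s) \<longleftrightarrow>
    (\<exists>p\<in>set (P1 s). cls p = q \<and> prefix_of \<alpha> (lev s) \<in> set (bet1 s p))"
    unfolding bet_part_def by (auto split: if_splits)
  also have "\<dots> \<longleftrightarrow> cls (R1.piece \<alpha> s) = q \<and> hit (2 * q + 9) s (prefix_of \<alpha> (lev s))"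
    using R1.piece_unique[of _ s \<alpha>] R1.piece_in R1.prefix_in_piece by (auto simp: bet1_def)
  finally show ?thesis .
qed

lemma bet_part_level: "set (bet_part q s) \<subseteq> words (lev s)" "distinct (bet_part q s)"
proof -
  show "set (bet_part q s) \<subseteq> words (lev s)"
    using R1.pwords_subset by (fastforce simp: bet_part_def bet1_def split: if_splits)
  show "distinct (bet_part q s)"
    unfolding bet_part_def
  proof (rule distinct_concat_sub[OF partitioned_distinct(1)[OF R1.partitioned_P[of s]]])
    fix p assume "p \<in> set (P1 s)"
    with partitioned_distinct(3)[OF R1.partitioned_P[of s]] have "distinct (pwords p)" by blast
    then show "distinct (if cls p = q then bet1 s p else [])" by (simp add: bet1_def)
  qed (auto simp: bet1_def)
qed

text \<open>A sequence that meets a bet of class \<open>q\<close> at stage \<open>t\<close> wins it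
  or is stuck. Either way its game ends, and all later classes are at least \<open>lev t\<close>,
  which exceeds \<open>q\<close>. So the bets of class \<open>q\<close> at different stages are
  disjoint, and all lie in one component of the universal test.\<close>

lemma bet_measure_bound: "(\<Sum>t<s. length (bet_part q t) / 2 ^ lev t) \<le> (1/2) ^ (2 * q + 9)"
proof -
  define D where "D t = open_of (set (bet_part q t))" for t
  have mem: "\<alpha> \<in> D t \<longleftrightarrow> cls (R1.piece \<alpha> t) = q \<and> hit (2 * q + 9) t (prefix_of \<alpha> (lev t))" for \<alpha> t
    unfolding D_def mem_bet_part[symmetric] using bet_part_level(1) by (intro mem_open_of_level) auto
  have disj: "D t \<inter> D u = {}" if "t < u" for t u
  proof (rule ccontr)
    assume "D t \<inter> D u \<noteq> {}"
    then obtain \<alpha> where \<alpha>: "cls (R1.piece \<alpha> t) = q" "hit (2 * q + 9) t (prefix_of \<alpha> (lev t))" "cls (R1.piece \<alpha> u) = q"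
      using mem by auto
    then have "prefix_of \<alpha> (lev t) \<in> set (bet1 t (R1.piece \<alpha> t))"
      using R1.prefix_in_piece[of \<alpha> t] by (simp add: bet1_def)
    then have "cls (R1.piece \<alpha> (Suc t)) = lev t"
      using R1.piece_step(1,2)[of t \<alpha>] by blast
    then have "lev t \<le> q" using R1.cls_piece_mono[of "Suc t" u \<alpha>] that \<alpha>(3) by simp
    moreover have "q \<le> dep t" using R1.cls_le[OF R1.piece_in[of \<alpha> t]] \<alpha>(1) by simp
    ultimately show False using dep_less_lev[of t] by simp
  qed
  have "(\<Sum>t<s. length (bet_part q t) / 2 ^ lev t) = (\<Sum>t<s. lam (D t))"
    unfolding D_def lam_open_of_level[OF bet_part_level(1)] distinct_card[OF bet_part_level(2)] ..
  also have "\<dots> = lam (\<Union>t<s. D t)"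
  proof (rule cantor.finite_measure_finite_Union[symmetric])
    show "disjoint_family_on D {..<s}"
      unfolding disjoint_family_on_def using disj by (metis inf_commute linorder_neqE_nat)
  qed (auto simp: D_def)
  also have "\<dots> \<le> lam (hit_set (2 * q + 9))"
    using mem mem_hit_set by (intro cantor.finite_measure_mono) auto
  also have "\<dots> \<le> (1/2) ^ (2 * q + 9)" by (rule lam_hit_set)
  finally show ?thesis .
qed

lemma stuck_measure_bound: "(\<Sum>t<s. stuck_measure q t) \<le> 8 * (1/2) ^ (2 * q + 9)"
  using deficit_bound[of q s] deficit_nonneg[of q s] bet_measure_bound[where q = q and s = s] by linarith

text \<open>Bounds 4 times the stuck fraction of any piece of the second strategy. Near independence
  contributes \<open>2 ^ cls p\<close> and two factors 2 for lost capital; the remaining 4 is the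
  stake.\<close>

definition burden :: "nat \<Rightarrow> real" where
  "burden s = (\<Sum>p\<leftarrow>P1 s. if R1.stuck s p then 2 ^ (cls p + 4) / 2 ^ dep s else 0)"

lemma burden_nonneg: "0 \<le> burden s"
  unfolding burden_def by (rule sum_list_nonneg) auto

lemma burden_bound: "(\<Sum>t<s. burden t) \<le> 1 / 2"
proof -
  have eq: "burden t = (\<Sum>q\<le>dep s. 2 ^ (q + 4) * stuck_measure q t)" if "t < s" for t
  proof -
    have "dep t \<le> dep s" using that by (cases s; cases t) (auto intro: lev_mono)
    then have "burden t = (\<Sum>q\<le>dep s. \<Sum>p\<leftarrow>P1 t. if cls p = q then (if R1.stuck t p then 2 ^ (cls p + 4) / 2 ^ dep t else 0) else 0)"
      unfolding burden_def using R1.cls_le by (intro sum_list_of_bool_split) fastforce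
    also have "\<dots> = (\<Sum>q\<le>dep s. 2 ^ (q + 4) * stuck_measure q t)"
      unfolding stuck_measure_def sum_list_const_mult[symmetric]
      by (intro sum.cong arg_cong[of _ _ sum_list] map_cong refl) auto
    finally show ?thesis .
  qed
  have "(\<Sum>t<s. burden t) = (\<Sum>t<s. \<Sum>q\<le>dep s. 2 ^ (q + 4) * stuck_measure q t)"
    using eq by simp
  also have "\<dots> = (\<Sum>q\<le>dep s. 2 ^ (q + 4) * (\<Sum>t<s. stuck_measure q t))"
    by (subst sum.swap) (simp add: sum_distrib_left)
  also have "\<dots> \<le> (\<Sum>q\<le>dep s. 2 ^ (q + 4) * (8 * (1/2) ^ (2 * q + 9)))"
    using stuck_measure_bound by (intro sum_mono mult_left_mono) auto
  \<comment> \<open>The exponents \<open>q + 4\<close>, 3 and \<open>- (2 * q + 9)\<close> add up to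
    \<open>- q - 2\<close>.\<close>
  also have "\<dots> = (\<Sum>q\<le>dep s. (1/2) ^ q / 4)"
  proof (intro sum.cong refl)
    fix q :: nat
    have "(2::real) ^ q * (1/2) ^ (2 * q) = (1/2) ^ q"
      by (simp add: mult_2 power_add power_one_over)
    then show "2 ^ (q + 4) * (8 * (1/2) ^ (2 * q + 9)) = (1/2) ^ q / (4::real)"
      by (simp add: power_add field_simps)
  qed
  also have "\<dots> = (\<Sum>q\<le>dep s. (1/2) ^ q) / 4" by (simp add: sum_divide_distrib)
  also have "\<dots> \<le> 1 / 2"
  proof -
    have "(\<Sum>q\<le>n. (1/2::real) ^ q) = 2 - (1/2) ^ n" for n by (induction n) auto
    then show ?thesis by simp
  qed
  finally show ?thesis .
qed

section \<open>Near independence of the two trees\<close>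

text \<open>Members of one residue class differ in their quotients by \<open>M\<close>; the bound is
  \<open>T / M\<close> rounded up.\<close>

lemma card_residue_class:
  fixes M T i k :: nat
  assumes "0 < M"
  shows "card {u. u < T \<and> (i + u) mod M = k} \<le> (T + M - 1) div M"
proof -
  have "inj_on (\<lambda>u. u div M) {u. u < T \<and> (i + u) mod M = k}"
  proof (rule inj_onI)
    fix u v assume uv: "u \<in> {u. u < T \<and> (i + u) mod M = k}" "v \<in> {u. u < T \<and> (i + u) mod M = k}" "u div M = v div M"
    have "u mod M = v mod M"
      using uv(1,2)
    proof (induction u v rule: linorder_wlog)
      case (le u v)
      then have "M dvd (i + v) - (i + u)"
        by (subst mod_eq_dvd_iff_nat[symmetric]) auto
      then have "M dvd v - u" by simp
      then show ?case using le(1) mod_eq_dvd_iff_nat[of u v M] by simp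
    qed simp
    then show "u = v" using uv(3) by (metis div_mult_mod_eq)
  qed
  moreover have "(\<lambda>u. u div M) ` {u. u < T \<and> (i + u) mod M = k} \<subseteq> {..<(T + M - 1) div M}"
  proof
    fix y assume "y \<in> (\<lambda>u. u div M) ` {u. u < T \<and> (i + u) mod M = k}"
    then obtain u where u: "u < T" "y = u div M" by auto
    have "u div M \<le> (T - 1) div M" using u by (intro div_le_mono) simp
    moreover have "T + M - 1 = (T - 1) + M" using u by simp
    moreover have "((T - 1) + M) div M = (T - 1) div M + 1" using assms by simp
    ultimately show "y \<in> {..<(T + M - 1) div M}" using u(2) by (simp only: lessThan_iff)
  qed
  ultimately have "card {u. u < T \<and> (i + u) mod M = k} \<le> card {..<(T + M - 1) div M}"
    by (intro card_inj_on_le) auto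
  then show ?thesis by simp
qed

text \<open>Removing \<open>K\<close> of \<open>N\<close> words concentrates the rest by the factor \<open>N / (N - K)\<close>, up to a rounding
  error. The stakes lower the capital by the factor \<open>(N - 4K) / N\<close>, which compensates for both.\<close>

lemma residue_class_bound:
  fixes N K M T i k :: nat
  assumes N: "N = 2 ^ a" and T: "T = 2 ^ b" and "N * N \<le> T" and M: "M + K = N" "0 < M"
  shows "card {u. u < T \<and> (i + u) mod M = k} * (N - 4 * K) \<le> T"
proof -
  define c where "c = (T + M - 1) div M"
  have cM: "c * M \<le> T + M - 1" by (simp add: c_def)
  have "c * (N - 4 * K) \<le> T"
  \<comment> \<open>For \<open>K = 0\<close> there is no slack for rounding, but \<open>N\<close>
    and \<open>T\<close> are powers of two and the division is exact.\<close>
  proof (cases "K = 0")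
    case True
    have "N \<le> T" using \<open>N * N \<le> T\<close> by (metis le_square le_trans)
    then have "a \<le> b" using N T by simp
    then obtain e where e: "b = a + e" using le_Suc_ex by blast
    have MN: "M = N" using M True by simp
    have "c = (N - 1 + 2 ^ e * N) div N"
      unfolding c_def MN T e using M(2) MN by (simp add: N power_add algebra_simps)
    also have "\<dots> = 2 ^ e + (N - 1) div N" using M by (subst div_mult_self1) auto
    also have "(N - 1) div N = 0" using M by simp
    finally show ?thesis using True by (simp add: T N e power_add)
  next
    case False
    show ?thesis
    proof (cases "4 * K \<le> N")
      case True
      \<comment> \<open>For positive \<open>K\<close> the slack \<open>c * (3 * K)\<close> is at
        least \<open>c\<close>. It absorbs the rounding error \<open>M - 1\<close> as soon as
        \<open>M \<le> c\<close>, which follows from \<open>N * N \<le> T\<close>.\<close>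
      have "M \<le> c"
      proof -
        have "M * M \<le> T" using mult_le_mono[of M N M N] M(1) \<open>N * N \<le> T\<close> by linarith
        then have "M * M div M \<le> T div M" by (rule div_le_mono)
        also have "T div M \<le> c" unfolding c_def using M(2) by (intro div_le_mono) simp
        finally show ?thesis using M(2) by simp
      qed
      obtain j where j: "N = 4 * K + j" using True le_Suc_ex by blast
      then have Mj: "M = 3 * K + j" using M(1) by simp
      have "c \<le> c * (3 * K)" using False by simp
      moreover have "c * M = c * (3 * K) + c * j" by (simp add: Mj distrib_left)
      ultimately have "c * j + c \<le> T + M - 1" using cM by linarith
      then show ?thesis using \<open>M \<le> c\<close> j by simp
    qed simp
  qed
  moreover have "card {u. u < T \<and> (i + u) mod M = k} * (N - 4 * K) \<le> c * (N - 4 * K)"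
    unfolding c_def by (intro mult_right_mono card_residue_class M) simp
  ultimately show ?thesis by linarith
qed

text \<open>The first half of the fresh bits determines the index for \<open>ws\<close>, the second
  half the one for \<open>vs\<close>. The two choices are independent, so the counts
  multiply.\<close>

lemma card_mix_le:
  assumes "ws \<noteq> []" "vs \<noteq> []" "set ws \<subseteq> words L" "set vs \<subseteq> words L"
  shows "card (set (mix True t ws i) \<inter> set (mix False t vs j)) \<le>
    (\<Sum>w\<in>set ws \<inter> set vs. card {u. u < 2 ^ t \<and> ws ! ((i + u) mod length ws) = w} *
                          card {u. u < 2 ^ t \<and> vs ! ((j + u) mod length vs) = w})"
proof -
  define A where "A w = {u. u < 2 ^ t \<and> ws ! ((i + u) mod length ws) = w}" for w
  define B where "B w = {u. u < 2 ^ t \<and> vs ! ((j + u) mod length vs) = w}" for w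
  define F where "F w = (\<lambda>(u, r). w @ bitstrings t ! u @ bitstrings t ! r) ` (A w \<times> B w)" for w
  have fin: "finite (A w)" "finite (B w)" for w by (simp_all add: A_def B_def)
  have "set (mix True t ws i) \<inter> set (mix False t vs j) \<subseteq> (\<Union>w\<in>set ws \<inter> set vs. F w)"
  proof
    fix y assume y: "y \<in> set (mix True t ws i) \<inter> set (mix False t vs j)"
    then obtain u z where u: "u < 2 ^ t" "z \<in> set (block True t u)" "y = ws ! ((i + u) mod length ws) @ z"
      unfolding set_mix[OF assms(1)] by blast
    from y obtain r z' where r: "r < 2 ^ t" "z' \<in> set (block False t r)" "y = vs ! ((j + r) mod length vs) @ z'"
      unfolding set_mix[OF assms(2)] by blast
    define w where "w = ws ! ((i + u) mod length ws)"
    have w: "w \<in> set ws" using assms(1) by (simp add: w_def)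
    have w': "vs ! ((j + r) mod length vs) \<in> set vs" using assms(2) by simp
    have "length w = length (vs ! ((j + r) mod length vs))" using subsetD[OF assms(3) w] subsetD[OF assms(4) w'] by simp
    then have eq: "vs ! ((j + r) mod length vs) = w" "z' = z" using u(3) r(3) by (simp_all add: w_def)
    have "take t z = bitstrings t ! u" "drop t z = bitstrings t ! r"
      using u(2) r(2) eq(2) unfolding mem_block[OF u(1)] mem_block[OF r(1)] half_def by simp_all
    then have "y = w @ bitstrings t ! u @ bitstrings t ! r"
      using u(3) append_take_drop_id[of t z] by (simp only: w_def)
    then have "y \<in> F w"
      unfolding F_def A_def B_def using u(1) r(1) eq(1) w_def by auto
    then show "y \<in> (\<Union>w\<in>set ws \<inter> set vs. F w)" using w w' eq(1) by blast
  qed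
  then have "card (set (mix True t ws i) \<inter> set (mix False t vs j)) \<le> card (\<Union>w\<in>set ws \<inter> set vs. F w)"
    using fin by (intro card_mono) (auto simp: F_def)
  also have "\<dots> \<le> (\<Sum>w\<in>set ws \<inter> set vs. card (F w))" by (rule card_UN_le) simp
  also have "\<dots> \<le> (\<Sum>w\<in>set ws \<inter> set vs. card (A w) * card (B w))"
  proof (rule sum_mono)
    fix w
    have "card (F w) \<le> card (A w \<times> B w)" unfolding F_def using fin by (intro card_image_le) simp
    then show "card (F w) \<le> card (A w) * card (B w)" by (simp add: card_cartesian_product)
  qed
  finally show ?thesis by (simp add: A_def B_def)
qed

lemma card_nth_residue:
  assumes "distinct ws" "w \<in> set ws" "N = 2 ^ a" "T = 2 ^ b" "N * N \<le> T" "length ws + K = N"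
  shows "card {u. u < T \<and> ws ! ((i + u) mod length ws) = w} * (N - 4 * K) \<le> T"
proof -
  from assms(2) obtain k where k: "k < length ws" "w = ws ! k" by (auto simp: in_set_conv_nth)
  have "{u. u < T \<and> ws ! ((i + u) mod length ws) = w} = {u. u < T \<and> (i + u) mod length ws = k}"
  proof -
    have "(i + u) mod length ws < length ws" for u using k(1) by (intro mod_less_divisor) linarith
    then show ?thesis unfolding k(2) using nth_eq_iff_index_eq[OF assms(1) _ k(1)] by simp
  qed
  moreover have "0 < length ws" using k(1) by linarith
  ultimately show ?thesis using residue_class_bound[OF assms(3-6)] by simp
qed

lemma card_spread_Int:
  assumes x: "x \<in> set (spread True t ws)" and y: "y \<in> set (spread False t vs)"
    and ws: "distinct ws" "set ws \<subseteq> words L" "length ws + K = N"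
    and vs: "distinct vs" "set vs \<subseteq> words L" "length vs + K' = N"
    and N: "N = 2 ^ a" "N * N \<le> 2 ^ t"
  shows "card (set x \<inter> set y) * ((N - 4 * K) * (N - 4 * K')) \<le> card (set ws \<inter> set vs) * (2 ^ t * 2 ^ t)"
proof -
  obtain i where "x = mix True t ws i" using x by (auto simp: spread_def)
  moreover have "ws \<noteq> []" using x by (auto simp: spread_def)
  ultimately have i: "x = mix True t ws i" "ws \<noteq> []" .
  obtain j where "y = mix False t vs j" using y by (auto simp: spread_def)
  moreover have "vs \<noteq> []" using y by (auto simp: spread_def)
  ultimately have j: "y = mix False t vs j" "vs \<noteq> []" .
  let ?A = "\<lambda>w. card {u. u < 2 ^ t \<and> ws ! ((i + u) mod length ws) = w}"
  let ?B = "\<lambda>w. card {u. u < 2 ^ t \<and> vs ! ((j + u) mod length vs) = w}"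
  have "card (set x \<inter> set y) * ((N - 4 * K) * (N - 4 * K'))
      \<le> (\<Sum>w\<in>set ws \<inter> set vs. ?A w * ?B w) * ((N - 4 * K) * (N - 4 * K'))"
    unfolding i(1) j(1) using card_mix_le[OF i(2) j(2) ws(2) vs(2)] by (rule mult_right_mono) simp
  also have "\<dots> = (\<Sum>w\<in>set ws \<inter> set vs. (?A w * (N - 4 * K)) * (?B w * (N - 4 * K')))"
    unfolding sum_distrib_right by (intro sum.cong refl) (simp only: mult_ac)
  also have "\<dots> \<le> (\<Sum>w\<in>set ws \<inter> set vs. 2 ^ t * 2 ^ t)"
    using card_nth_residue[OF ws(1) _ N(1) refl N(2) ws(3)] card_nth_residue[OF vs(1) _ N(1) refl N(2) vs(3)]
    by (intro sum_mono mult_le_mono) auto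
  finally show ?thesis by simp
qed

text \<open>The pieces of the two strategies stay nearly independent: the factor by which the intersection
  exceeds the product of the measures is bounded in terms of the capitals and of the stage at which
  the current game of the first strategy began.\<close>

definition nearly_independent :: "nat \<Rightarrow> bool" where
  "nearly_independent s \<longleftrightarrow> (\<forall>p\<in>set (P1 s). \<forall>r\<in>set (P2 s).
    card (set (pwords p) \<inter> set (pwords r)) * (mass p * mass r) * 4 ^ dep s \<le> 2 ^ (cls p + lev s) * (base p * base r))"

text \<open>By \<open>burden_bound\<close> this leaves every piece of the second strategy at least
  half of its \<open>base\<close>.\<close>

definition light :: "nat \<Rightarrow> bool" where
  "light s \<longleftrightarrow> (\<forall>r\<in>set (P2 s). 1 - (\<Sum>t<s. burden t) \<le> real (mass r) / real (base r))"

lemma in_bet2: "w \<in> set (bet2 (lost s (P1 s)) r) \<longleftrightarrow>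
    w \<in> set (pwords r) \<and> (\<exists>p\<in>set (P1 s). R1.stuck s p \<and> w \<in> set (pwords p))"
  by (auto simp: bet2_def lost_def split: if_splits)

lemma length_bet2_le:
  assumes "r \<in> set (P2 s)"
  shows "real (length (bet2 (lost s (P1 s)) r)) \<le>
    (\<Sum>p\<leftarrow>P1 s. if R1.stuck s p then real (card (set (pwords p) \<inter> set (pwords r))) else 0)"
proof -
  let ?E = "{p \<in> set (P1 s). R1.stuck s p}"
  have "distinct (bet2 (lost s (P1 s)) r)"
    using partitioned_distinct(3)[OF R2.partitioned_P assms] by (simp add: bet2_def)
  then have "length (bet2 (lost s (P1 s)) r) = card (set (bet2 (lost s (P1 s)) r))"
    by (simp add: distinct_card)
  also have "set (bet2 (lost s (P1 s)) r) = (\<Union>p\<in>?E. set (pwords p) \<inter> set (pwords r))"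
    using in_bet2[of _ s r] by auto
  also have "card \<dots> \<le> (\<Sum>p\<in>?E. card (set (pwords p) \<inter> set (pwords r)))"
    by (rule card_UN_le) simp
  finally have "real (length (bet2 (lost s (P1 s)) r)) \<le> (\<Sum>p\<in>?E. real (card (set (pwords p) \<inter> set (pwords r))))"
    unfolding of_nat_sum[symmetric] of_nat_le_iff .
  also have "\<dots> = (\<Sum>p\<in>set (P1 s). if R1.stuck s p then real (card (set (pwords p) \<inter> set (pwords r))) else 0)"
    by (simp add: sum.inter_filter)
  also have "\<dots> = (\<Sum>p\<leftarrow>P1 s. if R1.stuck s p then real (card (set (pwords p) \<inter> set (pwords r))) else 0)"
    using partitioned_distinct(2)[OF R1.partitioned_P] by (rule sum_list_distinct_conv_sum_set[symmetric])
  finally show ?thesis .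
qed

text \<open>Near independence is summed over the stuck pieces; each of the two ratios of
  \<open>base\<close> to \<open>mass\<close> is at most 2.\<close>

lemma bet2_burden:
  assumes ind: "nearly_independent s" and r: "r \<in> set (P2 s)"
  shows "4 * real (length (bet2 (lost s (P1 s)) r)) / real (R2.width s) \<le> burden s"
proof -
  have each: "real (card (set (pwords p) \<inter> set (pwords r))) \<le> 2 ^ (cls p + 2) / 2 ^ dep s * real (R2.width s)"
    if p: "p \<in> set (P1 s)" for p
  proof -
    let ?c = "card (set (pwords p) \<inter> set (pwords r))"
    have vp: "base p \<le> 2 * mass p" "0 < mass p" and vr: "base r \<le> 2 * mass r" "0 < mass r"
      using R1.valid_P[OF p] R2.valid_P[OF r] by (simp_all add: valid_def)
    have "?c * (mass p * mass r) * 4 ^ dep s \<le> 2 ^ (cls p + lev s) * (base p * base r)"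
      using ind p r by (simp add: nearly_independent_def)
    also have "\<dots> \<le> 2 ^ (cls p + lev s) * ((2 * mass p) * (2 * mass r))"
      using vp vr by (intro mult_le_mono) auto
    finally have "(?c * 4 ^ dep s) * (mass p * mass r) \<le> (2 ^ (cls p + lev s) * 4) * (mass p * mass r)"
      by (simp add: mult_ac)
    then have "?c * 4 ^ dep s \<le> 2 ^ (cls p + lev s) * 4"
      using vp vr by (simp only: mult_le_cancel2) simp
    then have "real (?c * 4 ^ dep s) \<le> real (2 ^ (cls p + lev s) * 4)" unfolding of_nat_le_iff .
    then have "real ?c * (2 ^ dep s * 2 ^ dep s) \<le> 2 ^ (cls p + 2) * (2 ^ dep s * real (R2.width s))"
      unfolding R2.power_lev[symmetric] by (simp add: power_add flip: power_mult_distrib)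
    then have "real ?c * 2 ^ dep s \<le> 2 ^ (cls p + 2) * real (R2.width s)"
      by (simp add: mult.left_commute flip: mult.assoc)
    then show ?thesis by (simp add: field_simps)
  qed
  have "real (length (bet2 (lost s (P1 s)) r)) \<le>
    (\<Sum>p\<leftarrow>P1 s. if R1.stuck s p then real (card (set (pwords p) \<inter> set (pwords r))) else 0)"
    by (rule length_bet2_le[OF r])
  also have "\<dots> \<le> (\<Sum>p\<leftarrow>P1 s. (if R1.stuck s p then 2 ^ (cls p + 4) / 2 ^ dep s else 0) * (real (R2.width s) / 4))"
  proof (rule sum_list_mono)
    fix p assume p: "p \<in> set (P1 s)"
    have eq: "2 ^ (cls p + 4) / 2 ^ dep s * (real (R2.width s) / 4) = 2 ^ (cls p + 2) / 2 ^ dep s * real (R2.width s)"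
      by (simp add: power_add)
    show "(if R1.stuck s p then real (card (set (pwords p) \<inter> set (pwords r))) else 0)
        \<le> (if R1.stuck s p then 2 ^ (cls p + 4) / 2 ^ dep s else 0) * (real (R2.width s) / 4)"
      using each[OF p] by (cases "R1.stuck s p") (simp_all only: if_True if_False eq mult_zero_left order_refl)
  qed
  also have "\<dots> = burden s * (real (R2.width s) / 4)"
    unfolding burden_def sum_list_mult_const ..
  finally show ?thesis by (simp add: field_simps)
qed

text \<open>The bet lowers the ratio of \<open>mass\<close> to \<open>base\<close>, which is at most
  1, by at most the burden of the stage. The burdens of all stages sum to at most 1/2, so the ratio
  never falls below the threshold of \<open>busted\<close>.\<close>

lemma R2_stake:
  assumes ind: "nearly_independent s" and light: "light s" and r: "r \<in> set (P2 s)"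
  shows "\<not> R2.stuck s r"
    "1 - (\<Sum>t<Suc s. burden t) \<le>
      real (mass r * (R2.width s - 4 * length (bet2 (lost s (P1 s)) r))) / real (base r * R2.width s)"
proof -
  define N K b where "N = real (R2.width s)" and "K = real (length (bet2 (lost s (P1 s)) r))"
    and "b = real (mass r) / real (base r)"
  have base: "0 < base r" "mass r \<le> base r" using R2.valid_P[OF r] by (simp_all add: valid_def)
  have N: "N > 0" by (simp add: N_def)
  have K: "0 \<le> K" by (simp add: K_def)
  have KN: "4 * K / N \<le> burden s" using bet2_burden[OF ind r] by (simp add: K_def N_def)
  have half: "(\<Sum>t<Suc s. burden t) \<le> 1 / 2" by (rule burden_bound)
  have b: "1 - (\<Sum>t<s. burden t) \<le> b" "b \<le> 1" using light r base by (simp_all add: light_def b_def)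
  have "(\<Sum>t<s. burden t) \<ge> 0" by (intro sum_nonneg burden_nonneg)
  then have "4 * K / N \<le> 1 / 2" using KN half by simp
  then have "4 * K \<le> N" using N by (simp add: field_simps)
  then have "4 * length (bet2 (lost s (P1 s)) r) \<le> R2.width s"
    unfolding K_def N_def by (metis of_nat_le_iff of_nat_mult of_nat_numeral)
  then have diff: "real (R2.width s - 4 * length (bet2 (lost s (P1 s)) r)) = N - 4 * K"
    unfolding K_def N_def by (simp only: of_nat_diff of_nat_mult of_nat_numeral)
  have eq: "real (mass r * (R2.width s - 4 * length (bet2 (lost s (P1 s)) r))) / real (base r * R2.width s)
      = b * (1 - 4 * K / N)"
    using N base unfolding of_nat_mult diff b_def N_def[symmetric] by (simp add: field_simps)
  have "b * (4 * K / N) \<le> 1 * (4 * K / N)" using b K N by (intro mult_right_mono) auto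
  then have ge: "1 - (\<Sum>t<Suc s. burden t) \<le> b * (1 - 4 * K / N)"
    using b KN by (simp add: right_diff_distrib)
  then show "1 - (\<Sum>t<Suc s. burden t) \<le>
      real (mass r * (R2.width s - 4 * length (bet2 (lost s (P1 s)) r))) / real (base r * R2.width s)"
    unfolding eq .
  have "1 / 2 \<le> b * (1 - 4 * K / N)" using ge half by linarith
  moreover have "0 < real (base r * R2.width s)" using base by simp
  moreover have "y \<le> 2 * x" if "1 / 2 \<le> x / y" "0 < y" for x y :: real
    using that by (simp add: field_simps)
  ultimately have "real (base r * R2.width s) \<le> 2 * real (mass r * (R2.width s - 4 * length (bet2 (lost s (P1 s)) r)))"
    unfolding eq[symmetric] by blast
  then have "real (base r * R2.width s) \<le> real (2 * mass r * (R2.width s - 4 * length (bet2 (lost s (P1 s)) r)))"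
    by (simp only: of_nat_mult of_nat_numeral mult.assoc)
  then show "\<not> R2.stuck s r"
    unfolding busted_def R2.length_pwords[OF r] of_nat_le_iff not_less .
qed

lemma light_Suc:
  assumes ind: "nearly_independent s" and light: "light s"
  shows "light (Suc s)"
  unfolding light_def
proof
  fix x assume "x \<in> set (P2 (Suc s))"
  then obtain r where r: "r \<in> set (P2 s)" "x \<in> set (refine False (lev s) (bet2 (lost s (P1 s)) r) r)"
    unfolding R2.in_P_Suc by blast
  have vx: "0 < mass x" using R2.valid_P[OF \<open>x \<in> set (P2 (Suc s))\<close>] by (simp add: valid_def)
  note ns = R2_stake[OF ind light r(1)]
  have pos: "0 \<le> (\<Sum>t<Suc s. burden t)" by (intro sum_nonneg burden_nonneg)
  from r(2) show "1 - (\<Sum>t<Suc s. burden t) \<le> real (mass x) / real (base x)"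
  proof (cases rule: refine_cases)
    case out
    then show ?thesis using ns(2) by (simp add: R2.length_pwords[OF r(1)])
  qed (use ns vx pos in auto)
qed


text \<open>If the first strategy begins a new game, the size of its piece suffices as a bound, paid
  for by the new class. If it misses while the second wins, the pieces are disjoint. If both miss,
  the lost capital pays for the concentration on the remaining words.\<close>

lemma nearly_independent_Suc:
  assumes ind: "nearly_independent s" and light: "light s"
  shows "nearly_independent (Suc s)"
  unfolding nearly_independent_def
proof (intro ballI)
  fix x y assume x: "x \<in> set (P1 (Suc s))" and y: "y \<in> set (P2 (Suc s))"
  let ?W = "\<lambda>r. bet2 (lost s (P1 s)) r"
  from x obtain p where p: "p \<in> set (P1 s)" "x \<in> set (refine True (lev s) (bet1 s p) p)"
    unfolding R1.in_P_Suc by blast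
  from y obtain r where r: "r \<in> set (P2 s)" "y \<in> set (refine False (lev s) (?W r) r)"
    unfolding R2.in_P_Suc by blast
  have nstuck: "\<not> R2.stuck s r" by (rule R2_stake(1)[OF ind light r(1)])
  have vx: "mass x \<le> base x" and vy: "mass y \<le> base y"
    using R1.valid_P[OF x] R2.valid_P[OF y] by (simp_all add: valid_def)
  let ?goal = "card (set (pwords x) \<inter> set (pwords y)) * (mass x * mass y) * 4 ^ dep (Suc s)
      \<le> 2 ^ (cls x + lev (Suc s)) * (base x * base y)"
  have new: ?goal if "cls x = lev s"
    unfolding dep.simps lev_Suc that
  proof -
    have "card (set (pwords x) \<inter> set (pwords y)) \<le> length (pwords x)"
      by (meson card_length card_mono finite_set inf_le1 le_trans)
    also have "\<dots> = 2 ^ (4 * lev s)" by (rule length_pwords_refine[OF p(2)])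
    finally have "card (set (pwords x) \<inter> set (pwords y)) * (mass x * mass y) * 4 ^ lev s
        \<le> 2 ^ (4 * lev s) * (base x * base y) * 4 ^ lev s"
      using vx vy by (intro mult_le_mono) auto
    also have "\<dots> = 2 ^ (4 * lev s + 2 * lev s) * (base x * base y)"
    proof -
      have "(4::nat) ^ lev s = 2 ^ (2 * lev s)" by (simp add: power_mult)
      then show ?thesis by (simp only: power_add mult_ac)
    qed
    finally show "card (set (pwords x) \<inter> set (pwords y)) * (mass x * mass y) * 4 ^ lev s
        \<le> 2 ^ (lev s + 5 * lev s) * (base x * base y)" by simp
  qed
  from p(2) show ?goal
  proof (cases rule: refine_cases)
    case out1: out
    from r(2) show ?goal
    proof (cases rule: refine_cases)
      case busted
      then show ?thesis using nstuck by simp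
    next
      case win
      \<comment> \<open>The second strategy wins only on words of stuck pieces, whereas
        \<open>p\<close> is not stuck.\<close>
      have "set (pwords x) \<inter> set (pwords y) = {}"
      proof (rule ccontr)
        assume "set (pwords x) \<inter> set (pwords y) \<noteq> {}"
        then obtain z where z: "z \<in> set (pwords x)" "z \<in> set (pwords y)" by blast
        have "set (?W r) \<subseteq> words (lev s)"
          using R2.W_subset R2.pwords_subset[OF r(1)] by blast
        from take_spread[OF win(2) z(2) this] obtain p' where
          p': "p' \<in> set (P1 s)" "R1.stuck s p'" "take (lev s) z \<in> set (pwords p')"
          unfolding in_bet2 by blast
        have "take (lev s) z \<in> set (pwords p)" by (rule R1.refine_words(1)[OF p z(1)])
        then have "p' = p" using partitioned_distinct(4)[OF R1.partitioned_P p'(1) p(1) p'(3)] by blast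
        then show False using p'(2) out1(1) by simp
      qed
      then show ?thesis by simp
    next
      case out2: out
      define N where "N = R1.width s"
      define ws where "ws = filter (\<lambda>w. w \<notin> set (bet1 s p)) (pwords p)"
      define vs where "vs = filter (\<lambda>w. w \<notin> set (?W r)) (pwords r)"
      define u where "u = (N - 4 * length (bet1 s p)) * (N - 4 * length (?W r))"
      define c C where "c = card (set (pwords x) \<inter> set (pwords y))"
        and "C = card (set (pwords p) \<inter> set (pwords r))"
      have len: "length (pwords p) = N" "length (pwords r) = N"
        using R1.length_pwords[OF p(1)] R2.length_pwords[OF r(1)] by (simp_all add: N_def)
      have lws: "length ws + length (bet1 s p) = N"
        using length_filter_not[of "hit (2 * cls p + 9) s" "pwords p"] R1.length_W[of s p]
        by (simp add: ws_def bet1_def len)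
      have lvs: "length vs + length (?W r) = N"
        using length_filter_not[of "\<lambda>w. w \<in> set (lost s (P1 s))" "pwords r"] R2.length_W[of s r]
        by (simp add: vs_def bet2_def len)
      \<comment> \<open>The reason for giving each half \<open>2 * lev s\<close> fresh bits: there
        are enough indices to keep rounding errors harmless.\<close>
      have "N * N \<le> 2 ^ (2 * lev s)"
        by (simp add: N_def flip: power_add)
      moreover have "distinct ws" "distinct vs"
        using partitioned_distinct(3)[OF R1.partitioned_P p(1)] partitioned_distinct(3)[OF R2.partitioned_P r(1)]
        by (simp_all add: ws_def vs_def)
      moreover have "set ws \<subseteq> words (lev s)" "set vs \<subseteq> words (lev s)"
        using R1.pwords_subset[OF p(1)] R2.pwords_subset[OF r(1)] by (auto simp: ws_def vs_def)
      ultimately have "c * u \<le> card (set ws \<inter> set vs) * (2 ^ (2 * lev s) * 2 ^ (2 * lev s))"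
        unfolding c_def u_def using card_spread_Int[OF out1(2)[folded ws_def] out2(2)[folded vs_def]] lws lvs N_def
        by blast
      also have "\<dots> \<le> C * (2 ^ (2 * lev s) * 2 ^ (2 * lev s))"
        unfolding C_def ws_def vs_def by (intro mult_right_mono card_mono) auto
      finally have cu: "c * u \<le> C * 2 ^ (4 * lev s)" by (simp flip: power_add)
      have C: "C * (mass p * mass r) * 4 ^ dep s \<le> 2 ^ (cls p + lev s) * (base p * base r)"
        using ind p(1) r(1) by (simp add: nearly_independent_def C_def)
      have four: "(4::nat) ^ lev s = 4 ^ dep s * (N * N)"
      proof -
        have "(2::nat) ^ lev s = 2 ^ dep s * N"
          using dep_less_lev[of s] by (simp add: N_def flip: power_add)
        moreover have "(4::nat) ^ k = 2 ^ k * 2 ^ k" for k by (simp flip: power_mult_distrib)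
        ultimately show ?thesis by (simp add: mult_ac)
      qed
      have mx: "mass x * mass y = mass p * mass r * u" "base x * base y = base p * base r * (N * N)"
        using out1 out2 by (simp_all add: len u_def mult_ac)
      have "c * (mass x * mass y) * 4 ^ lev s = (c * u) * ((mass p * mass r) * 4 ^ dep s * (N * N))"
        unfolding mx four by (simp only: mult_ac)
      also have "\<dots> \<le> (C * 2 ^ (4 * lev s)) * ((mass p * mass r) * 4 ^ dep s * (N * N))"
        by (rule mult_right_mono[OF cu]) simp
      also have "\<dots> = (C * (mass p * mass r) * 4 ^ dep s) * (2 ^ (4 * lev s) * (N * N))"
        by (simp only: mult_ac)
      also have "\<dots> \<le> (2 ^ (cls p + lev s) * (base p * base r)) * (2 ^ (4 * lev s) * (N * N))"
        by (rule mult_right_mono[OF C]) simp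
      also have "\<dots> = (2 ^ (cls p + lev s) * 2 ^ (4 * lev s)) * (base x * base y)"
        unfolding mx by (simp only: mult_ac)
      also have "(2::nat) ^ (cls p + lev s) * 2 ^ (4 * lev s) = 2 ^ (cls x + lev (Suc s))"
        by (simp add: out1 lev_Suc flip: power_add)
      finally show ?thesis by (simp add: c_def)
    qed
  qed (use new in blast)+
qed

lemma invariants: "nearly_independent s \<and> light s"
proof (induction s)
  case 0
  have "card (set [[False], [True]]) = 2" by simp
  then show ?case by (simp add: nearly_independent_def light_def state_0 lev_def)
next
  case (Suc s)
  then show ?case using nearly_independent_Suc light_Suc by blast
qed

lemma R2_never_stuck: "\<not> R2.stuck s (R2.piece \<alpha> s)"
  using R2_stake(1) invariants R2.piece_in by blast

section \<open>The dichotomy between stuck and winning sequences\<close>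

lemma some_strategy_succeeds:
  assumes "\<not> martin_loef_random \<alpha>"
  shows "succeeds R1.strat \<alpha> \<or> succeeds R2.strat \<alpha>"
proof (cases "\<forall>m. \<exists>s\<ge>m. R1.stuck s (R1.piece \<alpha> s)")
  case True
  have mono: "R2.gain \<alpha> s \<le> R2.gain \<alpha> (Suc s)" for s
    using R2.gain_step(2,3)[OF R2_never_stuck[of s \<alpha>]] R2.gain_pos[of \<alpha> s]
    by (cases "prefix_of \<alpha> (lev s) \<in> set (bet2 (lost s (P1 s)) (R2.piece \<alpha> s))") auto
  have dbl: "2 * R2.gain \<alpha> s \<le> R2.gain \<alpha> (Suc s)" if "R1.stuck s (R1.piece \<alpha> s)" for s
  proof -
    have "prefix_of \<alpha> (lev s) \<in> set (bet2 (lost s (P1 s)) (R2.piece \<alpha> s))"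
      unfolding in_bet2 using that R1.piece_in R1.prefix_in_piece R2.prefix_in_piece by blast
    then show ?thesis using R2.gain_step(2)[OF R2_never_stuck] by blast
  qed
  have "\<exists>s. B < R2.gain \<alpha> s" for B
    by (rule unbounded_if_doubling[of 0]) (use mono dbl True R2.gain_pos in blast)+
  then show ?thesis using R2.succeeds_if_gain_unbounded by blast
next
  case False
  then obtain m where m: "\<And>s. s \<ge> m \<Longrightarrow> \<not> R1.stuck s (R1.piece \<alpha> s)" by blast
  have mono: "R1.gain \<alpha> s \<le> R1.gain \<alpha> (Suc s)" if "s \<ge> m" for s
    using R1.gain_step(2,3)[OF m[OF that]] R1.gain_pos[of \<alpha> s]
    by (cases "prefix_of \<alpha> (lev s) \<in> set (bet1 s (R1.piece \<alpha> s))") auto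
  have dbl: "\<exists>s\<ge>k. 2 * R1.gain \<alpha> s \<le> R1.gain \<alpha> (Suc s)" for k
  proof (rule ccontr)
    assume none: "\<not> ?thesis"
    define n where "n = max k m"
    have no_bet: "prefix_of \<alpha> (lev s) \<notin> set (bet1 s (R1.piece \<alpha> s))" if "s \<ge> n" for s
      using none that m[of s] R1.gain_step(2)[of s \<alpha>] unfolding n_def by fastforce
    \<comment> \<open>Without further bets the awaited component no longer changes; a nonrandom
      sequence is eventually hit by it at every stage.\<close>
    have cls: "cls (R1.piece \<alpha> s) = cls (R1.piece \<alpha> n)" if "s \<ge> n" for s
      using that
    proof (induction rule: dec_induct)
      case (step s)
      then show ?case using R1.piece_step(3)[OF m no_bet, of s] by (simp add: n_def)
    qed simp
    define q where "q = cls (R1.piece \<alpha> n)"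
    obtain s0 where s0: "\<And>s. s \<ge> s0 \<Longrightarrow> hit (2 * q + 9) s (prefix_of \<alpha> (lev s))"
      using not_random_hit[OF assms] by blast
    define s where "s = max n s0"
    have "prefix_of \<alpha> (lev s) \<in> set (bet1 s (R1.piece \<alpha> s))"
      using s0[of s] cls[of s] R1.prefix_in_piece[of \<alpha> s] by (simp add: bet1_def q_def s_def)
    then show False using no_bet[of s] by (simp add: s_def)
  qed
  have "\<exists>s. B < R1.gain \<alpha> s" for B
    by (rule unbounded_if_doubling[of m]) (use mono dbl R1.gain_pos in blast)+
  then show ?thesis using R1.succeeds_if_gain_unbounded by blast
qed

theorem theorem1:
  shows "\<exists>R1 R2 :: strategy.
    sequence_set_betting_strategy R1 \<and> total_strategy R1 \<and> computable_strategy R1 \<and>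
    sequence_set_betting_strategy R2 \<and> total_strategy R2 \<and> computable_strategy R2 \<and>
    (\<forall>\<alpha> :: seq. \<not> martin_loef_random \<alpha> \<longrightarrow> succeeds R1 \<alpha> \<or> succeeds R2 \<alpha>)"
proof (intro exI conjI allI impI)
  show "computable_strategy R1.strat"
    by (intro R1.computable_strat comput_fst comput_state comput_id)
  show "computable_strategy R2.strat"
    by (intro R2.computable_strat comput_snd comput_state comput_id)
qed (use R1.sequence_set_strat R2.sequence_set_strat R1.total_strat R2.total_strat some_strategy_succeeds in auto)

end
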